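(* Let $0<q\le 1$ and suppose that $\mathcal{A}$ is a proper $q$-Banach subalgebra of $\mathcal{B}(\ell^2(\mathbb{G}))$, that $A,B,Q,R\in\mathcal{A}$, and that $Q$ and $R$ are positive and strictly positive on $\ell^2(\mathbb{G})$, respectively. Let $X\in\mathcal{B}(\ell^2(\mathbb{G}))$ be the unique positive definite solution of the Riccati equation $$A^*X+XA-XBR^{-1}B^*X+Q=0.$$ Suppose that at least one of the following holds: (a) $(A,B)$ is exponentially stabilizable, $(A,Q^{1/2})$ is exponentially detectable, and the dual Riccati equation $AY+YA^*-YQY+BR^{-1}B^*=0$ has a self-adjoint solution $Y\in\mathcal{B}(\ell^2(\mathbb{G}))$ such that $I+YX$ is invertible in $\mathcal{B}(\ell^2(\mathbb{G}))$; (b) $(A,B)$ is approximately controllable and $(A,Q^{1/2})$ is exponentially detectable. Then the LQR state feedback gain $K=-R^{-1}B^*X$ belongs to $\mathcal{A}$.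
   Context: $\mathbb{G}\subset\mathbb{Z}^d$ ($d\ge 1$) is the discrete spatial domain, and $\mathcal{B}(\ell^2(\mathbb{G}))$ is the Banach algebra of bounded linear operators on $\ell^2(\mathbb{G})$, identified with (infinite) matrices indexed by $\mathbb{G}\times\mathbb{G}$. An operator $Q$ is positive if it is self-adjoint with $\langle Qx,x\rangle\ge 0$ for all $x$; it is strictly positive if it is self-adjoint and $\langle Qx,x\rangle\ge c\|x\|_2^2$ for some $c>0$ and all $x$. $A$ is exponentially stable on $\mathcal{B}(\ell^2(\mathbb{G}))$ if there are $E,\alpha>0$ with $\|e^{tA}\|_{\mathcal{B}(\ell^2(\mathbb{G}))}\le Ee^{-\alpha t}$ for all $t\ge 0$. $(A,B)$ is exponentially stabilizable if $A+BF$ is exponentially stable on $\mathcal{B}(\ell^2(\mathbb{G}))$ for some bounded $F$; $(A,C)$ is exponentially detectable if $A+LC$ is exponentially stable on $\mathcal{B}(\ell^2(\mathbb{G}))$ for some bounded $L$. $(A,B)$ is approximately controllable if its reachable subspace $$\mathfrak{R}=\Big\{z\in\ell^2(\mathbb{G})\ \Big|\ \exists\,T>0,\ u\in L^2([0,T];\ell^2(\mathbb{G}))\ \text{s.t.}\ z=\int_0^T e^{A(T-\tau)}Bu(\tau)\,d\tau\Big\}$$ is dense in $\ell^2(\mathbb{G})$. The paper takes existence and uniqueness of the positive definite (strictly positive) solution $X$ from classical LQR theory. For $0<q\le 1$, a complex vector space $\mathcal{A}$ of matrices is a $q$-Banach space with $q$-norm $\|\cdot\|_{\mathcal{A}}$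 if it is complete with respect to the metric $d(A,B)=\|A-B\|_{\mathcal{A}}^q$ and, for all $A,B\in\mathcal{A}$, $\alpha\in\mathbb{C}$: (i) $\|A\|_{\mathcal{A}}\ge 0$, with equality iff $A=0$; (ii) $\|\alpha A\|_{\mathcal{A}}=|\alpha|\,\|A\|_{\mathcal{A}}$; (iii) $\|A+B\|_{\mathcal{A}}^q\le\|A\|_{\mathcal{A}}^q+\|B\|_{\mathcal{A}}^q$. A $q$-Banach space $\mathcal{A}$ is a $q$-Banach algebra if it contains the unit element $I$, with $M:=\|I\|_{\mathcal{A}}<\infty$, and there is a constant $K_0>0$ with (iv) $AB\in\mathcal{A}$ and $\|AB\|_{\mathcal{A}}\le K_0\|A\|_{\mathcal{A}}\|B\|_{\mathcal{A}}$ for all $A,B\in\mathcal{A}$. A $q$-Banach algebra $\mathcal{A}$ of matrices on $\mathbb{G}$ is proper (a proper $q$-Banach subalgebra of $\mathcal{B}(\ell^2(\mathbb{G}))$) if: (P1) $A^*\in\mathcal{A}$ and $\|A^*\|_{\mathcal{A}}=\|A\|_{\mathcal{A}}$ for all $A\in\mathcal{A}$; (P2) $\mathcal{A}$ is a subalgebra of $\mathcal{B}(\ell^2(\mathbb{G}))$ and $\|A\|_{\mathcal{B}(\ell^2(\mathbb{G}))}\le\|A\|_{\mathcal{A}}$ for all $A\in\mathcal{A}$; (P3) $\mathcal{A}$ is a differential subalgebra of $\mathcal{B}=\mathcal{B}(\ell^2(\mathbb{G}))$ of some order $\theta\in(0,1]$: there is a constant $D>0$ such that for all $A,B\in\mathcal{A}$,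 $$\|AB\|_{\mathcal{A}}^q\le D\,\|A\|_{\mathcal{A}}^q\|B\|_{\mathcal{A}}^q\left(\Big(\tfrac{\|A\|_{\mathcal{B}}}{\|A\|_{\mathcal{A}}}\Big)^{q\theta}+\Big(\tfrac{\|B\|_{\mathcal{B}}}{\|B\|_{\mathcal{A}}}\Big)^{q\theta}\right)$$ (right side read as $0$ if $A=0$ or $B=0$). *)

theory Defs
  imports "HOL-Analysis.Analysis"
begin

typedef 'i ell2 = "{x :: 'i \<Rightarrow> complex. (\<lambda>i. (cmod (x i))\<^sup>2) summable_on UNIV}"
  morphisms coord Abs_ell2
  by (rule exI[of _ "\<lambda>_. 0"]) simp

setup_lifting type_definition_ell2

lemma coord_square_summable: "(\<lambda>i. (cmod (coord x i))\<^sup>2) summable_on A"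
proof -
  have "(\<lambda>i. (cmod (coord x i))\<^sup>2) summable_on UNIV" using coord[of x] by simp
  then show ?thesis by (rule summable_on_subset_banach) simp
qed

lemma ell2_eqI: "(\<And>i. coord x i = coord y i) \<Longrightarrow> x = y"
  by (simp add: coord_inject[symmetric] fun_eq_iff)

lemma square_summable_add:
  fixes x y :: "'i \<Rightarrow> complex"
  assumes "(\<lambda>i. (cmod (x i))\<^sup>2) summable_on UNIV" "(\<lambda>i. (cmod (y i))\<^sup>2) summable_on UNIV"
  shows "(\<lambda>i. (cmod (x i + y i))\<^sup>2) summable_on UNIV"
proof (rule summable_on_comparison_test)
  show "(\<lambda>i. 2 * (cmod (x i))\<^sup>2 + 2 * (cmod (y i))\<^sup>2) summable_on UNIV"
    by (intro summable_on_add summable_on_cmult_right assms)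
  fix i
  have "(cmod (x i + y i))\<^sup>2 \<le> (cmod (x i) + cmod (y i))\<^sup>2"
    by (intro power_mono norm_triangle_ineq) simp
  also have "\<dots> \<le> 2 * (cmod (x i))\<^sup>2 + 2 * (cmod (y i))\<^sup>2"
    using sum_squares_bound[of "cmod (x i)" "cmod (y i)"] by (simp add: power2_sum)
  finally show "(cmod (x i + y i))\<^sup>2 \<le> 2 * (cmod (x i))\<^sup>2 + 2 * (cmod (y i))\<^sup>2" .
qed simp

lemma square_summable_cmult:
  fixes x :: "'i \<Rightarrow> complex"
  assumes "(\<lambda>i. (cmod (x i))\<^sup>2) summable_on UNIV"
  shows "(\<lambda>i. (cmod (c * x i))\<^sup>2) summable_on UNIV"
  by (simp add: norm_mult power_mult_distrib summable_on_cmult_right assms)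

lift_definition cscale :: "complex \<Rightarrow> 'i ell2 \<Rightarrow> 'i ell2" (infixr "*\<^sub>c" 75)
  is "\<lambda>c x i. c * x i"
  by (rule square_summable_cmult)

text \<open>Linear in the first argument, conjugate-linear in the second.\<close>

definition cinner :: "'i ell2 \<Rightarrow> 'i ell2 \<Rightarrow> complex"
  where "cinner x y = (\<Sum>\<^sub>\<infinity>i. coord x i * cnj (coord y i))"

lemma cinner_summable: "(\<lambda>i. coord x i * cnj (coord y i)) summable_on A"
proof (rule abs_summable_summable, rule summable_on_comparison_test)
  show "(\<lambda>i. (cmod (coord x i))\<^sup>2 + (cmod (coord y i))\<^sup>2) summable_on A"
    by (intro summable_on_add coord_square_summable)
  fix i
  have "2 * (cmod (coord x i) * cmod (coord y i)) \<le> (cmod (coord x i))\<^sup>2 + (cmod (coord y i))\<^sup>2"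
    using sum_squares_bound[of "cmod (coord x i)" "cmod (coord y i)"] by (simp add: mult.assoc)
  moreover have "0 \<le> cmod (coord x i) * cmod (coord y i)" by simp
  ultimately have "cmod (coord x i) * cmod (coord y i) \<le> (cmod (coord x i))\<^sup>2 + (cmod (coord y i))\<^sup>2"
    by linarith
  then show "cmod (coord x i * cnj (coord y i)) \<le> (cmod (coord x i))\<^sup>2 + (cmod (coord y i))\<^sup>2"
    by (simp add: norm_mult)
qed simp

instantiation ell2 :: (type) real_vector
begin

lift_definition zero_ell2 :: "'a ell2" is "\<lambda>_. 0" by simp
lift_definition plus_ell2 :: "'a ell2 \<Rightarrow> 'a ell2 \<Rightarrow> 'a ell2" is "\<lambda>x y i. x i + y i"
  by (rule square_summable_add)
lift_definition uminus_ell2 :: "'a ell2 \<Rightarrow> 'a ell2" is "\<lambda>x i. - x i" by simp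
lift_definition minus_ell2 :: "'a ell2 \<Rightarrow> 'a ell2 \<Rightarrow> 'a ell2" is "\<lambda>x y i. x i - y i"
  subgoal for x y using square_summable_add[of x "\<lambda>i. - y i"] by simp
  done
lift_definition scaleR_ell2 :: "real \<Rightarrow> 'a ell2 \<Rightarrow> 'a ell2" is "\<lambda>r x i. r *\<^sub>R x i"
  subgoal for r x using square_summable_cmult[of x "of_real r"] by (simp add: scaleR_conv_of_real)
  done

instance
proof
  fix x y z :: "'a ell2" and r s :: real
  show "x + y + z = x + (y + z)" by transfer (simp add: algebra_simps)
  show "x + y = y + x" by transfer (simp add: algebra_simps)
  show "0 + x = x" by transfer simp
  show "- x + x = 0" by transfer simp
  show "x - y = x + - y" by transfer simp
  show "r *\<^sub>R (x + y) = r *\<^sub>R x + r *\<^sub>R y" by transfer (simp add: algebra_simps)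
  show "(r + s) *\<^sub>R x = r *\<^sub>R x + s *\<^sub>R x" by transfer (simp add: algebra_simps)
  show "r *\<^sub>R s *\<^sub>R x = (r * s) *\<^sub>R x" by transfer simp
  show "1 *\<^sub>R x = x" by transfer simp
qed

end

instantiation ell2 :: (type) real_inner
begin

definition inner_ell2 :: "'a ell2 \<Rightarrow> 'a ell2 \<Rightarrow> real"
  where "inner_ell2 x y = Re (cinner x y)"
definition norm_ell2 :: "'a ell2 \<Rightarrow> real" where "norm_ell2 x = sqrt (inner x x)"
definition sgn_ell2 :: "'a ell2 \<Rightarrow> 'a ell2" where "sgn_ell2 x = x /\<^sub>R norm x"
definition dist_ell2 :: "'a ell2 \<Rightarrow> 'a ell2 \<Rightarrow> real" where "dist_ell2 x y = norm (x - y)"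
definition uniformity_ell2 :: "('a ell2 \<times> 'a ell2) filter"
  where "uniformity_ell2 = (INF e\<in>{0<..}. principal {(x, y). dist x y < e})"
definition open_ell2 :: "'a ell2 set \<Rightarrow> bool"
  where "open_ell2 U \<longleftrightarrow> (\<forall>x\<in>U. \<forall>\<^sub>F (x', y) in uniformity. x' = x \<longrightarrow> y \<in> U)"

instance
proof
  fix x y z :: "'a ell2" and r :: real and U :: "'a ell2 set"
  show "dist x y = norm (x - y)" by (rule dist_ell2_def)
  show "sgn x = x /\<^sub>R norm x" by (rule sgn_ell2_def)
  show "uniformity = (INF e\<in>{0<..}. principal {(x, y :: 'a ell2). dist x y < e})"
    by (rule uniformity_ell2_def)
  show "open U \<longleftrightarrow> (\<forall>x\<in>U. \<forall>\<^sub>F (x', y) in uniformity. x' = x \<longrightarrow> y \<in> U)"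
    by (rule open_ell2_def)
  have "cinner y x = cnj (cinner x y)"
    by (simp add: cinner_def infsum_cnj[symmetric] mult.commute del: infsum_cnj)
  then show "inner x y = inner y x" by (simp add: inner_ell2_def)
  have "cinner (x + y) z = cinner x z + cinner y z"
    unfolding cinner_def
    by (subst infsum_add[symmetric]) (simp_all add: cinner_summable plus_ell2.rep_eq algebra_simps)
  then show "inner (x + y) z = inner x z + inner y z" by (simp add: inner_ell2_def)
  have "cinner (r *\<^sub>R x) y = of_real r * cinner x y"
    unfolding cinner_def
    by (subst infsum_cmult_right'[symmetric]) (simp add: scaleR_ell2.rep_eq scaleR_conv_of_real mult.assoc)
  then show "inner (r *\<^sub>R x) y = r * inner x y" by (simp add: inner_ell2_def)
  have eq: "inner x x = (\<Sum>\<^sub>\<infinity>i. (cmod (coord x i))\<^sup>2)"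
    unfolding inner_ell2_def cinner_def
    by (subst infsum_Re[OF cinner_summable, symmetric])
      (simp add: complex_mult_cnj cmod_power2)
  show "0 \<le> inner x x" unfolding eq by (rule infsum_nonneg) simp
  show "inner x x = 0 \<longleftrightarrow> x = 0"
  proof
    assume "inner x x = 0"
    then have "(cmod (coord x i))\<^sup>2 = 0" for i
      using nonneg_infsum_le_0D[of "\<lambda>i. (cmod (coord x i))\<^sup>2" UNIV i] coord_square_summable[of x]
      unfolding eq by simp
    then show "x = 0" by (intro ell2_eqI) (simp add: zero_ell2.rep_eq)
  next
    assume "x = 0"
    then show "inner x x = 0" unfolding eq by (simp add: zero_ell2.rep_eq)
  qed
  show "norm x = sqrt (inner x x)" by (rule norm_ell2_def)
qed

end

lemma norm_ell2_square: "(norm x)\<^sup>2 = (\<Sum>\<^sub>\<infinity>i. (cmod (coord x i))\<^sup>2)"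
proof -
  have "(norm x)\<^sup>2 = inner x x" by (simp add: power2_norm_eq_inner)
  then show ?thesis
    unfolding inner_ell2_def cinner_def
    by (subst (asm) infsum_Re[OF cinner_summable, symmetric])
      (simp add: complex_mult_cnj cmod_power2)
qed

lemma sum_coord_le: "finite F \<Longrightarrow> (\<Sum>i\<in>F. (cmod (coord x i))\<^sup>2) \<le> (norm x)\<^sup>2"
  unfolding norm_ell2_square
  by (rule finite_sum_le_infsum) (simp_all add: coord_square_summable)

lemma cmod_coord_le: "cmod (coord x i) \<le> norm x"
  using sum_coord_le[of "{i}" x] by (simp add: abs_le_square_iff[symmetric])

instance ell2 :: (type) complete_space
proof
  fix X :: "nat \<Rightarrow> 'a ell2"
  assume X: "Cauchy X"
  have "Cauchy (\<lambda>n. coord (X n) i)" for i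
  proof (rule CauchyI)
    fix e :: real assume "e > 0"
    then obtain M where M: "\<forall>m\<ge>M. \<forall>n\<ge>M. norm (X m - X n) < e" using CauchyD[OF X] by blast
    have "norm (coord (X m) i - coord (X n) i) < e" if "m \<ge> M" "n \<ge> M" for m n
      using M that cmod_coord_le[of "X m - X n" i] by (force simp: minus_ell2.rep_eq)
    then show "\<exists>M. \<forall>m\<ge>M. \<forall>n\<ge>M. norm (coord (X m) i - coord (X n) i) < e" by blast
  qed
  then have "\<exists>l. (\<lambda>n. coord (X n) i) \<longlonglongrightarrow> l" for i
    using Cauchy_convergent convergent_def by blast
  then obtain l where l: "\<And>i. (\<lambda>n. coord (X n) i) \<longlonglongrightarrow> l i" by metis
  have bound: "\<exists>N. \<forall>n\<ge>N. \<forall>F. finite F \<longrightarrow> (\<Sum>i\<in>F. (cmod (coord (X n) i - l i))\<^sup>2) \<le> e\<^sup>2"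
    if "e > 0" for e
  proof -
    obtain N where N: "\<forall>m\<ge>N. \<forall>n\<ge>N. norm (X m - X n) < e" using CauchyD[OF X \<open>e > 0\<close>] by blast
    have "(\<Sum>i\<in>F. (cmod (coord (X n) i - l i))\<^sup>2) \<le> e\<^sup>2" if "n \<ge> N" "finite F" for n F
    proof (rule LIMSEQ_le_const2)
      show "(\<lambda>m. \<Sum>i\<in>F. (cmod (coord (X n) i - coord (X m) i))\<^sup>2)
              \<longlonglongrightarrow> (\<Sum>i\<in>F. (cmod (coord (X n) i - l i))\<^sup>2)"
        by (intro tendsto_intros l)
      have "(\<Sum>i\<in>F. (cmod (coord (X n) i - coord (X m) i))\<^sup>2) \<le> e\<^sup>2" if "m \<ge> N" for m
      proof -
        have "(\<Sum>i\<in>F. (cmod (coord (X n - X m) i))\<^sup>2) \<le> (norm (X n - X m))\<^sup>2"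
          by (rule sum_coord_le) fact
        also have "\<dots> \<le> e\<^sup>2"
          using N \<open>n \<ge> N\<close> that by (intro power_mono) (auto simp: less_imp_le)
        finally show ?thesis by (simp add: minus_ell2.rep_eq)
      qed
      then show "\<exists>N. \<forall>m\<ge>N. (\<Sum>i\<in>F. (cmod (coord (X n) i - coord (X m) i))\<^sup>2) \<le> e\<^sup>2" by blast
    qed
    then show ?thesis by blast
  qed
  have "(\<lambda>i. (cmod (l i))\<^sup>2) summable_on UNIV"
  proof -
    obtain N where N: "\<And>F. finite F \<Longrightarrow> (\<Sum>i\<in>F. (cmod (coord (X N) i - l i))\<^sup>2) \<le> 1"
      using bound[of 1] by fastforce
    have "(\<lambda>i. (cmod (coord (X N) i - l i))\<^sup>2) summable_on UNIV"
      by (rule nonneg_bdd_above_summable_on) (auto intro!: bdd_aboveI[of _ 1] N)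
    then have "(\<lambda>i. (cmod (- (coord (X N) i - l i)))\<^sup>2) summable_on UNIV" 
      by (simp only: norm_minus_cancel)
    from square_summable_add[OF coord_square_summable[of "X N"] this] show ?thesis by simp
  qed
  then have L: "coord (Abs_ell2 l) i = l i" for i by (simp add: Abs_ell2_inverse)
  have "X \<longlonglongrightarrow> Abs_ell2 l"
  proof (rule LIMSEQ_I)
    fix r :: real assume "r > 0"
    then obtain N where
      N: "\<And>n F. n \<ge> N \<Longrightarrow> finite F \<Longrightarrow> (\<Sum>i\<in>F. (cmod (coord (X n) i - l i))\<^sup>2) \<le> (r/2)\<^sup>2"
      using bound[of "r/2"] by auto
    have "norm (X n - Abs_ell2 l) < r" if "n \<ge> N" for n
    proof -
      have "(norm (X n - Abs_ell2 l))\<^sup>2 \<le> (r/2)\<^sup>2"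
        unfolding norm_ell2_square
        by (rule infsum_le_finite_sums[OF coord_square_summable])
          (use N that in \<open>simp add: minus_ell2.rep_eq L\<close>)
      then have "norm (X n - Abs_ell2 l) \<le> r/2"
        by (rule power2_le_imp_le) (use \<open>r > 0\<close> in simp)
      then show ?thesis using \<open>r > 0\<close> by simp
    qed
    then show "\<exists>N. \<forall>n\<ge>N. norm (X n - Abs_ell2 l) < r" by blast
  qed
  then show "convergent X" by (auto simp: convergent_def)
qed

instance ell2 :: (type) banach ..

lift_definition single :: "'i \<Rightarrow> complex \<Rightarrow> 'i ell2" is "\<lambda>i c j. if j = i then c else 0"
  subgoal for i c
    by (rule summable_on_cong_neutral[THEN iffD1, OF _ _ _ summable_on_finite[of "{i}" "\<lambda>_. (cmod c)\<^sup>2"]]) auto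
  done

lemma norm_single_le: "norm (single i c) \<le> cmod c"
proof -
  have "(norm (single i c))\<^sup>2 = (\<Sum>\<^sub>\<infinity>j\<in>{i}. (cmod c)\<^sup>2)"
    unfolding norm_ell2_square by (rule infsum_cong_neutral) (auto simp: single.rep_eq)
  then show ?thesis by simp
qed

lemma single_diff: "single i c - single i d = single i (c - d)"
  by (rule ell2_eqI) (simp add: minus_ell2.rep_eq single.rep_eq)

lemma coord_sum: "coord (\<Sum>k\<in>F. f k) i = (\<Sum>k\<in>F. coord (f k) i)"
  by (induction F rule: infinite_finite_induct) (simp_all add: zero_ell2.rep_eq plus_ell2.rep_eq)

instance ell2 :: (countable) second_countable_topology
proof
  define g :: "('a \<times> rat \<times> rat) \<Rightarrow> 'a ell2"
    where "g = (\<lambda>(i, a, b). single i (Complex (of_rat a) (of_rat b)))"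
  define D where "D = range (\<lambda>xs. sum_list (map g xs))"
  have "countable D" unfolding D_def by simp
  have zero: "0 \<in> closure D"
    unfolding D_def by (rule subsetD[OF closure_subset]) (auto intro!: image_eqI[of _ _ "[]"])
  have add: "x + y \<in> closure D" if xy: "x \<in> closure D" "y \<in> closure D" for x y
  proof -
    from xy obtain u v where u: "\<And>n. u n \<in> D" "u \<longlonglongrightarrow> x" and v: "\<And>n. v n \<in> D" "v \<longlonglongrightarrow> y"
      unfolding closure_sequential by blast
    have "a + b \<in> D" if "a \<in> D" "b \<in> D" for a b
    proof -
      from that obtain xs ys where "a = sum_list (map g xs)" "b = sum_list (map g ys)"
        unfolding D_def by auto
      then have "a + b = sum_list (map g (xs @ ys))" by simp
      then show ?thesis unfolding D_def by blast
    qed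
    then have "\<And>n. u n + v n \<in> D" using u v by blast
    moreover have "(\<lambda>n. u n + v n) \<longlonglongrightarrow> x + y" by (intro tendsto_add u v)
    ultimately show ?thesis
      unfolding closure_sequential by (intro exI[of _ "\<lambda>n. u n + v n"]) simp
  qed
  have single: "single i c \<in> closure D" for i c
    unfolding closure_approachable
  proof (intro allI impI)
    fix e :: real assume "e > 0"
    then obtain a b where a: "\<bar>of_rat a - Re c\<bar> < e/2" and b: "\<bar>of_rat b - Im c\<bar> < e/2"
      using of_rat_dense[of "Re c - e/2" "Re c + e/2"] of_rat_dense[of "Im c - e/2" "Im c + e/2"]
      by (smt (verit) field_sum_of_halves)
    define d where "d = Complex (of_rat a) (of_rat b)"
    have "cmod (d - c) \<le> \<bar>Re (d - c)\<bar> + \<bar>Im (d - c)\<bar>" by (rule cmod_le)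
    also have "\<dots> < e" using a b by (simp add: d_def)
    finally have "dist (single i d) (single i c) < e"
      using norm_single_le[of i "d - c"] by (simp add: dist_norm single_diff)
    moreover have "single i d = sum_list (map g [(i, a, b)])" by (simp add: g_def d_def)
    then have "single i d \<in> D" unfolding D_def by blast
    ultimately show "\<exists>y\<in>D. dist y (single i c) < e" by blast
  qed
  have fin: "(\<Sum>k\<in>F. single k (f k)) \<in> closure D" if "finite F" for F f
    using that by (induction F) (auto intro: zero add single)
  have dense: "x \<in> closure D" for x
  proof -
    have "x \<in> closure (closure D)"
      unfolding closure_approachable
    proof (intro allI impI)
      fix e :: real assume "e > 0"
      then have "e\<^sup>2 / 2 > 0" by simp
      then obtain F where F: "finite F"
          and le: "dist (\<Sum>i\<in>F. (cmod (coord x i))\<^sup>2) ((norm x)\<^sup>2) \<le> e\<^sup>2 / 2"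
        using infsum_finite_approximation[OF coord_square_summable[where x = x and A = UNIV]]
        unfolding norm_ell2_square by metis
      from le \<open>e\<^sup>2 / 2 > 0\<close> have lt: "dist (\<Sum>i\<in>F. (cmod (coord x i))\<^sup>2) ((norm x)\<^sup>2) < e\<^sup>2"
        by linarith
      define y where "y = (\<Sum>k\<in>F. single k (coord x k))"
      have y: "coord y i = (if i \<in> F then coord x i else 0)" for i
        using F by (simp add: y_def coord_sum single.rep_eq)
      have "(norm (y - x))\<^sup>2 = (\<Sum>\<^sub>\<infinity>i\<in>UNIV - F. (cmod (coord x i))\<^sup>2)"
        unfolding norm_ell2_square
        by (rule infsum_cong_neutral) (auto simp: minus_ell2.rep_eq y)
      also have "\<dots> = (norm x)\<^sup>2 - (\<Sum>i\<in>F. (cmod (coord x i))\<^sup>2)"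
        unfolding norm_ell2_square
        by (subst infsum_Diff) (simp_all add: coord_square_summable F)
      also have "\<dots> < e\<^sup>2" using lt by (simp add: dist_real_def)
      finally have "norm (y - x) < e" by (rule power2_less_imp_less) (use \<open>e > 0\<close> in simp)
      then show "\<exists>y\<in>closure D. dist y x < e"
        using fin[OF F] by (auto simp: dist_norm y_def)
    qed
    then show ?thesis by simp
  qed
  define B where "B = (\<lambda>(x, n). ball x (inverse (real (Suc n)))) ` (D \<times> (UNIV :: nat set))"
  have "topological_basis B"
  proof (rule topological_basisI)
    fix U :: "'a ell2 set" and x assume U: "open U" "x \<in> U"
    then obtain e where e: "e > 0" "ball x e \<subseteq> U" using open_contains_ball by blast
    obtain n where n: "inverse (real (Suc n)) < e / 2"
      using reals_Archimedean[of "e/2"] e(1) by auto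
    obtain y where y: "y \<in> D" "dist y x < inverse (real (Suc n))"
      using dense[of x] unfolding closure_approachable by (metis inverse_positive_iff_positive of_nat_0_less_iff zero_less_Suc)
    have "ball y (inverse (real (Suc n))) \<subseteq> ball x e"
    proof
      fix z assume "z \<in> ball y (inverse (real (Suc n)))"
      then have "dist x z < e"
        using dist_triangle[of x z y] y(2) n by (simp add: dist_commute)
      then show "z \<in> ball x e" by simp
    qed
    with e y show "\<exists>B'\<in>B. x \<in> B' \<and> B' \<subseteq> U"
      unfolding B_def by (intro bexI[of _ "ball y (inverse (real (Suc n)))"]) auto
  qed (auto simp: B_def)
  moreover have "countable B" unfolding B_def using \<open>countable D\<close> by auto
  ultimately show "\<exists>B :: 'a ell2 set set. countable B \<and> open = generate_topology B"
    using topological_basis_imp_subbasis by blast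
qed

lemma norm_cscale: "norm (c *\<^sub>c x) = cmod c * norm x"
proof -
  have "(norm (c *\<^sub>c x))\<^sup>2 = (cmod c * norm x)\<^sup>2"
    by (simp add: norm_ell2_square power_mult_distrib cscale.rep_eq norm_mult infsum_cmult_right')
  then show ?thesis by (simp add: power2_eq_iff_nonneg)
qed

lemma bounded_linear_cscale: "bounded_linear ((*\<^sub>c) c)"
proof (rule bounded_linear_intro[where K = "cmod c"])
  fix x y :: "'i ell2" and r
  show "c *\<^sub>c (x + y) = c *\<^sub>c x + c *\<^sub>c y"
    by (rule ell2_eqI) (simp add: cscale.rep_eq plus_ell2.rep_eq algebra_simps)
  show "c *\<^sub>c (r *\<^sub>R x) = r *\<^sub>R (c *\<^sub>c x)"
    by (rule ell2_eqI) (simp add: cscale.rep_eq scaleR_ell2.rep_eq)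
  show "norm (c *\<^sub>c x) \<le> norm x * cmod c" by (simp add: norm_cscale mult.commute)
qed

text \<open>
  For a set \<open>G\<close> of indices, \<open>\<ell>\<^sup>2(G)\<close> is the closed subspace of the families vanishing outside
  \<open>G\<close>, and a bounded operator on \<open>\<ell>\<^sup>2(G)\<close> is represented by its extension by zero to the
  orthogonal complement; in matrix terms, a matrix indexed by \<open>G \<times> G\<close> is padded with zeros. This
  preserves sums, products, adjoints and operator norms. The identity of \<open>\<ell>\<^sup>2(G)\<close> becomes the
  coordinate projection \<open>id_op G\<close>, which is the unit with respect to which inverses and
  exponentials are formed.
\<close>

type_synonym 'i op = "'i ell2 \<Rightarrow>\<^sub>L 'i ell2"

definition ell2_on :: "'i set \<Rightarrow> 'i ell2 set"
  where "ell2_on G = {x. \<forall>i. i \<notin> G \<longrightarrow> coord x i = 0}"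

lift_definition restrict_ell2 :: "'i set \<Rightarrow> 'i ell2 \<Rightarrow> 'i ell2"
  is "\<lambda>G x i. if i \<in> G then x i else 0"
  by (erule summable_on_comparison_test) auto

definition id_op :: "'i set \<Rightarrow> 'i op"
  where "id_op G = Blinfun (restrict_ell2 G)"

lemma id_op_apply [simp]: "blinfun_apply (id_op G) x = restrict_ell2 G x"
proof -
  have "bounded_linear (restrict_ell2 G)"
  proof (rule bounded_linear_intro[where K = 1])
    fix x y :: "'a ell2" and r
    show "restrict_ell2 G (x + y) = restrict_ell2 G x + restrict_ell2 G y"
      by (rule ell2_eqI) (simp add: restrict_ell2.rep_eq plus_ell2.rep_eq)
    show "restrict_ell2 G (r *\<^sub>R x) = r *\<^sub>R restrict_ell2 G x"
      by (rule ell2_eqI) (simp add: restrict_ell2.rep_eq scaleR_ell2.rep_eq)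
    have "(norm (restrict_ell2 G x))\<^sup>2 \<le> (norm x)\<^sup>2"
      unfolding norm_ell2_square
      by (rule infsum_mono[OF coord_square_summable coord_square_summable])
        (simp add: restrict_ell2.rep_eq)
    then have "norm (restrict_ell2 G x) \<le> norm x" by (rule power2_le_imp_le) simp
    then show "norm (restrict_ell2 G x) \<le> norm x * 1" by simp
  qed
  then show ?thesis by (simp add: id_op_def bounded_linear_Blinfun_apply)
qed

definition scale_op :: "complex \<Rightarrow> 'i op \<Rightarrow> 'i op"
  where "scale_op c T = Blinfun (\<lambda>x. c *\<^sub>c blinfun_apply T x)"

lemma scale_op_apply [simp]: "blinfun_apply (scale_op c T) x = c *\<^sub>c blinfun_apply T x"
proof -
  have "bounded_linear (\<lambda>x. c *\<^sub>c blinfun_apply T x)"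
    by (rule bounded_linear_compose[OF bounded_linear_cscale blinfun.bounded_linear_right])
  then show ?thesis by (simp add: scale_op_def bounded_linear_Blinfun_apply)
qed

text \<open>
  The algebra \<open>\<B>(\<ell>\<^sup>2(G))\<close>; the first condition is needed because \<open>\<Rightarrow>\<^sub>L\<close> only provides real
  linearity.
\<close>

definition bounded_ops :: "'i set \<Rightarrow> 'i op set"
  where "bounded_ops G = {T. (\<forall>c x. blinfun_apply T (c *\<^sub>c x) = c *\<^sub>c blinfun_apply T x)
                           \<and> id_op G o\<^sub>L T o\<^sub>L id_op G = T}"

text \<open>
  \<open>THE\<close> below picks a unique object in all the intended cases: adjoints of operators in
  \<open>bounded_ops G\<close>, inverses of invertible operators, positive square roots of positive operators.
\<close>

definition adj :: "'i op \<Rightarrow> 'i op"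
  where "adj T = (THE S. \<forall>x y. cinner (blinfun_apply T x) y = cinner x (blinfun_apply S y))"

definition invertible_op :: "'i set \<Rightarrow> 'i op \<Rightarrow> bool"
  where "invertible_op G T \<longleftrightarrow> (\<exists>S\<in>bounded_ops G. S o\<^sub>L T = id_op G \<and> T o\<^sub>L S = id_op G)"

definition inv_op :: "'i set \<Rightarrow> 'i op \<Rightarrow> 'i op"
  where "inv_op G T = (THE S. S \<in> bounded_ops G \<and> S o\<^sub>L T = id_op G \<and> T o\<^sub>L S = id_op G)"

definition positive_op :: "'i set \<Rightarrow> 'i op \<Rightarrow> bool"
  where "positive_op G T \<longleftrightarrow> T \<in> bounded_ops G \<and> adj T = T
           \<and> (\<forall>x\<in>ell2_on G. 0 \<le> Re (cinner (blinfun_apply T x) x))"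

definition strictly_positive_op :: "'i set \<Rightarrow> 'i op \<Rightarrow> bool"
  where "strictly_positive_op G T \<longleftrightarrow> T \<in> bounded_ops G \<and> adj T = T
           \<and> (\<exists>c>0. \<forall>x\<in>ell2_on G. c * (norm x)\<^sup>2 \<le> Re (cinner (blinfun_apply T x) x))"

definition sqrt_op :: "'i set \<Rightarrow> 'i op \<Rightarrow> 'i op"
  where "sqrt_op G Q = (THE S. positive_op G S \<and> S o\<^sub>L S = Q)"

definition exp_op :: "'i set \<Rightarrow> 'i op \<Rightarrow> 'i op"
  where "exp_op G T = (\<Sum>n. (((o\<^sub>L) T) ^^ n) (id_op G) /\<^sub>R fact n)"

definition exp_stable :: "'i set \<Rightarrow> 'i op \<Rightarrow> bool"
  where "exp_stable G A \<longleftrightarrow>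
    (\<exists>E>0. \<exists>\<alpha>>0. \<forall>t\<ge>0. norm (exp_op G (t *\<^sub>R A)) \<le> E * exp (- \<alpha> * t))"

definition exp_stabilizable :: "'i set \<Rightarrow> 'i op \<Rightarrow> 'i op \<Rightarrow> bool"
  where "exp_stabilizable G A B \<longleftrightarrow> (\<exists>F\<in>bounded_ops G. exp_stable G (A + (B o\<^sub>L F)))"

definition exp_detectable :: "'i set \<Rightarrow> 'i op \<Rightarrow> 'i op \<Rightarrow> bool"
  where "exp_detectable G A C \<longleftrightarrow> (\<exists>L\<in>bounded_ops G. exp_stable G (A + (L o\<^sub>L C)))"

definition L2_controls :: "'i set \<Rightarrow> real \<Rightarrow> (real \<Rightarrow> 'i ell2) set"
  where "L2_controls G T = {u. u \<in> borel_measurable (lebesgue_on {0..T})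
           \<and> (\<forall>\<tau>\<in>{0..T}. u \<tau> \<in> ell2_on G)
           \<and> integrable (lebesgue_on {0..T}) (\<lambda>\<tau>. (norm (u \<tau>))\<^sup>2)}"

definition reachable :: "'i::countable set \<Rightarrow> 'i op \<Rightarrow> 'i op \<Rightarrow> 'i ell2 set"
  where "reachable G A B = {z \<in> ell2_on G. \<exists>T>0. \<exists>u\<in>L2_controls G T.
    z = (LINT \<tau>|lebesgue_on {0..T}.
           blinfun_apply (exp_op G ((T - \<tau>) *\<^sub>R A)) (blinfun_apply B (u \<tau>)))}"

definition approx_controllable :: "'i::countable set \<Rightarrow> 'i op \<Rightarrow> 'i op \<Rightarrow> bool"
  where "approx_controllable G A B \<longleftrightarrow> ell2_on G \<subseteq> closure (reachable G A B)"

text \<open>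
  \<open>N\<close> is the \<open>q\<close>-norm; only its values on \<open>\<A>\<close> matter. Matrices are represented by operators from
  the outset, which is no restriction for the proper algebras below: they are contained in
  \<open>\<B>(\<ell>\<^sup>2(G))\<close>.
\<close>

locale q_Banach_space =
  fixes q :: real and \<A> :: "'i op set" and N :: "'i op \<Rightarrow> real"
  assumes zero_mem: "0 \<in> \<A>"
    and add_mem: "\<lbrakk>A \<in> \<A>; B \<in> \<A>\<rbrakk> \<Longrightarrow> A + B \<in> \<A>"
    and scale_mem: "A \<in> \<A> \<Longrightarrow> scale_op c A \<in> \<A>"
    and N_nonneg: "A \<in> \<A> \<Longrightarrow> 0 \<le> N A"
    and N_eq_0_iff: "A \<in> \<A> \<Longrightarrow> N A = 0 \<longleftrightarrow> A = 0"
    and N_scale: "A \<in> \<A> \<Longrightarrow> N (scale_op c A) = cmod c * N A"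
    and N_triangle: "\<lbrakk>A \<in> \<A>; B \<in> \<A>\<rbrakk> \<Longrightarrow> N (A + B) powr q \<le> N A powr q + N B powr q"
    and complete:
      "\<lbrakk>\<And>n. S n \<in> \<A>; \<forall>e>0. \<exists>M. \<forall>m\<ge>M. \<forall>n\<ge>M. N (S m - S n) powr q < e\<rbrakk>
        \<Longrightarrow> \<exists>L\<in>\<A>. (\<lambda>n. N (S n - L) powr q) \<longlonglongrightarrow> 0"

locale q_Banach_algebra = q_Banach_space q \<A> N
  for G :: "'i set" and q :: real and \<A> :: "'i op set" and N :: "'i op \<Rightarrow> real" +
  assumes unit_mem: "id_op G \<in> \<A>"
    and ex_mult_bound: "\<exists>K\<^sub>0>0. \<forall>A\<in>\<A>. \<forall>B\<in>\<A>. A o\<^sub>L B \<in> \<A> \<and> N (A o\<^sub>L B) \<le> K\<^sub>0 * N A * N B"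

text \<open>
  In the differential-subalgebra condition, \<open>x / 0 = 0\<close> and \<open>0 powr q = 0\<close> make the right-hand side
  \<open>0\<close> when \<open>A = 0\<close> or \<open>B = 0\<close>.
\<close>

locale proper_q_Banach_algebra = q_Banach_algebra G q \<A> N
  for G :: "'i set" and q :: real and \<A> :: "'i op set" and N :: "'i op \<Rightarrow> real" +
  assumes adj_mem: "A \<in> \<A> \<Longrightarrow> adj A \<in> \<A>"
    and N_adj: "A \<in> \<A> \<Longrightarrow> N (adj A) = N A"
    and subset_bounded_ops: "\<A> \<subseteq> bounded_ops G"
    and norm_le_N: "A \<in> \<A> \<Longrightarrow> norm A \<le> N A"
    and differential: "\<exists>\<theta>. 0 < \<theta> \<and> \<theta> \<le> 1 \<and> (\<exists>D>0. \<forall>A\<in>\<A>. \<forall>B\<in>\<A>.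
      N (A o\<^sub>L B) powr q \<le> D * N A powr q * N B powr q
        * ((norm A / N A) powr (q * \<theta>) + (norm B / N B) powr (q * \<theta>)))"

end

(*
  The stable subspace of the Hamiltonian h = (A, -S; -Q, -A'), S = B R^{-1} B' (with ' the adjoint), is the graph of X,
  because detectability and strict positivity of X make the closed loop A - S X stable. The spectral
  projection of h onto this graph belongs to the 2x2 matrices over the algebra: a differential
  subalgebra is closed under inverses and under power series in elements of operator norm < 1, and
  the projection is obtained from a Cayley transform of (1 + t h)^n by such a series. Multiplying
  the projection by its adjoint gives (1; X) g (1, X) with g strictly positive, so that
  X = (X g) g^{-1}.
*)

theory Submission
  imports Defs
begin

section \<open>The Banach algebra of bounded operators on a Hilbert space\<close>

text \<open>\<open>X\<close>, the basis adapted to the two invariant subspaces and the resulting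
  blocks are known only to be bounded. All membership must therefore come from one matrix with
  entries visibly in the algebra: \<open>u = 1 + h H\<close>, with \<open>H\<close> the Hamiltonian
  and \<open>h\<close> a small step. A q-norm with q < 1 need not be locally convex, which makes a
  contour integral for the projection awkward; power series behave well, because the q-th power of a
  q-norm is subadditive. Hence the discrete-time setting: \<open>u\<close> acts on the graph as the
  Euler step \<open>1 + h m\<close>, with \<open>m\<close> the closed loop, and on an invariant
  complement as the adjoint of \<open>1 - h m\<close>. Powers of the former and of the inverse of
  the latter decay, so the Cayley transform of \<open>u ^ n\<close> tends to 1 on the graph and to
  -1 on the complement. It only approximates that reflection; the exact reflection is its sign,
  computed with a binomial square root. A second obstacle is that the unit of the algebra is the
  projection \<open>e\<close> onto the coordinates in \<open>G\<close>. All data are padded with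
  multiples of \<open>1 - e\<close> so that the padded equation has the genuine identity as
  unit.\<close>

class hilbert_space = real_inner + complete_space +
  assumes ex_nonzero: "\<exists>x. x \<noteq> 0"

instance hilbert_space \<subseteq> banach ..

instance prod :: (hilbert_space, hilbert_space) hilbert_space
proof
  obtain x :: 'a where "x \<noteq> 0" using ex_nonzero by blast
  then show "\<exists>z :: 'a \<times> 'b. z \<noteq> 0" by (intro exI[of _ "(x, 0)"]) (simp add: zero_prod_def)
qed

text \<open>
  A copy of the operator type \<open>'v \<Rightarrow>\<^sub>L 'v\<close>: type class instances for multiplication cannot express
  that domain and codomain coincide.
\<close>

typedef (overloaded) 'v endo = "UNIV :: ('v::real_normed_vector \<Rightarrow>\<^sub>L 'v) set"
  morphisms to_blinfun of_blinfun by simp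

setup_lifting type_definition_endo

instantiation endo :: (real_normed_vector) real_vector
begin

lift_definition zero_endo :: "'a endo" is 0 .
lift_definition plus_endo :: "'a endo \<Rightarrow> 'a endo \<Rightarrow> 'a endo" is "(+)" .
lift_definition minus_endo :: "'a endo \<Rightarrow> 'a endo \<Rightarrow> 'a endo" is "(-)" .
lift_definition uminus_endo :: "'a endo \<Rightarrow> 'a endo" is uminus .
lift_definition scaleR_endo :: "real \<Rightarrow> 'a endo \<Rightarrow> 'a endo" is "(*\<^sub>R)" .

instance
  by standard (transfer; simp add: algebra_simps)+

end

instantiation endo :: (real_normed_vector) real_normed_algebra
begin

lift_definition norm_endo :: "'a endo \<Rightarrow> real" is norm .
lift_definition times_endo :: "'a endo \<Rightarrow> 'a endo \<Rightarrow> 'a endo" is "(o\<^sub>L)" .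
definition sgn_endo :: "'a endo \<Rightarrow> 'a endo" where "sgn_endo x = x /\<^sub>R norm x"
definition dist_endo :: "'a endo \<Rightarrow> 'a endo \<Rightarrow> real" where "dist_endo x y = norm (x - y)"
definition uniformity_endo :: "('a endo \<times> 'a endo) filter"
  where "uniformity_endo = (INF e\<in>{0<..}. principal {(x, y). dist x y < e})"
definition open_endo :: "'a endo set \<Rightarrow> bool"
  where "open_endo U \<longleftrightarrow> (\<forall>x\<in>U. \<forall>\<^sub>F (x', y) in uniformity. x' = x \<longrightarrow> y \<in> U)"

instance
proof
  fix a b c :: "'a endo" and r s :: real and U :: "'a endo set"
  show "dist a b = norm (a - b)" by (rule dist_endo_def)
  show "sgn a = a /\<^sub>R norm a" by (rule sgn_endo_def)
  show "uniformity = (INF e\<in>{0<..}. principal {(x, y :: 'a endo). dist x y < e})"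
    by (rule uniformity_endo_def)
  show "open U \<longleftrightarrow> (\<forall>x\<in>U. \<forall>\<^sub>F (x', y) in uniformity. x' = x \<longrightarrow> y \<in> U)"
    by (rule open_endo_def)
  show "a * b * c = a * (b * c)" by transfer (rule blinfun_eqI, simp)
  show "(a + b) * c = a * c + b * c" "a * (b + c) = a * b + a * c"
    "r *\<^sub>R a * b = r *\<^sub>R (a * b)" "a * r *\<^sub>R b = r *\<^sub>R (a * b)"
    by (transfer; intro blinfun_eqI; simp add: blinfun.bilinear_simps)+
  show "norm a = 0 \<longleftrightarrow> a = 0" "norm (a + b) \<le> norm a + norm b"
    "norm (r *\<^sub>R a) = \<bar>r\<bar> * norm a" "norm (a * b) \<le> norm a * norm b"
    by (transfer; simp add: norm_triangle_ineq norm_blinfun_compose)+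
qed

end

lemma dist_to_blinfun: "dist (to_blinfun a) (to_blinfun b) = dist a b"
  by (simp add: dist_norm norm_endo.rep_eq minus_endo.rep_eq)

instance endo :: (banach) banach
proof
  fix X :: "nat \<Rightarrow> 'a endo"
  assume "Cauchy X"
  then have "Cauchy (\<lambda>n. to_blinfun (X n))" by (simp add: Cauchy_def dist_to_blinfun)
  then obtain L where "(\<lambda>n. to_blinfun (X n)) \<longlonglongrightarrow> L" using Cauchy_convergent convergent_def by blast
  then have "X \<longlonglongrightarrow> of_blinfun L"
    unfolding tendsto_iff dist_to_blinfun[symmetric] by (simp add: of_blinfun_inverse)
  then show "convergent X" by (auto simp: convergent_def)
qed

instantiation endo :: (hilbert_space) real_normed_algebra_1
begin

lift_definition one_endo :: "'a endo" is id_blinfun .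

instance
proof
  fix a :: "'a endo"
  show "1 * a = a" "a * 1 = a" by (transfer; intro blinfun_eqI; simp)+
  \<comment> \<open>On a zero space the identity has norm 0 and \<open>norm 1 = 1\<close> fails;
    this is why \<open>hilbert_space\<close> asks for a nonzero vector.\<close>
  obtain x :: 'a where x: "x \<noteq> 0" using ex_nonzero by blast
  have "norm (id_blinfun :: 'a \<Rightarrow>\<^sub>L 'a) \<le> 1" by (rule norm_blinfun_id_le)
  moreover have "1 \<le> norm (id_blinfun :: 'a \<Rightarrow>\<^sub>L 'a)"
    using norm_blinfun[of "id_blinfun :: 'a \<Rightarrow>\<^sub>L 'a" x] x by simp
  ultimately show n: "norm (1 :: 'a endo) = 1" by transfer simp
  show "(0 :: 'a endo) \<noteq> 1" using n by (metis norm_zero zero_neq_one)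
qed

end

section \<open>Action on vectors, Riesz representation and adjoints\<close>

definition app :: "'v::real_normed_vector endo \<Rightarrow> 'v \<Rightarrow> 'v"  (infixr "\<cdot>" 75)
  where "a \<cdot> x = blinfun_apply (to_blinfun a) x"

lemma bounded_bilinear_app: "bounded_bilinear (\<cdot>)"
proof
  fix a b :: "'a endo" and x y r
  show "(a + b) \<cdot> x = a \<cdot> x + b \<cdot> x" "a \<cdot> (x + y) = a \<cdot> x + a \<cdot> y"
    "(r *\<^sub>R a) \<cdot> x = r *\<^sub>R (a \<cdot> x)" "a \<cdot> (r *\<^sub>R x) = r *\<^sub>R (a \<cdot> x)"
    by (simp_all add: app_def plus_endo.rep_eq scaleR_endo.rep_eq blinfun.bilinear_simps)
  show "\<exists>K. \<forall>(a :: 'a endo) x. norm (a \<cdot> x) \<le> norm a * norm x * K"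
    by (intro exI[of _ 1]) (simp add: app_def norm_endo.rep_eq norm_blinfun)
qed

interpretation app: bounded_bilinear "(\<cdot>)" by (rule bounded_bilinear_app)

lemmas app_simps [simp] = app.add_left app.add_right app.diff_left app.diff_right app.minus_left
  app.minus_right app.scaleR_left app.scaleR_right app.zero_left app.zero_right

lemma app_mult [simp]: "(a * b) \<cdot> x = a \<cdot> b \<cdot> x"
  by (simp add: app_def times_endo.rep_eq)

lemma app_one [simp]: "1 \<cdot> x = x"
  by (simp add: app_def one_endo.rep_eq)

lemma norm_app_le: "norm (a \<cdot> x) \<le> norm a * norm x"
  by (simp add: app_def norm_endo.rep_eq norm_blinfun)

lemma endo_eqI: "(\<And>x. a \<cdot> x = b \<cdot> x) \<Longrightarrow> a = b"
  unfolding app_def by (metis blinfun_eqI to_blinfun_inject)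

lemma norm_endo_bound: "0 \<le> M \<Longrightarrow> (\<And>x. norm (a \<cdot> x) \<le> M * norm x) \<Longrightarrow> norm a \<le> M"
  by (simp add: app_def norm_endo.rep_eq norm_blinfun_bound)

definition endo :: "('v::real_normed_vector \<Rightarrow> 'v) \<Rightarrow> 'v endo"
  where "endo f = of_blinfun (Blinfun f)"

lemma app_endo: "bounded_linear f \<Longrightarrow> endo f \<cdot> x = f x"
  by (simp add: app_def endo_def of_blinfun_inverse bounded_linear_Blinfun_apply)

text \<open>The functional \<open>\<parallel>x\<parallel>\<^sup>2 / 2 - f x\<close> attains its minimum at the representing vector.\<close>

lemma riesz_representation:
  fixes f :: "'v::{real_inner, complete_space} \<Rightarrow> real"
  assumes f: "bounded_linear f"
  shows "\<exists>z. \<forall>x. f x = inner z x"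
proof -
  interpret f: bounded_linear f by fact
  define g where "g x = (norm x)\<^sup>2 / 2 - f x" for x
  obtain K where K: "\<And>x. norm (f x) \<le> norm x * K" using f.bounded by blast
  have "- (K\<^sup>2 / 2) \<le> g x" for x
  proof -
    have "f x \<le> norm x * K" using K[of x] by simp
    moreover have "0 \<le> (norm x - K)\<^sup>2" by simp
    ultimately show ?thesis by (simp add: g_def power2_diff)
  qed
  then have bdd: "bdd_below (range g)" by (intro bdd_belowI[of _ "- (K\<^sup>2 / 2)"]) auto
  define m where "m = Inf (range g)"
  have m: "m \<le> g x" for x unfolding m_def using bdd by (intro cInf_lower) auto
  have "\<exists>x. g x < m + 1 / real (Suc n)" for n
    using cInf_lessD[of "range g" "m + 1 / real (Suc n)"] by (auto simp: m_def)
  then obtain X where X: "\<And>n. g (X n) < m + 1 / real (Suc n)" by metis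
  \<comment> \<open>Parallelogram law: the linear part cancels, and the midpoint cannot undercut the
    infimum, so near-minimizers are close to each other.\<close>
  have mid: "(norm (x - y))\<^sup>2 = 4 * (g x + g y - 2 * g ((x + y) /\<^sub>R 2))" for x y
  proof -
    have "(norm ((x + y) /\<^sub>R 2))\<^sup>2 = (norm (x + y))\<^sup>2 / 4" by (simp add: power_divide)
    moreover have "f ((x + y) /\<^sub>R 2) = (f x + f y) / 2" by (simp add: f.scaleR f.add)
    moreover have "(norm (x + y))\<^sup>2 + (norm (x - y))\<^sup>2 = 2 * (norm x)\<^sup>2 + 2 * (norm y)\<^sup>2"
      by (simp add: power2_norm_eq_inner inner_add_left inner_add_right inner_diff_left
          inner_diff_right inner_commute)
    ultimately show ?thesis unfolding g_def by (simp add: field_simps)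
  qed
  have "Cauchy X"
  proof (rule metric_CauchyI)
    fix e :: real assume e: "0 < e"
    obtain N where N: "1 / real (Suc N) < e\<^sup>2 / 8"
      using nat_approx_posE[of "e\<^sup>2 / 8"] e by auto
    have "dist (X i) (X j) < e" if "i \<ge> N" "j \<ge> N" for i j
    proof -
      have "1 / real (Suc i) \<le> 1 / real (Suc N)" "1 / real (Suc j) \<le> 1 / real (Suc N)"
        using that by (simp_all add: field_simps)
      then have "g (X i) + g (X j) - 2 * g ((X i + X j) /\<^sub>R 2) < e\<^sup>2 / 4"
        using X[of i] X[of j] m[of "(X i + X j) /\<^sub>R 2"] N by linarith
      moreover have "4 * s < e\<^sup>2" if "s < e\<^sup>2 / 4" for s using that by linarith
      ultimately have "(norm (X i - X j))\<^sup>2 < e\<^sup>2" unfolding mid by blast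
      then show ?thesis unfolding dist_norm by (rule power2_less_imp_less) (use e in simp)
    qed
    then show "\<exists>M. \<forall>m\<ge>M. \<forall>n\<ge>M. dist (X m) (X n) < e" by blast
  qed
  then obtain z where z: "X \<longlonglongrightarrow> z" using Cauchy_convergent convergent_def by blast
  have "(\<lambda>n. g (X n)) \<longlonglongrightarrow> g z" unfolding g_def by (intro tendsto_intros f.tendsto z) simp
  moreover have "(\<lambda>n. m + 1 / real (Suc n)) \<longlonglongrightarrow> m + 0"
    by (intro tendsto_add tendsto_const LIMSEQ_Suc[OF lim_1_over_n])
  ultimately have "g z \<le> m + 0" by (rule LIMSEQ_le) (use X less_imp_le in blast)
  then have min: "g z \<le> g y" for y using m[of y] by simp
  have "f x = inner z x" for x
  proof -
    \<comment> \<open>\<open>d\<close> is the derivative of \<open>g\<close> at the minimizer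
      \<open>z\<close> in direction \<open>x\<close>.\<close>
    define d where "d = inner z x - f x"
    have "0 \<le> t * d + t\<^sup>2 * (norm x)\<^sup>2 / 2" for t
    proof -
      have "(norm (z + t *\<^sub>R x))\<^sup>2 = (norm z)\<^sup>2 + 2 * t * inner z x + t\<^sup>2 * (norm x)\<^sup>2"
        unfolding power2_norm_eq_inner
        by (simp add: inner_add_left inner_add_right inner_commute power2_eq_square algebra_simps)
      then show ?thesis
        using min[of "z + t *\<^sub>R x"]
        by (simp add: g_def d_def f.add f.scaleR algebra_simps add_divide_distrib)
    qed
    note nonneg = this
    \<comment> \<open>The test value \<open>t = - d / M\<close> would be optimal for
      \<open>M = (norm x)\<^sup>2\<close>; the added 1 avoids dividing by zero.\<close>
    define M where "M = 1 + (norm x)\<^sup>2"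
    have M: "0 < M" "(norm x)\<^sup>2 \<le> M" unfolding M_def by (smt (verit) zero_le_power2)+
    have "0 \<le> (- d / M) * d + (- d / M)\<^sup>2 * (norm x)\<^sup>2 / 2" by (rule nonneg)
    also have "\<dots> = - (d\<^sup>2 / M) + d\<^sup>2 / M * ((norm x)\<^sup>2 / M) / 2" by (simp add: power2_eq_square)
    also have "\<dots> \<le> - (d\<^sup>2 / M) + d\<^sup>2 / M * 1 / 2"
      using M by (intro add_left_mono divide_right_mono mult_left_mono) simp_all
    finally have "d\<^sup>2 \<le> 0" using M by (simp add: field_simps)
    then show ?thesis by (simp add: d_def)
  qed
  then show ?thesis by blast
qed

definition adjoint_endo :: "'v::hilbert_space endo \<Rightarrow> 'v endo"  ("_\<^sup>\<dagger>" [1000] 1000)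
  where "a\<^sup>\<dagger> = endo (\<lambda>y. SOME z. \<forall>x. inner (a \<cdot> x) y = inner x z)"

lemma inner_app_le: "inner (a \<cdot> x) y \<le> norm a * norm x * norm y"
  using norm_cauchy_schwarz[of "a \<cdot> x" y] mult_right_mono[OF norm_app_le[of a x] norm_ge_zero[of y]]
  by linarith

text \<open>\<open>endo\<close> is meaningful only on bounded linear maps, so the pointwise Riesz
  choice must be shown to be one: linearity comes from uniqueness of the representing vector, the
  bound from testing with \<open>f x\<close> itself.\<close>

lemma inner_adjoint: "inner (a\<^sup>\<dagger> \<cdot> x) y = inner x (a \<cdot> y)"
proof -
  define f where "f = (\<lambda>y. SOME z. \<forall>x. inner (a \<cdot> x) y = inner x z)"
  have f: "inner (a \<cdot> x) y = inner x (f y)" for x y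
  proof -
    have "bounded_linear (\<lambda>x. inner (a \<cdot> x) y)"
      by (rule bounded_linear_compose[OF bounded_linear_inner_left app.bounded_linear_right])
    then have "\<exists>z. \<forall>x. inner (a \<cdot> x) y = inner x z"
      using riesz_representation[of "\<lambda>x. inner (a \<cdot> x) y"] by (auto simp: inner_commute)
    then have "\<forall>x. inner (a \<cdot> x) y = inner x (f y)" unfolding f_def by (rule someI_ex)
    then show ?thesis by blast
  qed
  have uniq: "u = v" if "\<And>x. inner x u = inner x v" for u v :: 'a
    using that[of "u - v"] by (metis inner_diff_right inner_eq_zero_iff right_minus_eq)
  have "bounded_linear f"
  proof (rule bounded_linear_intro[where K = "norm a"])
    show "f (x + y) = f x + f y" for x y
      by (rule uniq) (simp add: f[symmetric] inner_add_right)
    show "f (r *\<^sub>R x) = r *\<^sub>R f x" for r x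
      by (rule uniq) (simp add: f[symmetric])
    show "norm (f x) \<le> norm x * norm a" for x
    proof (cases "f x = 0")
      case False
      have "norm (f x) * norm (f x) = inner (a \<cdot> f x) x"
        by (simp add: f flip: power2_norm_eq_inner power2_eq_square)
      also have "\<dots> \<le> norm a * norm (f x) * norm x" by (rule inner_app_le)
      finally show ?thesis using False by (simp add: mult.commute mult.assoc)
    qed simp
  qed
  then have "a\<^sup>\<dagger> \<cdot> x = f x" by (simp add: adjoint_endo_def f_def app_endo)
  then show ?thesis using f[of y x] by (simp add: inner_commute)
qed

lemma inner_adjoint': "inner (a \<cdot> x) y = inner x (a\<^sup>\<dagger> \<cdot> y)"
  by (metis inner_adjoint inner_commute)

lemma adjoint_eqI:
  assumes "\<And>x y. inner (a \<cdot> x) y = inner x (b \<cdot> y)"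
  shows "a\<^sup>\<dagger> = b"
proof (rule endo_eqI)
  fix y
  have "inner (a\<^sup>\<dagger> \<cdot> y - b \<cdot> y) (a\<^sup>\<dagger> \<cdot> y - b \<cdot> y) = 0"
    using assms[of "a\<^sup>\<dagger> \<cdot> y - b \<cdot> y" y]
    by (simp add: inner_diff_right inner_adjoint'[symmetric])
  then show "a\<^sup>\<dagger> \<cdot> y = b \<cdot> y" by simp
qed

lemma adjoint_simps [simp]:
  fixes a b :: "'v::hilbert_space endo"
  shows "a\<^sup>\<dagger>\<^sup>\<dagger> = a" "(a * b)\<^sup>\<dagger> = b\<^sup>\<dagger> * a\<^sup>\<dagger>" "(a + b)\<^sup>\<dagger> = a\<^sup>\<dagger> + b\<^sup>\<dagger>" "(a - b)\<^sup>\<dagger> = a\<^sup>\<dagger> - b\<^sup>\<dagger>"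
    "(r *\<^sub>R a)\<^sup>\<dagger> = r *\<^sub>R a\<^sup>\<dagger>" "(- a)\<^sup>\<dagger> = - a\<^sup>\<dagger>" "1\<^sup>\<dagger> = (1 :: 'v endo)" "0\<^sup>\<dagger> = (0 :: 'v endo)"
  by (rule adjoint_eqI; simp only: inner_adjoint; fail)
    (rule adjoint_eqI; simp add: inner_adjoint' inner_add_left inner_add_right
      inner_diff_left inner_diff_right)+

lemma norm_adjoint_le: "norm (a\<^sup>\<dagger>) \<le> norm a"
proof (rule norm_endo_bound)
  fix x
  show "norm (a\<^sup>\<dagger> \<cdot> x) \<le> norm a * norm x"
  proof (cases "a\<^sup>\<dagger> \<cdot> x = 0")
    case False
    have "norm (a\<^sup>\<dagger> \<cdot> x) * norm (a\<^sup>\<dagger> \<cdot> x) = inner (a \<cdot> a\<^sup>\<dagger> \<cdot> x) x"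
      by (simp add: inner_adjoint' flip: power2_norm_eq_inner power2_eq_square)
    also have "\<dots> \<le> norm a * norm (a\<^sup>\<dagger> \<cdot> x) * norm x" by (rule inner_app_le)
    finally show ?thesis using False by (simp add: mult.commute mult.assoc)
  qed simp
qed simp

lemma bounded_linear_adjoint: "bounded_linear adjoint_endo"
  by (rule bounded_linear_intro[where K = 1]) (simp_all add: norm_adjoint_le)

lemma adjoint_power: "(a ^ n)\<^sup>\<dagger> = (a\<^sup>\<dagger>) ^ n"
  by (induction n) (simp_all add: power_commutes)

lemma adjoint_suminf: "summable f \<Longrightarrow> (\<Sum>n. f n)\<^sup>\<dagger> = (\<Sum>n. (f n)\<^sup>\<dagger>)"
  using bounded_linear.suminf[OF bounded_linear_adjoint] by metis

lemma adjoint_exp: "(exp a)\<^sup>\<dagger> = exp (a\<^sup>\<dagger>)"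
  unfolding exp_def
  by (subst adjoint_suminf) (simp_all add: adjoint_power summable_exp_generic)

section \<open>Positive and coercive operators\<close>

definition positive_endo :: "'v::hilbert_space endo \<Rightarrow> bool"
  where "positive_endo a \<longleftrightarrow> a\<^sup>\<dagger> = a \<and> (\<forall>x. 0 \<le> inner (a \<cdot> x) x)"

definition coercive_endo :: "'v::hilbert_space endo \<Rightarrow> bool"
  where "coercive_endo a \<longleftrightarrow> (\<exists>c>0. \<forall>x. c * (norm x)\<^sup>2 \<le> inner (a \<cdot> x) x)"

text \<open>Positivity is tested at \<open>x - (1 / M) *\<^sub>R (a \<cdot> x)\<close>. This gives
  the form inequality a^2 \<le> M a before square roots are available; their construction relies on
  it.\<close>

lemma positive_endo_square_le:
  assumes "positive_endo a" and "norm a \<le> M"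
  shows "(norm (a \<cdot> x))\<^sup>2 \<le> M * inner (a \<cdot> x) x"
proof (cases "M = 0")
  case True
  then have "a = 0" using assms(2) by simp
  then show ?thesis by simp
next
  case False
  then have M: "0 < M" using assms(2) norm_ge_zero[of a] by linarith
  have sym: "inner (a \<cdot> u) v = inner u (a \<cdot> v)" for u v
    using assms(1) inner_adjoint'[of a u v] by (simp add: positive_endo_def)
  let ?y = "x - (1 / M) *\<^sub>R (a \<cdot> x)"
  have "0 \<le> inner (a \<cdot> ?y) ?y" using assms(1) unfolding positive_endo_def by blast
  also have "\<dots> = inner (a \<cdot> x) x - 2 / M * (norm (a \<cdot> x))\<^sup>2
      + inner (a \<cdot> a \<cdot> x) (a \<cdot> x) / M\<^sup>2"
  proof -
    have "inner (a \<cdot> a \<cdot> x) x = (norm (a \<cdot> x))\<^sup>2" by (simp add: sym power2_norm_eq_inner)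
    then show ?thesis
      by (simp add: inner_diff_left inner_diff_right power2_norm_eq_inner[of "a \<cdot> x"]
          power2_eq_square[of M] sym[of x "a \<cdot> x", symmetric] inner_commute[of x] algebra_simps)
  qed
  also have "inner (a \<cdot> a \<cdot> x) (a \<cdot> x) \<le> M * (norm (a \<cdot> x))\<^sup>2"
  proof -
    have "inner (a \<cdot> a \<cdot> x) (a \<cdot> x) \<le> norm a * norm (a \<cdot> x) * norm (a \<cdot> x)" by (rule inner_app_le)
    also have "\<dots> \<le> M * norm (a \<cdot> x) * norm (a \<cdot> x)" using assms(2) by (intro mult_right_mono) auto
    finally show ?thesis by (simp add: power2_eq_square mult.assoc)
  qed
  finally have "0 \<le> inner (a \<cdot> x) x - 2 / M * (norm (a \<cdot> x))\<^sup>2 + M * (norm (a \<cdot> x))\<^sup>2 / M\<^sup>2"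
    using M by (simp add: divide_right_mono)
  also have "M * (norm (a \<cdot> x))\<^sup>2 / M\<^sup>2 = (norm (a \<cdot> x))\<^sup>2 / M" using M by (simp add: power2_eq_square)
  finally show ?thesis using M by (simp add: field_simps)
qed

section \<open>Square roots by the binomial series\<close>

text \<open>Taylor coefficients of (1 - z)^(1/2) at 0.\<close>

definition sqrt_coeff :: "nat \<Rightarrow> real"
  where "sqrt_coeff n = ((1/2) gchoose n) * (-1) ^ n"

lemma sqrt_coeff_0 [simp]: "sqrt_coeff 0 = 1"
  by (simp add: sqrt_coeff_def)

lemma gbinomial_Suc_mult: "((a::real) gchoose Suc n) * (-1) ^ Suc n
    = (a gchoose n) * (-1) ^ n * ((real n - a) / real (Suc n))"
proof -
  define c where "c = (real n - a) / real (Suc n)"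
  have "(a gchoose Suc n) = - ((a gchoose n) * c)"
    using gbinomial_mult_1[of a n] by (simp add: c_def field_simps)
  then show ?thesis unfolding c_def[symmetric] by simp
qed

lemma sqrt_coeff_Suc_nonpos: "sqrt_coeff (Suc n) \<le> 0"
proof (induction n)
  case (Suc n)
  have "0 \<le> (real (Suc n) - 1/2) / real (Suc (Suc n))" by simp
  then show ?case
    using Suc unfolding sqrt_coeff_def gbinomial_Suc_mult[of "1/2" "Suc n"]
    by (rule mult_nonpos_nonneg[rotated])
qed (simp add: sqrt_coeff_def)

text \<open>Summing coefficients amounts to dividing by 1 - z: the partial sum is the n-th
  coefficient of (1 - z)^(-1/2), which is nonnegative.\<close>

lemma sum_sqrt_coeff_nonneg: "0 \<le> (\<Sum>k\<le>n. sqrt_coeff k)"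
proof -
  have "(\<Sum>k\<le>n. sqrt_coeff k) = (-1) ^ n * ((-1/2) gchoose n)"
    using gbinomial_sum_lower_neg[of "1/2 :: real" n] by (simp add: sqrt_coeff_def)
  also have "\<dots> \<ge> 0"
  proof (induction n)
    case (Suc n)
    then show ?case
      using gbinomial_Suc_mult[of "-1/2" n] by (simp add: mult.commute del: power_Suc)
  qed simp
  finally show ?thesis .
qed

text \<open>Only the constant term 1 is positive and partial sums stay nonnegative, so the other
  terms have total modulus at most 1. Hence absolute convergence on the closed unit ball, boundary
  included.\<close>

lemma sum_abs_sqrt_coeff_le: "(\<Sum>k<n. \<bar>sqrt_coeff (Suc k)\<bar>) \<le> 1"
proof -
  have "(\<Sum>k<n. \<bar>sqrt_coeff (Suc k)\<bar>) = - (\<Sum>k<n. sqrt_coeff (Suc k))"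
    by (simp add: abs_of_nonpos sqrt_coeff_Suc_nonpos sum_negf)
  also have "\<dots> = 1 - (\<Sum>k<Suc n. sqrt_coeff k)"
    by (subst sum.lessThan_Suc_shift) simp
  also have "\<dots> \<le> 1" using sum_sqrt_coeff_nonneg[of n] by (simp only: lessThan_Suc_atMost)
  finally show ?thesis .
qed

lemma summable_abs_sqrt_coeff: "summable (\<lambda>n. \<bar>sqrt_coeff n\<bar>)"
  by (subst summable_Suc_iff[symmetric], rule summableI_nonneg_bounded[where x = 1])
    (simp_all add: sum_abs_sqrt_coeff_le)

lemma suminf_abs_sqrt_coeff_le: "(\<Sum>n. \<bar>sqrt_coeff (Suc n)\<bar>) \<le> 1"
  using summable_abs_sqrt_coeff summable_Suc_iff[of "\<lambda>n. \<bar>sqrt_coeff n\<bar>"]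
  by (intro suminf_le_const sum_abs_sqrt_coeff_le) auto

lemma abs_sqrt_coeff_le: "\<bar>sqrt_coeff n\<bar> \<le> 1"
proof (cases n)
  case (Suc m)
  have "\<bar>sqrt_coeff (Suc m)\<bar> \<le> (\<Sum>k<Suc m. \<bar>sqrt_coeff (Suc k)\<bar>)"
    by (rule member_le_sum) auto
  then show ?thesis unfolding Suc using sum_abs_sqrt_coeff_le[of "Suc m"] by linarith
qed simp

definition sqrt_series :: "'a::{real_normed_algebra_1, banach} \<Rightarrow> 'a"
  where "sqrt_series x = (\<Sum>n. sqrt_coeff n *\<^sub>R x ^ n)"

lemma norm_sqrt_term_le:
  fixes x :: "'a::{real_normed_algebra_1, banach}"
  assumes "norm x \<le> 1"
  shows "norm (sqrt_coeff n *\<^sub>R x ^ n) \<le> \<bar>sqrt_coeff n\<bar>"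
proof -
  have "norm (x ^ n) \<le> 1" using norm_power_ineq[of x n] power_le_one[OF norm_ge_zero assms, of n] by linarith
  then show ?thesis by (simp add: mult_left_le)
qed

lemma summable_norm_sqrt_series:
  fixes x :: "'a::{real_normed_algebra_1, banach}"
  assumes "norm x \<le> 1"
  shows "summable (\<lambda>n. norm (sqrt_coeff n *\<^sub>R x ^ n))"
proof (rule summable_comparison_test'[OF summable_abs_sqrt_coeff, of 0])
  show "norm (norm (sqrt_coeff n *\<^sub>R x ^ n)) \<le> \<bar>sqrt_coeff n\<bar>" for n
    using norm_sqrt_term_le[OF assms] by (simp only: real_norm_def abs_norm_cancel)
qed

lemma summable_sqrt_series:
  fixes x :: "'a::{real_normed_algebra_1, banach}"
  shows "norm x \<le> 1 \<Longrightarrow> summable (\<lambda>n. sqrt_coeff n *\<^sub>R x ^ n)"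
  by (rule summable_norm_cancel[OF summable_norm_sqrt_series])

text \<open>In the Cauchy product the coefficients combine by Vandermonde to those of (1 - z)^1,
  which are 1, -1, 0, 0, and so on.\<close>

lemma sqrt_series_square:
  assumes "norm x \<le> 1"
  shows "sqrt_series x * sqrt_series x = 1 - x"
proof -
  have "sqrt_series x * sqrt_series x
      = (\<Sum>n. \<Sum>i\<le>n. (sqrt_coeff i *\<^sub>R x ^ i) * (sqrt_coeff (n - i) *\<^sub>R x ^ (n - i)))"
    unfolding sqrt_series_def by (rule Cauchy_product) (rule summable_norm_sqrt_series[OF assms])+
  also have "(\<lambda>n. \<Sum>i\<le>n. (sqrt_coeff i *\<^sub>R x ^ i) * (sqrt_coeff (n - i) *\<^sub>R x ^ (n - i)))
      = (\<lambda>n. if n \<in> {0, 1} then (if n = 0 then 1 else - x) else 0)"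
  proof
    fix n
    have "(\<Sum>i\<le>n. (sqrt_coeff i *\<^sub>R x ^ i) * (sqrt_coeff (n - i) *\<^sub>R x ^ (n - i)))
        = (\<Sum>i\<le>n. sqrt_coeff i * sqrt_coeff (n - i)) *\<^sub>R x ^ n"
      unfolding scaleR_sum_left by (rule sum.cong) (simp_all flip: power_add)
    also have "(\<Sum>i\<le>n. sqrt_coeff i * sqrt_coeff (n - i))
        = (\<Sum>i\<le>n. ((1/2) gchoose i) * ((1/2) gchoose (n - i)) * (-1) ^ n)"
    proof (rule sum.cong)
      fix i assume "i \<in> {..n}"
      then have "(-1 :: real) ^ n = (-1) ^ i * (-1) ^ (n - i)" by (simp flip: power_add)
      then show "sqrt_coeff i * sqrt_coeff (n - i)
          = ((1/2) gchoose i) * ((1/2) gchoose (n - i)) * (-1) ^ n"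
        by (simp add: sqrt_coeff_def)
    qed simp
    also have "\<dots> = (1 gchoose n) * (-1) ^ n"
      using gbinomial_Vandermonde[of "1/2 :: real" "1/2" n]
      by (simp add: atLeast0AtMost flip: sum_distrib_right)
    also have "(1 gchoose n) = real (1 choose n)" by (simp add: binomial_gbinomial)
    finally show "(\<Sum>i\<le>n. (sqrt_coeff i *\<^sub>R x ^ i) * (sqrt_coeff (n - i) *\<^sub>R x ^ (n - i)))
        = (if n \<in> {0, 1} then (if n = 0 then 1 else - x) else 0)"
      by (auto simp: binomial_eq_0)
  qed
  also have "(\<Sum>n. if n \<in> {0, 1} then (if n = 0 then 1 else - x) else 0)
      = (\<Sum>n\<in>{0, 1 :: nat}. if n = 0 then 1 else - x)"
    by (rule sums_unique[symmetric], rule sums_If_finite_set) simp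
  finally show ?thesis by simp
qed

text \<open>With constant 1, the root stays within distance 1 of the identity on the whole closed
  ball; this later gives positivity of the root.\<close>

lemma norm_sqrt_series_diff_one_le:
  assumes "norm x \<le> 1"
  shows "norm (sqrt_series x - 1) \<le> norm x"
proof -
  let ?f = "\<lambda>n. sqrt_coeff n *\<^sub>R x ^ n"
  have le: "norm (?f (Suc n)) \<le> \<bar>sqrt_coeff (Suc n)\<bar> * norm x" for n
  proof -
    have "norm (x ^ n) \<le> 1" using norm_power_ineq[of x n] power_le_one[OF norm_ge_zero assms, of n] by linarith
    then have "norm (x ^ Suc n) \<le> norm x"
      using norm_mult_ineq[of x "x ^ n"] mult_left_le[of "norm (x ^ n)" "norm x"] by simp
    then show ?thesis by (simp add: mult_left_mono del: power_Suc)
  qed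
  have sm: "summable (\<lambda>n. \<bar>sqrt_coeff (Suc n)\<bar>)"
    using summable_abs_sqrt_coeff summable_Suc_iff[of "\<lambda>n. \<bar>sqrt_coeff n\<bar>"] by simp
  have "sqrt_series x - 1 = (\<Sum>n. ?f (Suc n))"
    unfolding sqrt_series_def using suminf_split_head[OF summable_sqrt_series[OF assms]] by simp
  also have "norm \<dots> \<le> (\<Sum>n. \<bar>sqrt_coeff (Suc n)\<bar> * norm x)"
    by (rule norm_suminf_le[OF le summable_mult2[OF sm]])
  also have "\<dots> = (\<Sum>n. \<bar>sqrt_coeff (Suc n)\<bar>) * norm x"
    by (rule suminf_mult2[OF sm, symmetric])
  also have "\<dots> \<le> 1 * norm x" by (intro mult_right_mono suminf_abs_sqrt_coeff_le norm_ge_zero)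
  finally show ?thesis by simp
qed

lemma sqrt_series_commute:
  assumes "norm x \<le> 1" and "x * y = y * x"
  shows "sqrt_series x * y = y * sqrt_series x"
proof -
  have "x ^ n * y = y * x ^ n" for n
    by (induction n) (simp_all add: mult.assoc assms(2), metis assms(2) mult.assoc)
  then show ?thesis
    unfolding sqrt_series_def
    by (simp add: suminf_mult2[OF summable_sqrt_series[OF assms(1)]]
        suminf_mult[OF summable_sqrt_series[OF assms(1)], symmetric])
qed

section \<open>Neumann series\<close>

lemma norm_lt_one_inverse:
  fixes x :: "'a::{real_normed_algebra_1, banach}"
  assumes "norm x < 1"
  shows "(1 - x) * (\<Sum>n. x ^ n) = 1" "(\<Sum>n. x ^ n) * (1 - x) = 1"
proof -
  have sm: "summable (\<lambda>n. x ^ n)" by (rule complete_algebra_summable_geometric[OF assms])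
  have "(\<lambda>n. x ^ n - x ^ Suc n) sums (x ^ 0 - 0)"
    by (intro telescope_sums' summable_LIMSEQ_zero sm)
  then have one: "(\<Sum>n. x ^ n - x ^ Suc n) = 1" using sums_unique by fastforce
  have "(\<lambda>n. (1 - x) * x ^ n) = (\<lambda>n. x ^ n - x ^ Suc n)"
    "(\<lambda>n. x ^ n * (1 - x)) = (\<lambda>n. x ^ n - x ^ Suc n)"
    by (simp_all add: algebra_simps power_commutes)
  then show "(1 - x) * (\<Sum>n. x ^ n) = 1" "(\<Sum>n. x ^ n) * (1 - x) = 1"
    using one by (simp_all only: suminf_mult[OF sm, symmetric] suminf_mult2[OF sm])
qed

section \<open>Differential subalgebras\<close>

text \<open>
  \<open>\<nu>\<close> plays the role of the \<open>q\<close>-th power of a \<open>q\<close>-norm. The condition \<open>differential\<close> is stated with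
  common bounds for both factors, a form that passes to matrices over the subalgebra.
\<close>

locale differential_subalgebra =
  fixes S :: "'a::{real_normed_algebra_1, banach} set" and \<nu> :: "'a \<Rightarrow> real"
    and q \<theta> D K :: real
  assumes q_pos: "0 < q" and \<theta>_pos: "0 < \<theta>" and \<theta>_le: "\<theta> \<le> 1" and D_pos: "0 < D" and K_pos: "0 < K"
    and one: "1 \<in> S"
    and add: "\<lbrakk>a \<in> S; b \<in> S\<rbrakk> \<Longrightarrow> a + b \<in> S"
    and scaleR: "a \<in> S \<Longrightarrow> r *\<^sub>R a \<in> S"
    and mult: "\<lbrakk>a \<in> S; b \<in> S\<rbrakk> \<Longrightarrow> a * b \<in> S"
    and \<nu>_zero: "\<nu> 0 = 0"
    and \<nu>_nonneg: "a \<in> S \<Longrightarrow> 0 \<le> \<nu> a"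
    and \<nu>_add: "\<lbrakk>a \<in> S; b \<in> S\<rbrakk> \<Longrightarrow> \<nu> (a + b) \<le> \<nu> a + \<nu> b"
    and \<nu>_scaleR: "\<lbrakk>a \<in> S; \<bar>r\<bar> \<le> 1\<rbrakk> \<Longrightarrow> \<nu> (r *\<^sub>R a) \<le> \<nu> a"
    and \<nu>_mult: "\<lbrakk>a \<in> S; b \<in> S\<rbrakk> \<Longrightarrow> \<nu> (a * b) \<le> K * \<nu> a * \<nu> b"
    and differential: "\<lbrakk>a \<in> S; b \<in> S; \<nu> a \<le> t; \<nu> b \<le> t; norm a \<le> m; norm b \<le> m\<rbrakk>
      \<Longrightarrow> \<nu> (a * b) \<le> D * t powr (2 - \<theta>) * m powr (q * \<theta>)"
    and closed: "\<lbrakk>\<And>n. s n \<in> S; \<And>e. 0 < e \<Longrightarrow> \<exists>M. \<forall>m\<ge>M. \<forall>n\<ge>M. \<nu> (s m - s n) < e; s \<longlonglongrightarrow> l\<rbrakk>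
      \<Longrightarrow> l \<in> S"
begin

lemma zero: "0 \<in> S" using scaleR[OF one, of 0] by simp
lemma minus: "a \<in> S \<Longrightarrow> - a \<in> S" using scaleR[of a "-1"] by simp
lemma diff: "\<lbrakk>a \<in> S; b \<in> S\<rbrakk> \<Longrightarrow> a - b \<in> S" using add[of a "- b"] minus[of b] by simp
lemma power: "a \<in> S \<Longrightarrow> a ^ n \<in> S" by (induction n) (simp_all add: one mult)
lemma sum: "(\<And>i. i \<in> I \<Longrightarrow> f i \<in> S) \<Longrightarrow> sum f I \<in> S"
  by (induction I rule: infinite_finite_induct) (auto intro: zero add)
lemma \<nu>_sum: "(\<And>i. i \<in> I \<Longrightarrow> f i \<in> S) \<Longrightarrow> \<nu> (sum f I) \<le> (\<Sum>i\<in>I. \<nu> (f i))"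
proof (induction I rule: infinite_finite_induct)
  case (insert i I)
  then show ?case using \<nu>_add[of "f i" "sum f I"] sum[of I f] by simp
qed (simp_all add: \<nu>_zero)

text \<open>
  Repeated squaring: the exponent \<open>2 - \<theta> < 2\<close> makes \<open>\<nu> (x ^ 2 ^ k)\<close> grow like \<open>exp (C k (2 - \<theta>) ^ k)\<close>
  relative to \<open>\<rho> powr (q 2 ^ k)\<close>, so the latter wins.
\<close>

lemma \<nu>_power_two_power_tendsto_zero:
  assumes x: "x \<in> S" "norm x < 1"
  shows "(\<lambda>k. \<nu> (x ^ 2 ^ k)) \<longlonglongrightarrow> 0"
proof -
  \<comment> \<open>The floor 1/2 keeps \<open>\<rho>\<close> positive, so that
    \<open>\<nu> x / \<rho> powr q\<close> and \<open>ln \<rho>\<close> behave even for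
    \<open>x = 0\<close>.\<close>
  define \<rho> where "\<rho> = max (norm x) (1/2)"
  define \<gamma> where "\<gamma> = 2 - \<theta>"
  have \<rho>: "0 < \<rho>" "\<rho> < 1" "norm x \<le> \<rho>" using x by (auto simp: \<rho>_def)
  have \<gamma>: "1 \<le> \<gamma>" "\<gamma> < 2" using \<theta>_pos \<theta>_le by (auto simp: \<gamma>_def)
  define M where "M = max 1 (max D (\<nu> x / \<rho> powr q))"
  have M: "1 \<le> M" "D \<le> M" "\<nu> x \<le> M * \<rho> powr q"
  proof -
    have "\<nu> x = \<nu> x / \<rho> powr q * \<rho> powr q" using \<rho> by simp
    also have "\<dots> \<le> M * \<rho> powr q" unfolding M_def by (intro mult_right_mono) auto
    finally show "\<nu> x \<le> M * \<rho> powr q" .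
  qed (auto simp: M_def)
  \<comment> \<open>Each squaring costs one factor \<open>D\<close>, absorbed through
    \<open>D \<le> M powr (\<gamma> ^ Suc k)\<close>; these factors produce the coefficient
    \<open>k + 1\<close> in the exponent.\<close>
  have bound: "\<nu> (x ^ 2 ^ k) \<le> M powr (real (k + 1) * \<gamma> ^ k) * \<rho> powr (q * 2 ^ k)" for k
  proof (induction k)
    case 0
    then show ?case using M by simp
  next
    case (Suc k)
    let ?t = "M powr (real (k + 1) * \<gamma> ^ k) * \<rho> powr (q * 2 ^ k)"
    have "norm (x ^ 2 ^ k) \<le> \<rho> ^ 2 ^ k"
      using norm_power_ineq[of x "2 ^ k"] power_mono[OF \<rho>(3), of "2 ^ k"] by simp
    then have "\<nu> (x ^ 2 ^ k * x ^ 2 ^ k) \<le> D * ?t powr (2 - \<theta>) * (\<rho> ^ 2 ^ k) powr (q * \<theta>)"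
      by (intro differential power x Suc)
    also have "?t powr (2 - \<theta>) = M powr (real (k + 1) * \<gamma> ^ Suc k) * \<rho> powr (q * 2 ^ k * \<gamma>)"
      by (simp add: powr_mult powr_powr \<gamma>_def[symmetric] mult_ac)
    also have "(\<rho> ^ 2 ^ k) powr (q * \<theta>) = \<rho> powr (q * 2 ^ k * \<theta>)"
      using powr_realpow[OF \<rho>(1), of "2 ^ k", symmetric] by (simp add: powr_powr mult_ac)
    also have "D * (M powr (real (k + 1) * \<gamma> ^ Suc k) * \<rho> powr (q * 2 ^ k * \<gamma>)) * \<rho> powr (q * 2 ^ k * \<theta>)
        = D * M powr (real (k + 1) * \<gamma> ^ Suc k) * \<rho> powr (q * 2 ^ Suc k)"
    proof -
      \<comment> \<open>As \<open>\<gamma> + \<theta> = 2\<close>, the power of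
        \<open>\<rho>\<close> doubles exactly.\<close>
      have "q * 2 ^ Suc k = q * 2 ^ k * \<gamma> + q * 2 ^ k * \<theta>" by (simp add: \<gamma>_def algebra_simps)
      then show ?thesis by (simp only: powr_add mult.assoc)
    qed
    also have "\<dots> \<le> M powr (\<gamma> ^ Suc k) * M powr (real (k + 1) * \<gamma> ^ Suc k) * \<rho> powr (q * 2 ^ Suc k)"
    proof (intro mult_right_mono)
      have "M powr 1 \<le> M powr (\<gamma> ^ Suc k)" using M \<gamma> by (intro powr_mono one_le_power) auto
      then show "D \<le> M powr (\<gamma> ^ Suc k)" using M by simp
    qed simp_all
    also have "M powr (\<gamma> ^ Suc k) * M powr (real (k + 1) * \<gamma> ^ Suc k) = M powr (real (Suc k + 1) * \<gamma> ^ Suc k)"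
    proof -
      have "real (Suc k + 1) * \<gamma> ^ Suc k = \<gamma> ^ Suc k + real (k + 1) * \<gamma> ^ Suc k"
        by (simp add: algebra_simps)
      then show ?thesis by (simp only: powr_add)
    qed
    finally show ?case by (simp only: power_add[symmetric] mult_2[symmetric] power_Suc)
  qed
  \<comment> \<open>\<open>2 * \<delta>\<close> is the decay rate of
    \<open>\<rho> powr (q * 2 ^ k)\<close> per unit of \<open>2 ^ k\<close>. Half of it pays for the
    factor with \<open>M\<close>, whose exponent divided by \<open>2 ^ k\<close> vanishes in the
    limit because \<open>\<gamma> < 2\<close>.\<close>
  define \<delta> where "\<delta> = - (q * ln \<rho>) / 2"
  have \<delta>: "0 < \<delta>" using \<rho> q_pos by (simp add: \<delta>_def mult_pos_neg)
  have "(\<lambda>k. (real k * (\<gamma> / 2) ^ k + (\<gamma> / 2) ^ k) * ln M) \<longlonglongrightarrow> (0 + 0) * ln M"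
    using \<gamma>
    by (intro tendsto_mult[OF _ tendsto_const] tendsto_add[OF powser_times_n_limit_0 LIMSEQ_power_zero])
      auto
  then have "\<forall>\<^sub>F k in sequentially. (real k * (\<gamma> / 2) ^ k + (\<gamma> / 2) ^ k) * ln M < \<delta>"
    by (rule order_tendstoD(2)) (use \<delta> in simp)
  then have "\<forall>\<^sub>F k in sequentially. \<nu> (x ^ 2 ^ k) \<le> exp (- \<delta>) ^ k"
  proof (rule eventually_mono)
    fix k
    assume k: "(real k * (\<gamma> / 2) ^ k + (\<gamma> / 2) ^ k) * ln M < \<delta>"
    have "real (k + 1) * \<gamma> ^ k * ln M + q * 2 ^ k * ln \<rho>
        = 2 ^ k * ((real k * (\<gamma> / 2) ^ k + (\<gamma> / 2) ^ k) * ln M - 2 * \<delta>)"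
    proof -
      have "2 ^ k * (\<gamma> / 2) ^ k = \<gamma> ^ k" by (simp add: power_divide)
      moreover have "T * ((r * p + p) * L - d) = (r + 1) * (T * p) * L - T * d" for T r p L d :: real
        by (simp add: algebra_simps)
      ultimately have eq: "2 ^ k * ((real k * (\<gamma> / 2) ^ k + (\<gamma> / 2) ^ k) * ln M - 2 * \<delta>)
          = (real k + 1) * \<gamma> ^ k * ln M - 2 ^ k * (2 * \<delta>)" by simp
      have d: "2 * \<delta> = - (q * ln \<rho>)" by (simp add: \<delta>_def)
      show ?thesis unfolding eq unfolding d by (simp add: algebra_simps)
    qed
    also have "\<dots> \<le> 2 ^ k * (- \<delta>)" using k by (intro mult_left_mono) auto
    also have "\<dots> \<le> real k * (- \<delta>)" 
      using \<delta> of_nat_less_two_power[of k, where 'a = real] by simp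
    finally have "exp (real (k + 1) * \<gamma> ^ k * ln M + q * 2 ^ k * ln \<rho>) \<le> exp (real k * (- \<delta>))"
      by simp
    then show "\<nu> (x ^ 2 ^ k) \<le> exp (- \<delta>) ^ k"
      using bound[of k] M \<rho> unfolding exp_of_nat_mult by (simp add: powr_def exp_add)
  qed
  then show ?thesis
  proof (rule tendsto_sandwich[where f = "\<lambda>_. 0", rotated])
    show "(\<lambda>k. exp (- \<delta>) ^ k) \<longlonglongrightarrow> 0" using \<delta> by (intro LIMSEQ_power_zero) simp
    show "\<forall>\<^sub>F k in sequentially. 0 \<le> \<nu> (x ^ 2 ^ k)"
      using \<nu>_nonneg[OF power[OF x(1)]] by simp
  qed simp
qed

text \<open>A single power with \<open>K * \<nu> (x ^ m) \<le> 1/2\<close> suffices: division of n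
  by m with remainder gives geometric decay along blocks of length m, and the remainder costs a
  constant.\<close>

lemma summable_\<nu>_power:
  assumes x: "x \<in> S" "norm x < 1"
  shows "summable (\<lambda>n. \<nu> (x ^ n))"
proof -
  have "\<forall>\<^sub>F k in sequentially. \<nu> (x ^ 2 ^ k) < 1 / (2 * K)"
    using K_pos by (intro order_tendstoD(2)[OF \<nu>_power_two_power_tendsto_zero[OF x]]) simp
  then obtain k where k: "\<nu> (x ^ 2 ^ k) < 1 / (2 * K)" using eventually_happens by force
  define m :: nat where "m = 2 ^ k"
  have m: "0 < m" "K * \<nu> (x ^ m) \<le> 1/2" using k K_pos by (auto simp: m_def field_simps)
  define C where "C = (\<Sum>i<m. \<nu> (x ^ i))"
  have C: "\<nu> (x ^ i) \<le> C" if "i < m" for i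
    unfolding C_def using that by (intro member_le_sum) (auto intro: \<nu>_nonneg power x)
  have C0: "0 \<le> C" using C[of 0] m \<nu>_nonneg[OF power[OF x(1)], of 0] by simp
  have blocks: "\<nu> (x ^ (m * j)) \<le> \<nu> 1 * (1/2) ^ j" for j
  proof (induction j)
    case (Suc j)
    have "\<nu> (x ^ (m * Suc j)) = \<nu> (x ^ (m * j) * x ^ m)" by (simp add: algebra_simps flip: power_add)
    also have "\<dots> \<le> K * \<nu> (x ^ (m * j)) * \<nu> (x ^ m)" by (intro \<nu>_mult power x)
    also have "\<dots> = \<nu> (x ^ (m * j)) * (K * \<nu> (x ^ m))" by simp
    also have "\<dots> \<le> (\<nu> 1 * (1/2) ^ j) * (1/2)"
      using K_pos by (intro mult_mono Suc m) (auto intro!: mult_nonneg_nonneg \<nu>_nonneg power x one)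
    finally show ?case by (simp add: mult.assoc)
  qed simp
  \<comment> \<open>\<open>r ^ m = 1/2\<close> spreads the halving per block over single steps; the
    factor 2 below pays for rounding \<open>n / m\<close> down.\<close>
  define r where "r = 2 powr (- 1 / real m)"
  have r: "0 < r" "r < 1" using m by (simp_all add: r_def powr_less_one)
  have "norm (\<nu> (x ^ n)) \<le> K * \<nu> 1 * C * 2 * r ^ n" for n
  proof -
    have "\<nu> (x ^ n) = \<nu> (x ^ (m * (n div m)) * x ^ (n mod m))" by (simp flip: power_add)
    also have "\<dots> \<le> K * \<nu> (x ^ (m * (n div m))) * \<nu> (x ^ (n mod m))" by (intro \<nu>_mult power x)
    also have "\<dots> \<le> K * (\<nu> 1 * (1/2) ^ (n div m)) * C"
      using K_pos m
      by (intro mult_mono blocks C) (auto intro!: mult_nonneg_nonneg \<nu>_nonneg power x one)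
    also have "(1/2 :: real) ^ (n div m) \<le> 2 * r ^ n"
    proof -
      have "real n = real m * real (n div m) + real (n mod m)" by (metis mult_div_mod_eq of_nat_add of_nat_mult)
      moreover have "real (n mod m) \<le> real m" using m by simp
      ultimately have "real n / real m - 1 \<le> real (n div m)" using m by (simp add: field_simps)
      then have "2 powr (- real (n div m)) \<le> 2 powr (1 - real n / real m)" by simp
      also have "\<dots> = 2 * r ^ n"
        by (simp add: r_def powr_diff powr_power powr_minus field_simps)
      finally show ?thesis by (simp add: powr_minus powr_realpow power_one_over inverse_eq_divide)
    qed
    finally show ?thesis
      using K_pos C0 \<nu>_nonneg[OF one] \<nu>_nonneg[OF power[OF x(1)], of n]
      by (simp add: mult_left_mono mult_right_mono mult.assoc mult.left_commute mult.commute)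
  qed
  then show ?thesis
    by (rule summable_comparison_test'[rotated]) (use r in \<open>intro summable_mult summable_geometric, simp\<close>)
qed

text \<open>Coefficients are bounded by 1 because \<open>\<nu>_scaleR\<close> covers exactly such
  scalars. The partial sums are Cauchy for \<nu> and converge in norm, which is what
  \<open>closed\<close> asks for.\<close>

lemma power_series_mem:
  assumes x: "x \<in> S" "norm x < 1" and c: "\<And>n. \<bar>c n\<bar> \<le> 1"
  shows "(\<Sum>n. c n *\<^sub>R x ^ n) \<in> S"
proof (rule closed)
  let ?s = "\<lambda>n. \<Sum>k<n. c k *\<^sub>R x ^ k"
  show mem: "?s n \<in> S" for n by (intro sum scaleR power x)
  have "norm (c n *\<^sub>R x ^ n) \<le> norm x ^ n" for n
    using mult_mono[OF c[of n] norm_power_ineq[of x n]] by simp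
  then have "summable (\<lambda>n. c n *\<^sub>R x ^ n)"
    using x(2) by (intro summable_comparison_test'[OF summable_geometric[of "norm x"]]) auto
  then show "?s \<longlonglongrightarrow> (\<Sum>n. c n *\<^sub>R x ^ n)" by (rule summable_LIMSEQ)
  fix e :: real assume "0 < e"
  then obtain M where M: "\<And>m n. m \<ge> M \<Longrightarrow> norm (\<Sum>k=m..<n. \<nu> (x ^ k)) < e"
    using summable_\<nu>_power[OF x] unfolding summable_Cauchy by meson
  have le: "\<nu> (?s n - ?s m) < e" if "M \<le> m" "m \<le> n" for m n
  proof -
    have "?s n - ?s m = (\<Sum>k=m..<n. c k *\<^sub>R x ^ k)"
      using sum_diff_nat_ivl[of 0 m n "\<lambda>k. c k *\<^sub>R x ^ k"] that by (simp add: lessThan_atLeast0)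
    also have "\<nu> \<dots> \<le> (\<Sum>k=m..<n. \<nu> (c k *\<^sub>R x ^ k))" by (intro \<nu>_sum scaleR power x)
    also have "\<dots> \<le> (\<Sum>k=m..<n. \<nu> (x ^ k))" by (intro sum_mono \<nu>_scaleR power x c)
    also have "\<dots> < e" using M[of m n] that by simp
    finally show ?thesis .
  qed
  have "\<nu> (?s m - ?s n) < e" if "M \<le> m" "M \<le> n" for m n
  proof (cases "m \<le> n")
    case True
    have "\<nu> (?s m - ?s n) = \<nu> ((- 1) *\<^sub>R (?s n - ?s m))" by simp
    also have "\<dots> \<le> \<nu> (?s n - ?s m)" by (intro \<nu>_scaleR diff mem) simp
    finally show ?thesis using le[of m n] that True by simp
  qed (use le that in auto)
  then show "\<exists>M. \<forall>m\<ge>M. \<forall>n\<ge>M. \<nu> (?s m - ?s n) < e" by blast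
qed

lemma inverse_near_one_mem:
  assumes "x \<in> S" and "norm (1 - x) < 1"
  obtains y where "y \<in> S" "x * y = 1" "y * x = 1"
proof -
  let ?y = "\<Sum>n. (1 - x) ^ n"
  have "?y \<in> S" using power_series_mem[of "1 - x" "\<lambda>_. 1"] assms one diff by simp
  then show ?thesis using that norm_lt_one_inverse[OF assms(2)] by simp
qed

text \<open>
  An involution close to \<open>f\<close> is the value at \<open>f\<close> of the sign function \<open>z / sqrt (z\<^sup>2)\<close>, which is a power
  series in \<open>1 - f\<^sup>2\<close>.
\<close>

lemma nearby_involution_mem:
  assumes f: "f \<in> S" and g: "g * g = 1" "f * g = g * f" and near: "norm (g * f - 1) \<le> 1/4"
  shows "g \<in> S"
proof -
  \<comment> \<open>As \<open>g\<close> is an involution commuting with \<open>f\<close>,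
    \<open>f * f\<close> is the square of \<open>1 + e\<close>; so \<open>j\<close> has norm at most
    2/4 + 1/16, which is below 5/8.\<close>
  define e where "e = g * f - 1"
  define j where "j = 1 - f * f"
  have "f * f = (g * f) * (g * f)" using g by (metis mult.assoc mult_1)
  also have "\<dots> = 1 + 2 *\<^sub>R e + e * e"
    by (simp add: e_def algebra_simps scaleR_2)
  finally have "j = - (2 *\<^sub>R e + e * e)" by (simp add: j_def)
  then have "norm j \<le> norm (2 *\<^sub>R e) + norm (e * e)" by (metis norm_minus_cancel norm_triangle_ineq)
  also have "\<dots> \<le> 2 * norm e + norm e * norm e" by (intro add_mono norm_mult_ineq) simp
  also have "\<dots> \<le> 2 * (1/4) + (1/4) * (1/4)"
    using near by (intro add_mono mult_mono) (auto simp: e_def)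
  finally have j: "norm j < 1" "norm j \<le> 5/8" by auto
  define s where "s = sqrt_series j"
  have "j \<in> S" unfolding j_def by (intro diff one mult f)
  then have sS: "s \<in> S"
    unfolding s_def sqrt_series_def using j by (intro power_series_mem abs_sqrt_coeff_le)
  have ss: "s * s = f * f" using sqrt_series_square[of j] j by (simp add: s_def j_def)
  have near_s: "norm (s - 1) \<le> 5/8" using norm_sqrt_series_diff_one_le[of j] j by (simp add: s_def)
  have "norm (1 - s) < 1" using near_s by (simp add: norm_minus_commute)
  then obtain s' where s': "s' \<in> S" "s * s' = 1" "s' * s = 1" using inverse_near_one_mem[OF sS] by blast
  have "j * f = f * j" by (simp add: j_def algebra_simps)
  then have sf: "s * f = f * s" unfolding s_def using j by (intro sqrt_series_commute) auto
  have "f * f * g = g * (f * f)" using g(2) by (metis mult.assoc)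
  then have "j * g = g * j" by (simp add: j_def algebra_simps)
  then have sg: "s * g = g * s" unfolding s_def using j by (intro sqrt_series_commute) auto
  \<comment> \<open>\<open>s\<close> and \<open>g * f\<close> are commuting square roots of
    \<open>f * f\<close>, both near 1. Their mean \<open>w\<close> differs from 1 by at most (5/8 +
    1/4)/2 and is invertible, so \<open>w * (s - g * f) = 0\<close> identifies them.\<close>
  define w where "w = (1/2) *\<^sub>R (s + g * f)"
  have "1 - w = (1/2) *\<^sub>R ((1 - s) - (g * f - 1))" by (simp add: w_def algebra_simps flip: scaleR_2)
  then have "norm (1 - w) \<le> 1/2 * (norm (1 - s) + norm (g * f - 1))"
    using norm_triangle_ineq4[of "1 - s" "g * f - 1"] by simp
  also have "\<dots> < 1" using near near_s by (simp add: norm_minus_commute)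
  finally have w': "(\<Sum>n. (1 - w) ^ n) * w = 1" using norm_lt_one_inverse(2)[of "1 - w"] by simp
  have "(s + g * f) * (s - g * f) = s * s - (s * (g * f) - g * f * s) - (g * f) * (g * f)"
    by (simp add: algebra_simps)
  also have "s * (g * f) = g * f * s" by (metis sf sg mult.assoc)
  also have "(g * f) * (g * f) = s * s" using \<open>f * f = (g * f) * (g * f)\<close> ss by simp
  finally have "w * (s - g * f) = 0" by (simp add: w_def)
  then have "s - g * f = 0" by (metis w' mult.assoc mult_1 mult_zero_right)
  then have "g * f = s" by simp
  then have "f = g * s" by (metis g(1) mult.assoc mult_1)
  then have "g = f * s'" by (metis s'(2) mult.assoc mult_1_right)
  then show ?thesis using f s' mult by simp
qed

end

section \<open>Inverse-closedness and matrices over a differential subalgebra\<close>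

text \<open>Expanding the square gives the factor 1 - 2 r c + r^2 |a|^2, and the choice of
  \<open>r\<close> ensures r |a|^2 \<le> c. The c^2 in its denominator prevents division by
  zero.\<close>

lemma coercive_near_one:
  assumes "coercive_endo a"
  obtains r where "0 < r" "norm (1 - r *\<^sub>R a) < 1"
proof -
  obtain c where c: "0 < c" "\<And>x. c * (norm x)\<^sup>2 \<le> inner (a \<cdot> x) x"
    using assms by (auto simp: coercive_endo_def)
  define r where "r = c / ((norm a)\<^sup>2 + c\<^sup>2)"
  have den: "0 < (norm a)\<^sup>2 + c\<^sup>2" using c(1) by (simp add: add_nonneg_pos)
  have r: "0 < r" using c(1) den by (simp add: r_def)
  have "r * (norm a)\<^sup>2 \<le> c"
    using c(1) den by (simp add: r_def field_simps power2_eq_square)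
  then have rr: "r\<^sup>2 * (norm a)\<^sup>2 \<le> r * c"
    using r mult_left_mono[of "r * (norm a)\<^sup>2" c r] by (simp add: power2_eq_square mult.assoc)
  have sq: "(norm ((1 - r *\<^sub>R a) \<cdot> x))\<^sup>2 \<le> (1 - r * c) * (norm x)\<^sup>2" for x
  proof -
    have "(norm ((1 - r *\<^sub>R a) \<cdot> x))\<^sup>2
        = (norm x)\<^sup>2 - 2 * r * inner (a \<cdot> x) x + r\<^sup>2 * (norm (a \<cdot> x))\<^sup>2"
      unfolding power2_norm_eq_inner
      by (simp add: inner_diff_left inner_diff_right inner_commute power2_eq_square algebra_simps)
    also have "r\<^sup>2 * (norm (a \<cdot> x))\<^sup>2 \<le> r\<^sup>2 * (norm a * norm x)\<^sup>2"
      by (intro mult_left_mono power_mono norm_app_le) auto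
    also have "\<dots> = (r\<^sup>2 * (norm a)\<^sup>2) * (norm x)\<^sup>2" by (simp add: power_mult_distrib)
    also have "\<dots> \<le> r * c * (norm x)\<^sup>2" by (intro mult_right_mono rr) simp
    also have "(norm x)\<^sup>2 - 2 * r * inner (a \<cdot> x) x + r * c * (norm x)\<^sup>2 \<le> (1 - r * c) * (norm x)\<^sup>2"
      using mult_left_mono[OF c(2)[of x], of "2 * r"] r by (simp add: algebra_simps)
    finally show ?thesis by simp
  qed
  have "0 \<le> 1 - r * c"
  proof -
    obtain x :: 'a where "x \<noteq> 0" using ex_nonzero by blast
    moreover have "0 \<le> (1 - r * c) * (norm x)\<^sup>2" using sq[of x] by (meson order_trans zero_le_power2)
    ultimately show ?thesis by (simp add: zero_le_mult_iff)
  qed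
  moreover have "norm ((1 - r *\<^sub>R a) \<cdot> x) \<le> sqrt (1 - r * c) * norm x" for x
    using real_sqrt_le_mono[OF sq[of x]] by (simp add: real_sqrt_mult)
  ultimately have "norm (1 - r *\<^sub>R a) \<le> sqrt (1 - r * c)" by (intro norm_endo_bound) auto
  also have "\<dots> < 1" using r c by simp
  finally show ?thesis using that r by blast
qed

lemma coercive_square:
  fixes a b :: "'v::hilbert_space endo"
  assumes "b * a = 1"
  shows "coercive_endo (a\<^sup>\<dagger> * a)"
  unfolding coercive_endo_def
proof (intro exI conjI allI)
  have "b \<noteq> 0" using assms by auto
  then show "0 < inverse ((norm b)\<^sup>2)" by simp
  fix x :: 'v
  have "norm x \<le> norm b * norm (a \<cdot> x)" using norm_app_le[of b "a \<cdot> x"] assms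
    by (simp flip: app_mult)
  then have "(norm x)\<^sup>2 \<le> (norm b)\<^sup>2 * (norm (a \<cdot> x))\<^sup>2"
    unfolding power_mult_distrib[symmetric] by (intro power_mono) auto
  then show "inverse ((norm b)\<^sup>2) * (norm x)\<^sup>2 \<le> inner ((a\<^sup>\<dagger> * a) \<cdot> x) x"
    using \<open>b \<noteq> 0\<close> by (simp add: inner_adjoint field_simps flip: power2_norm_eq_inner)
qed

locale differential_star_subalgebra = differential_subalgebra S \<nu> q \<theta> D K
  for S :: "'v::hilbert_space endo set" and \<nu> q \<theta> D K +
  assumes adjoint: "a \<in> S \<Longrightarrow> a\<^sup>\<dagger> \<in> S"
begin

lemma coercive_inverse_mem:
  assumes "a \<in> S" "coercive_endo a"
  obtains b where "b \<in> S" "a * b = 1" "b * a = 1"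
proof -
  obtain r where r: "0 < r" "norm (1 - r *\<^sub>R a) < 1" using coercive_near_one[OF assms(2)] .
  obtain b where "b \<in> S" "(r *\<^sub>R a) * b = 1" "b * (r *\<^sub>R a) = 1"
    using inverse_near_one_mem[OF scaleR[OF assms(1)] r(2)] .
  then show ?thesis by (intro that[of "r *\<^sub>R b"]) (simp_all add: scaleR)
qed

text \<open>The coercive case suffices, since the inverse of \<open>a\<close> is the inverse of
  \<open>a\<^sup>\<dagger> * a\<close> times \<open>a\<^sup>\<dagger>\<close>; boundedness of
  \<open>b\<close> is what makes \<open>a\<^sup>\<dagger> * a\<close> coercive.\<close>

lemma inverse_mem:
  assumes a: "a \<in> S" and b: "a * b = 1" "b * a = 1"
  shows "b \<in> S"
proof -
  obtain y where y: "y \<in> S" "y * (a\<^sup>\<dagger> * a) = 1"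
    using coercive_inverse_mem[OF mult[OF adjoint[OF a] a] coercive_square[OF b(2)]] by metis
  have "b = y * (a\<^sup>\<dagger> * a) * b" using y by simp
  also have "\<dots> = y * a\<^sup>\<dagger>" by (simp add: mult.assoc b)
  finally show ?thesis using a y by (simp add: adjoint mult)
qed

end

section \<open>Operators on a doubled space as 2x2 matrices\<close>

definition pair_proj :: "bool \<Rightarrow> 'v \<times> 'v \<Rightarrow> 'v"
  where "pair_proj i z = (if i then snd z else fst z)"

definition pair_inj :: "bool \<Rightarrow> 'v \<Rightarrow> 'v::zero \<times> 'v"
  where "pair_inj i x = (if i then (0, x) else (x, 0))"

text \<open>Rows and columns are indexed by \<open>bool\<close>, with \<open>False\<close> for the
  first component, so that entries of products are sums over \<open>UNIV\<close>.\<close>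

definition entry :: "bool \<Rightarrow> bool \<Rightarrow> ('v \<times> 'v) endo \<Rightarrow> 'v::hilbert_space endo"
  where "entry i j m = endo (\<lambda>x. pair_proj i (m \<cdot> pair_inj j x))"

definition mat2 :: "'v endo \<Rightarrow> 'v endo \<Rightarrow> 'v endo \<Rightarrow> 'v endo \<Rightarrow> ('v::hilbert_space \<times> 'v) endo"
  where "mat2 a b c d = endo (\<lambda>z. (a \<cdot> fst z + b \<cdot> snd z, c \<cdot> fst z + d \<cdot> snd z))"

lemma bounded_linear_pair_proj: "bounded_linear (pair_proj i)"
  unfolding pair_proj_def by (cases i) (simp_all add: bounded_linear_fst bounded_linear_snd)

lemma bounded_linear_pair_inj: "bounded_linear (pair_inj i)"
  unfolding pair_inj_def
  by (cases i) (simp_all add: bounded_linear_Pair bounded_linear_zero bounded_linear_ident)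

lemma norm_pair_proj_le:
  fixes z :: "'v::real_normed_vector \<times> 'v"
  shows "norm (pair_proj i z) \<le> norm z"
  unfolding pair_proj_def using norm_fst_le[of "fst z" "snd z"] norm_snd_le[of "snd z" "fst z"] by simp

lemma norm_pair_inj: 
  fixes x :: "'v::real_normed_vector"
  shows "norm (pair_inj i x) = norm x"
  by (simp add: pair_inj_def norm_Pair)

lemma inner_pair_proj: "inner (pair_proj i z) y = inner z (pair_inj i y)"
  by (cases z) (simp add: pair_proj_def pair_inj_def)

lemma pair_sum: "z = (\<Sum>i\<in>UNIV. pair_inj i (pair_proj i z))" for z :: "'v::real_vector \<times> 'v"
  by (cases z) (simp add: UNIV_bool pair_inj_def pair_proj_def)

lemma app_entry: "entry i j m \<cdot> x = pair_proj i (m \<cdot> pair_inj j x)"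
  unfolding entry_def
  by (intro app_endo bounded_linear_compose[OF bounded_linear_pair_proj]
      bounded_linear_compose[OF app.bounded_linear_right] bounded_linear_pair_inj)

lemma app_mat2: "mat2 a b c d \<cdot> z = (a \<cdot> fst z + b \<cdot> snd z, c \<cdot> fst z + d \<cdot> snd z)"
  unfolding mat2_def
  by (intro app_endo bounded_linear_Pair bounded_linear_add bounded_linear_compose[OF app.bounded_linear_right]
      bounded_linear_fst bounded_linear_snd)

lemma entry_mat2 [simp]:
  "entry i j (mat2 a b c d) = (if i then if j then d else c else if j then b else a)"
  by (rule endo_eqI) (simp add: app_entry app_mat2 pair_proj_def pair_inj_def)

lemma norm_entry_le: "norm (entry i j m) \<le> norm m"
proof (rule norm_endo_bound)
  fix x
  have "norm (entry i j m \<cdot> x) \<le> norm (m \<cdot> pair_inj j x)"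
    unfolding app_entry by (rule norm_pair_proj_le)
  also have "\<dots> \<le> norm m * norm x" using norm_app_le[of m "pair_inj j x"] by (simp add: norm_pair_inj)
  finally show "norm (entry i j m \<cdot> x) \<le> norm m * norm x" .
qed simp

lemma bounded_linear_entry: "bounded_linear (entry i j)"
proof (rule bounded_linear_intro[where K = 1])
  interpret bounded_linear "pair_proj i :: 'a \<times> 'a \<Rightarrow> 'a" by (rule bounded_linear_pair_proj)
  show "entry i j (m + n) = entry i j m + entry i j n" for m n :: "('a \<times> 'a) endo"
    by (rule endo_eqI) (simp add: app_entry add)
  show "entry i j (r *\<^sub>R m) = r *\<^sub>R entry i j m" for r and m :: "('a \<times> 'a) endo"
    by (rule endo_eqI) (simp add: app_entry scaleR)
qed (simp add: norm_entry_le)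

lemma entry_mult: "entry i j (m * n) = (\<Sum>k\<in>UNIV. entry i k m * entry k j n)"
proof (rule endo_eqI)
  fix x
  interpret pr: bounded_linear "pair_proj i :: 'a \<times> 'a \<Rightarrow> 'a" by (rule bounded_linear_pair_proj)
  have "m \<cdot> n \<cdot> pair_inj j x = (\<Sum>k\<in>UNIV. m \<cdot> pair_inj k (pair_proj k (n \<cdot> pair_inj j x)))"
    by (subst pair_sum[of "n \<cdot> pair_inj j x"]) (simp only: app.sum_right)
  then show "entry i j (m * n) \<cdot> x = (\<Sum>k\<in>UNIV. entry i k m * entry k j n) \<cdot> x"
    by (simp add: app_entry pr.sum app.sum_left)
qed

lemma entry_adjoint: "entry i j (m\<^sup>\<dagger>) = (entry j i m)\<^sup>\<dagger>"
proof (rule adjoint_eqI[symmetric])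
  fix x y
  have "inner (entry j i m \<cdot> x) y = inner (pair_inj i x) (m\<^sup>\<dagger> \<cdot> pair_inj j y)"
    by (simp add: app_entry inner_pair_proj inner_adjoint')
  also have "\<dots> = inner x (entry i j (m\<^sup>\<dagger>) \<cdot> y)"
    by (metis app_entry inner_commute inner_pair_proj)
  finally show "inner (entry j i m \<cdot> x) y = inner x (entry i j (m\<^sup>\<dagger>) \<cdot> y)" .
qed

lemma mat2_eqI:
  assumes "\<And>i j. entry i j m = entry i j n"
  shows "m = n"
proof (rule endo_eqI)
  fix z
  have *: "pair_proj i (m \<cdot> pair_inj j x) = pair_proj i (n \<cdot> pair_inj j x)" for i j x
    using assms[of i j] by (simp flip: app_entry)
  have "m \<cdot> pair_inj j x = n \<cdot> pair_inj j x" for j x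
    using *[of False j x] *[of True j x] by (simp add: pair_proj_def prod_eq_iff)
  then show "m \<cdot> z = n \<cdot> z" by (subst (1 2) pair_sum[of z]) (simp only: app.sum_right)
qed

lemma entry_one: "entry i j 1 = (if i = j then 1 else 0)"
  by (rule endo_eqI) (simp add: app_entry pair_proj_def pair_inj_def)

lemmas entry_add = linear_simps(1)[OF bounded_linear_entry]
  and entry_diff = linear_simps(2)[OF bounded_linear_entry]
  and entry_zero = linear_simps(3)[OF bounded_linear_entry]
  and entry_scaleR = linear_simps(5)[OF bounded_linear_entry]

lemma mat2_add: "mat2 a b c d + mat2 a' b' c' d' = mat2 (a + a') (b + b') (c + c') (d + d')"
  by (rule mat2_eqI) (simp add: entry_add)

lemma mat2_diff: "mat2 a b c d - mat2 a' b' c' d' = mat2 (a - a') (b - b') (c - c') (d - d')"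
  by (rule mat2_eqI) (simp add: entry_diff)

lemma mat2_scaleR: "r *\<^sub>R mat2 a b c d = mat2 (r *\<^sub>R a) (r *\<^sub>R b) (r *\<^sub>R c) (r *\<^sub>R d)"
  by (rule mat2_eqI) (simp add: entry_scaleR)

lemma mat2_mult: "mat2 a b c d * mat2 a' b' c' d'
    = mat2 (a * a' + b * c') (a * b' + b * d') (c * a' + d * c') (c * b' + d * d')"
  by (rule mat2_eqI) (simp add: entry_mult UNIV_bool add.commute)

lemma mat2_one: "mat2 1 0 0 1 = 1"
  by (rule mat2_eqI) (simp add: entry_one)

lemma mat2_diagonal_power: "mat2 a 0 0 d ^ n = mat2 (a ^ n) 0 0 (d ^ n)"
  by (induction n) (simp_all add: mat2_one mat2_mult)

lemma norm_mat2_diagonal_le: "norm (mat2 a 0 0 d) \<le> norm a + norm d"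
proof (rule norm_endo_bound)
  fix z :: "'a \<times> 'a"
  have "norm (mat2 a 0 0 d \<cdot> z) \<le> norm (a \<cdot> fst z) + norm (d \<cdot> snd z)"
    using norm_triangle_ineq[of "(a \<cdot> fst z, 0)" "(0, d \<cdot> snd z)"] by (simp add: app_mat2 norm_Pair)
  also have "\<dots> \<le> norm a * norm z + norm d * norm z"
    using norm_pair_proj_le[of False z] norm_pair_proj_le[of True z]
    by (intro add_mono order_trans[OF norm_app_le] mult_left_mono) (simp_all add: pair_proj_def)
  finally show "norm (mat2 a 0 0 d \<cdot> z) \<le> (norm a + norm d) * norm z" by (simp add: algebra_simps)
qed simp

context differential_star_subalgebra
begin

text \<open>The factor 8 counts the index triples (i, k, j) of a product. The differential condition
  passes on because each entry obeys the same bounds \<open>t\<close> and \<open>m\<close> as the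
  whole matrix.\<close>

lemma matrices:
  "differential_star_subalgebra {m. \<forall>i j. entry i j m \<in> S} (\<lambda>m. \<Sum>i\<in>UNIV. \<Sum>j\<in>UNIV. \<nu> (entry i j m))
    q \<theta> (8 * D) (8 * K)"
    (is "differential_star_subalgebra ?S ?\<nu> q \<theta> (8 * D) (8 * K)")
proof
  have le: "\<nu> (entry i j m) \<le> ?\<nu> m" if "m \<in> ?S" for i j m
  proof -
    have "\<nu> (entry i j m) \<le> (\<Sum>j\<in>UNIV. \<nu> (entry i j m))"
      using that by (intro member_le_sum) (auto intro: \<nu>_nonneg)
    also have "\<dots> \<le> ?\<nu> m"
      using that by (intro member_le_sum) (auto intro!: sum_nonneg \<nu>_nonneg)
    finally show ?thesis .
  qed
  have prod: "?\<nu> (m * n) \<le> 8 * B" if "m \<in> ?S" "n \<in> ?S" "\<And>i j k. \<nu> (entry i k m * entry k j n) \<le> B" for m n B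
  proof -
    have "?\<nu> (m * n) \<le> (\<Sum>i\<in>(UNIV :: bool set). \<Sum>j\<in>(UNIV :: bool set). \<Sum>k\<in>(UNIV :: bool set). \<nu> (entry i k m * entry k j n))"
      unfolding entry_mult using that by (intro sum_mono \<nu>_sum mult) auto
    also have "\<dots> \<le> (\<Sum>i\<in>(UNIV :: bool set). \<Sum>j\<in>(UNIV :: bool set). \<Sum>k\<in>(UNIV :: bool set). B)"
      by (intro sum_mono that)
    finally show ?thesis by (simp add: card_UNIV_bool)
  qed
  fix a b assume a: "a \<in> ?S" and b: "b \<in> ?S"
  show "a + b \<in> ?S" using a b by (auto simp: entry_add add)
  show "a * b \<in> ?S" using a b by (auto simp: entry_mult sum mult)
  show "?\<nu> (a + b) \<le> ?\<nu> a + ?\<nu> b"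
    unfolding sum.distrib[symmetric] entry_add using a b by (intro sum_mono \<nu>_add) auto
  show "?\<nu> (a * b) \<le> 8 * K * ?\<nu> a * ?\<nu> b"
  proof -
    have "\<nu> (entry i k a * entry k j b) \<le> K * ?\<nu> a * ?\<nu> b" for i j k
    proof -
      have "\<nu> (entry i k a * entry k j b) \<le> K * \<nu> (entry i k a) * \<nu> (entry k j b)"
        using a b by (intro \<nu>_mult) auto
      also have "\<dots> \<le> K * ?\<nu> a * ?\<nu> b"
        using a b K_pos
        by (intro mult_mono mult_left_mono le) (auto intro!: mult_nonneg_nonneg sum_nonneg \<nu>_nonneg)
      finally show ?thesis .
    qed
    from prod[OF a b this] show ?thesis by (simp add: mult.assoc)
  qed
  show "?\<nu> (a * b) \<le> 8 * D * t powr (2 - \<theta>) * m powr (q * \<theta>)"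
    if "?\<nu> a \<le> t" "?\<nu> b \<le> t" "norm a \<le> m" "norm b \<le> m" for t m
  proof -
    have "\<nu> (entry i k a * entry k j b) \<le> D * t powr (2 - \<theta>) * m powr (q * \<theta>)" for i j k
      using a b that
      by (intro differential) (auto intro: order_trans[OF le] order_trans[OF norm_entry_le])
    from prod[OF a b this] show ?thesis by (simp add: mult.assoc)
  qed
next
  show "m \<in> ?S" if mem: "\<And>n. s n \<in> ?S"
    and cauchy: "\<And>e. 0 < e \<Longrightarrow> \<exists>M. \<forall>m\<ge>M. \<forall>n\<ge>M. ?\<nu> (s m - s n) < e" and lim: "s \<longlonglongrightarrow> m" for s m
  proof (intro CollectI allI)
    fix i j
    show "entry i j m \<in> S"
    proof (rule closed[where s = "\<lambda>n. entry i j (s n)"])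
      show "entry i j (s n) \<in> S" for n using mem by auto
      show "(\<lambda>n. entry i j (s n)) \<longlonglongrightarrow> entry i j m" by (rule bounded_linear.tendsto[OF bounded_linear_entry lim])
      fix e :: real assume "0 < e"
      then obtain M where M: "\<forall>m\<ge>M. \<forall>n\<ge>M. ?\<nu> (s m - s n) < e" using cauchy by blast
      have "\<nu> (entry i j (s m - s n)) \<le> ?\<nu> (s m - s n)" for m n
      proof -
        have *: "entry i' j' (s m - s n) \<in> S" for i' j'
          using mem by (simp add: entry_diff diff)
        have "\<nu> (entry i j (s m - s n)) \<le> (\<Sum>j\<in>UNIV. \<nu> (entry i j (s m - s n)))"
          by (intro member_le_sum) (auto intro: \<nu>_nonneg *)
        also have "\<dots> \<le> ?\<nu> (s m - s n)"
          by (intro member_le_sum) (auto intro!: sum_nonneg \<nu>_nonneg *)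
        finally show ?thesis .
      qed
      then show "\<exists>M. \<forall>m\<ge>M. \<forall>n\<ge>M. \<nu> (entry i j (s m) - entry i j (s n)) < e"
        unfolding entry_diff[symmetric] using M by (meson le_less_trans)
    qed
  qed
  show "?\<nu> (r *\<^sub>R a) \<le> ?\<nu> a" if "a \<in> ?S" "\<bar>r\<bar> \<le> 1" for a and r :: real
    unfolding entry_scaleR using that by (intro sum_mono \<nu>_scaleR) auto
qed (use q_pos \<theta>_pos \<theta>_le D_pos K_pos in
    \<open>auto simp: entry_one entry_scaleR entry_adjoint entry_zero \<nu>_zero one zero scaleR adjoint
      intro!: sum_nonneg \<nu>_nonneg\<close>)

end

section \<open>Lyapunov functions and the closed loop\<close>

text \<open>The operator \<open>\<integral>\<^sub>0\<^sup>T exp(t m)\<^sup>\<dagger> exp(t m) dt\<close> over a finite horizon suffices.\<close>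

lemma lyapunov_operator:
  fixes m :: "'v::hilbert_space endo"
  assumes "0 \<le> T" and small: "(norm (exp (T *\<^sub>R m)))\<^sup>2 \<le> 1/2"
  obtains p where "positive_endo p" "\<And>x. 2 * inner (p \<cdot> x) (m \<cdot> x) \<le> - (1/2) * (norm x)\<^sup>2"
proof -
  define f where "f t = exp (t *\<^sub>R m)" for t
  have adj: "(f t)\<^sup>\<dagger> = exp (t *\<^sub>R m\<^sup>\<dagger>)" for t by (simp add: f_def adjoint_exp)
  define w where "w t = (f t)\<^sup>\<dagger> * f t" for t
  have deriv: "(w has_vector_derivative m\<^sup>\<dagger> * w t + w t * m) (at t within {0..T})" for t
  proof -
    have "((\<lambda>t. exp (t *\<^sub>R m\<^sup>\<dagger>) * exp (t *\<^sub>R m)) has_vector_derivative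
        exp (t *\<^sub>R m\<^sup>\<dagger>) * (exp (t *\<^sub>R m) * m) + (m\<^sup>\<dagger> * exp (t *\<^sub>R m\<^sup>\<dagger>)) * exp (t *\<^sub>R m)) (at t within {0..T})"
      by (intro bounded_bilinear.has_vector_derivative[OF bounded_bilinear_mult]
          has_vector_derivative_at_within[OF exp_scaleR_has_vector_derivative_left]
          exp_scaleR_has_vector_derivative_right)
    then show ?thesis by (simp add: w_def[abs_def] f_def adjoint_exp mult.assoc add.commute)
  qed
  then have "continuous_on {0..T} w"
    by (intro continuous_on_vector_derivative)
  then have int: "w integrable_on {0..T}" by (rule integrable_continuous_interval)
  define p where "p = integral {0..T} w"
  have p: "(w has_integral p) {0..T}" using int unfolding p_def by (rule integrable_integral)
  have lin: "((\<lambda>t. h (w t)) has_integral h p) {0..T}" if "bounded_linear h" for h :: "'v endo \<Rightarrow> 'b::real_normed_vector"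
    using has_integral_linear[OF p that] by (simp add: o_def)
  \<comment> \<open>The Lyapunov expression of \<open>p\<close> is the integral of the derivative of
    \<open>w\<close>, hence the boundary term \<open>w T - w 0\<close>; \<open>small\<close> bounds
    the form of \<open>w T\<close> by half the squared norm.\<close>
  have "((\<lambda>t. m\<^sup>\<dagger> * w t + w t * m) has_integral (m\<^sup>\<dagger> * p + p * m)) {0..T}"
    by (intro lin bounded_linear_add bounded_linear_mult_right bounded_linear_mult_left)
  moreover have "((\<lambda>t. m\<^sup>\<dagger> * w t + w t * m) has_integral (w T - w 0)) {0..T}"
    by (intro fundamental_theorem_of_calculus assms(1) deriv)
  ultimately have "m\<^sup>\<dagger> * p + p * m = w T - w 0" by (rule has_integral_unique)
  then have eq: "m\<^sup>\<dagger> * p + p * m = w T - 1" by (simp add: w_def f_def)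
  have "((\<lambda>t. (w t)\<^sup>\<dagger>) has_integral p\<^sup>\<dagger>) {0..T}" by (rule lin[OF bounded_linear_adjoint])
  moreover have "(\<lambda>t. (w t)\<^sup>\<dagger>) = w" by (simp add: fun_eq_iff w_def)
  ultimately have "(w has_integral p\<^sup>\<dagger>) {0..T}" by simp
  then have sym: "p\<^sup>\<dagger> = p" using p by (rule has_integral_unique)
  have pos: "0 \<le> inner (p \<cdot> x) x" for x
  proof (rule has_integral_nonneg)
    show "((\<lambda>t. inner (w t \<cdot> x) x) has_integral inner (p \<cdot> x) x) {0..T}"
      by (intro lin bounded_linear_compose[OF bounded_linear_inner_left app.bounded_linear_left])
    show "0 \<le> inner (w t \<cdot> x) x" for t by (simp add: w_def inner_adjoint)
  qed
  have "2 * inner (p \<cdot> x) (m \<cdot> x) \<le> - (1/2) * (norm x)\<^sup>2" for x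
  proof -
    have "2 * inner (p \<cdot> x) (m \<cdot> x) = inner ((m\<^sup>\<dagger> * p + p * m) \<cdot> x) x"
      using inner_adjoint[of p "m \<cdot> x" x] by (simp add: inner_add_left inner_adjoint sym inner_commute[of "m \<cdot> x"])
    also have "\<dots> = (norm (f T \<cdot> x))\<^sup>2 - (norm x)\<^sup>2"
      unfolding eq by (simp add: w_def inner_diff_left inner_adjoint power2_norm_eq_inner)
    also have "(norm (f T \<cdot> x))\<^sup>2 \<le> (norm (f T) * norm x)\<^sup>2"
      by (intro power_mono norm_app_le) simp
    also have "\<dots> \<le> 1/2 * (norm x)\<^sup>2"
      unfolding power_mult_distrib f_def by (intro mult_right_mono small) simp
    finally show ?thesis by simp
  qed
  with sym pos that[of p] show ?thesis by (auto simp: positive_endo_def)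
qed

section \<open>Contracting discrete steps from a Lyapunov form\<close>

lemma norm_power_le_lyapunov:
  fixes a :: "'v::hilbert_space endo"
  assumes c: "0 < c" "\<And>x. c * (norm x)\<^sup>2 \<le> inner (p \<cdot> x) x"
    and \<rho>: "0 \<le> \<rho>" "\<And>x. inner (p \<cdot> a \<cdot> x) (a \<cdot> x) \<le> \<rho> * inner (p \<cdot> x) x"
  shows "norm (a ^ n) \<le> sqrt (norm p / c) * sqrt \<rho> ^ n"
proof (rule norm_endo_bound)
  fix x
  have "inner (p \<cdot> a ^ n \<cdot> x) (a ^ n \<cdot> x) \<le> \<rho> ^ n * inner (p \<cdot> x) x"
  proof (induction n)
    case (Suc n)
    have "inner (p \<cdot> a ^ Suc n \<cdot> x) (a ^ Suc n \<cdot> x) \<le> \<rho> * inner (p \<cdot> a ^ n \<cdot> x) (a ^ n \<cdot> x)"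
      using \<rho>(2)[of "a ^ n \<cdot> x"] by simp
    also have "\<dots> \<le> \<rho> * (\<rho> ^ n * inner (p \<cdot> x) x)" by (intro mult_left_mono Suc \<rho>)
    finally show ?case by (simp add: mult.assoc)
  qed simp
  also have "\<dots> \<le> \<rho> ^ n * (norm p * norm x * norm x)"
    by (intro mult_left_mono inner_app_le) (use \<rho> in simp)
  finally have "c * (norm (a ^ n \<cdot> x))\<^sup>2 \<le> \<rho> ^ n * (norm p * norm x * norm x)"
    using c(2)[of "a ^ n \<cdot> x"] by simp
  then have "(norm (a ^ n \<cdot> x))\<^sup>2 \<le> norm p / c * \<rho> ^ n * (norm x)\<^sup>2"
    using c(1) by (simp add: field_simps power2_eq_square)
  then have "sqrt ((norm (a ^ n \<cdot> x))\<^sup>2) \<le> sqrt (norm p / c * \<rho> ^ n * (norm x)\<^sup>2)"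
    by (rule real_sqrt_le_mono)
  then show "norm (a ^ n \<cdot> x) \<le> sqrt (norm p / c) * sqrt \<rho> ^ n * norm x"
    by (simp only: real_sqrt_mult real_sqrt_abs abs_norm_cancel real_sqrt_power[of \<rho>])
qed (use c \<rho> in simp)

text \<open>The explicit step \<open>1 + h m\<close> will act on the graph and the adjoint of
  \<open>1 - h m\<close> on its complement, so the implicit step \<open>b\<close> has to contract as
  well. Euler steps replace the exponential because \<open>1 + h H\<close> is polynomial in the
  Hamiltonian.\<close>

lemma euler_steps_contract:
  fixes m :: "'v::hilbert_space endo"
  assumes p: "p\<^sup>\<dagger> = p" "coercive_endo p" and \<kappa>: "0 < \<kappa>"
    and lyapunov: "\<And>x. 2 * inner (p \<cdot> x) (m \<cdot> x) \<le> - \<kappa> * (norm x)\<^sup>2"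
  obtains h b C r where "0 < h" "(1 - h *\<^sub>R m) * b = 1" "b * (1 - h *\<^sub>R m) = 1"
    "0 \<le> r" "r < 1" "\<And>n. norm ((1 + h *\<^sub>R m) ^ n) \<le> C * r ^ n" "\<And>n. norm (b ^ n) \<le> C * r ^ n"
proof -
  obtain c where c: "0 < c" "\<And>x. c * (norm x)\<^sup>2 \<le> inner (p \<cdot> x) x"
    using p(2) by (auto simp: coercive_endo_def)
  define P where "P = norm p + 1"
  have P: "0 < P" "norm p \<le> P" by (auto simp: P_def add_nonneg_pos)
  have upper: "inner (p \<cdot> x) x \<le> P * (norm x)\<^sup>2" for x
    using inner_app_le[of p x x] mult_right_mono[OF P(2), of "(norm x)\<^sup>2"]
    by (simp add: power2_eq_square mult.assoc)
  \<comment> \<open>The first bound makes \<open>1 - h m\<close> invertible by a Neumann series; the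
    second keeps the quadratic term of a step below half of the linear decrease.\<close>
  define h where "h = min (1 / (2 * (norm m + 1))) (\<kappa> / (2 * P * ((norm m)\<^sup>2 + 1)))"
  have pos: "0 < norm m + 1" "0 < (norm m)\<^sup>2 + 1" by (auto intro: add_nonneg_pos)
  have h: "0 < h" using \<kappa> P pos by (simp add: h_def)
  have "h * (2 * (norm m + 1)) \<le> 1"
    using pos by (simp add: h_def min_mult_distrib_right pos_le_divide_eq[symmetric] del: distrib_left_numeral)
  then have hm: "norm (h *\<^sub>R m) < 1" using h by (simp add: algebra_simps)
  have "h * (2 * P * ((norm m)\<^sup>2 + 1)) \<le> \<kappa>"
    unfolding h_def using P pos by (subst pos_le_divide_eq[symmetric]) auto
  moreover have "h * P * (norm m)\<^sup>2 \<le> h * P * ((norm m)\<^sup>2 + 1)" using h P by simp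
  ultimately have h2: "h * P * (norm m)\<^sup>2 \<le> \<kappa> / 2" by (simp add: algebra_simps)
  define b where "b = (\<Sum>n. (h *\<^sub>R m) ^ n)"
  have b: "(1 - h *\<^sub>R m) * b = 1" "b * (1 - h *\<^sub>R m) = 1"
    using norm_lt_one_inverse[OF hm] by (simp_all add: b_def)
  have sym: "inner (p \<cdot> u) v = inner (p \<cdot> v) u" for u v
    using inner_adjoint[of p u v] p(1) by (simp add: inner_commute)
  have quad: "h\<^sup>2 * inner (p \<cdot> m \<cdot> x) (m \<cdot> x) \<le> h * \<kappa> / 2 * (norm x)\<^sup>2"
    "0 \<le> h\<^sup>2 * inner (p \<cdot> m \<cdot> x) (m \<cdot> x)" for x
  proof -
    have "inner (p \<cdot> m \<cdot> x) (m \<cdot> x) \<le> P * (norm m * norm x)\<^sup>2"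
      by (rule order_trans[OF upper]) (intro mult_left_mono power_mono norm_app_le, use P in auto)
    then have "h\<^sup>2 * inner (p \<cdot> m \<cdot> x) (m \<cdot> x) \<le> h * (h * P * (norm m)\<^sup>2) * (norm x)\<^sup>2"
      using mult_left_mono[of "inner (p \<cdot> m \<cdot> x) (m \<cdot> x)" "P * (norm m * norm x)\<^sup>2" "h\<^sup>2"]
      by (simp add: power_mult_distrib power2_eq_square mult_ac)
    also have "\<dots> \<le> h * (\<kappa> / 2) * (norm x)\<^sup>2" by (intro mult_right_mono mult_left_mono h2) (use h in auto)
    finally show "h\<^sup>2 * inner (p \<cdot> m \<cdot> x) (m \<cdot> x) \<le> h * \<kappa> / 2 * (norm x)\<^sup>2" by simp
    show "0 \<le> h\<^sup>2 * inner (p \<cdot> m \<cdot> x) (m \<cdot> x)"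
      using c(1) c(2)[of "m \<cdot> x"] by (intro mult_nonneg_nonneg) (auto intro: order_trans[rotated])
  qed
  define s where "s = h * \<kappa> / P"
  have s: "0 < s" using h \<kappa> P by (simp add: s_def)
  have sV: "s * inner (p \<cdot> x) x \<le> h * \<kappa> * (norm x)\<^sup>2" for x
    using mult_left_mono[OF upper[of x], of s] s P by (simp add: s_def)
  \<comment> \<open>\<open>s\<close> is the decrease relative to the form of \<open>p\<close>; that
    form shrinks by \<open>1 - s / 2\<close> in the explicit step and by \<open>1 / (1 + s)\<close>
    in the implicit one.\<close>
  define \<rho> where "\<rho> = max (1 - s / 2) (1 / (1 + s))"
  have \<rho>: "0 \<le> \<rho>" "\<rho> < 1" using s by (auto simp: \<rho>_def le_max_iff_disj)
  have V_nonneg: "0 \<le> inner (p \<cdot> x) x" for x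
    using c(1) c(2)[of x] by (meson less_imp_le mult_nonneg_nonneg order_trans zero_le_power2)
  have "inner (p \<cdot> (1 + h *\<^sub>R m) \<cdot> x) ((1 + h *\<^sub>R m) \<cdot> x) \<le> \<rho> * inner (p \<cdot> x) x" for x
  proof -
    have "inner (p \<cdot> (1 + h *\<^sub>R m) \<cdot> x) ((1 + h *\<^sub>R m) \<cdot> x)
        = inner (p \<cdot> x) x + h * (2 * inner (p \<cdot> x) (m \<cdot> x)) + h\<^sup>2 * inner (p \<cdot> m \<cdot> x) (m \<cdot> x)"
      using sym[of "m \<cdot> x" x] by (simp add: inner_add_left inner_add_right power2_eq_square algebra_simps)
    also have "\<dots> \<le> inner (p \<cdot> x) x + h * (- \<kappa> * (norm x)\<^sup>2) + h * \<kappa> / 2 * (norm x)\<^sup>2"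
      using h by (intro add_mono mult_left_mono lyapunov quad) auto
    also have "\<dots> = inner (p \<cdot> x) x - (h * \<kappa> * (norm x)\<^sup>2) / 2" by (simp add: algebra_simps)
    also have "\<dots> \<le> (1 - s / 2) * inner (p \<cdot> x) x" using sV[of x] by (simp add: algebra_simps)
    also have "\<dots> \<le> \<rho> * inner (p \<cdot> x) x" by (intro mult_right_mono V_nonneg) (simp add: \<rho>_def)
    finally show ?thesis .
  qed
  note step = norm_power_le_lyapunov[OF c \<rho>(1) this]
  have "inner (p \<cdot> b \<cdot> x) (b \<cdot> x) \<le> \<rho> * inner (p \<cdot> x) x" for x
  proof -
    define y where "y = b \<cdot> x"
    have x: "x = (1 - h *\<^sub>R m) \<cdot> y" unfolding y_def app_mult[symmetric] b by simp
    have "(1 + s) * inner (p \<cdot> y) y \<le> inner (p \<cdot> y) y + h * \<kappa> * (norm y)\<^sup>2"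
      using sV[of y] by (simp add: algebra_simps)
    also have "\<dots> \<le> inner (p \<cdot> y) y - h * (2 * inner (p \<cdot> y) (m \<cdot> y)) + h\<^sup>2 * inner (p \<cdot> m \<cdot> y) (m \<cdot> y)"
      using mult_left_mono[OF lyapunov[of y], of h] quad(2)[of y] h by (simp add: algebra_simps)
    also have "\<dots> = inner (p \<cdot> x) x"
      unfolding x using sym[of "m \<cdot> y" y]
      by (simp add: inner_diff_left inner_diff_right power2_eq_square algebra_simps)
    finally have "inner (p \<cdot> y) y \<le> 1 / (1 + s) * inner (p \<cdot> x) x" using s by (simp add: field_simps)
    also have "\<dots> \<le> \<rho> * inner (p \<cdot> x) x" by (intro mult_right_mono V_nonneg) (simp add: \<rho>_def)
    finally show ?thesis by (simp add: y_def)
  qed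
  note backward = norm_power_le_lyapunov[OF c \<rho>(1) this]
  show ?thesis using \<rho> by (intro that[OF h b _ _ step backward]) auto
qed

text \<open>
  With \<open>a + l c\<close> stable, the Lyapunov operator of \<open>a + l c\<close> plus a large multiple of \<open>x\<close> is a Lyapunov
  operator of the closed loop \<open>a - s x\<close>: the Riccati equation makes \<open>x\<close> decrease at the rate
  \<open>\<parallel>c v\<parallel>\<^sup>2 + \<langle>s x v, x v\<rangle>\<close>, which absorbs the cross terms.
\<close>

lemma closed_loop_lyapunov:
  fixes a s x l c :: "'v::hilbert_space endo"
  assumes x: "x\<^sup>\<dagger> = x" "coercive_endo x" and s: "positive_endo s"
    and riccati: "a\<^sup>\<dagger> * x + x * a - x * s * x + c\<^sup>\<dagger> * c = 0"
    and T: "0 \<le> T" "(norm (exp (T *\<^sub>R (a + l * c))))\<^sup>2 \<le> 1/2"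
  obtains p where "p\<^sup>\<dagger> = p" "coercive_endo p"
    "\<And>v. 2 * inner (p \<cdot> v) ((a - s * x) \<cdot> v) \<le> - (1/4) * (norm v)\<^sup>2"
proof -
  obtain w where w: "positive_endo w"
      "\<And>v. 2 * inner (w \<cdot> v) ((a + l * c) \<cdot> v) \<le> - (1/2) * (norm v)\<^sup>2"
    using lyapunov_operator[OF T] by blast
  define M where "M = norm s + 1"
  have M: "0 < M" "norm s \<le> M" by (auto simp: M_def add_nonneg_pos)
  \<comment> \<open>The cross terms are split by 2 p q \<le> p^2/8 + 8 q^2: each spends 1/8 of the
    available 1/2, leaving 1/4, and \<open>k\<close> dominates what remains. The added 1 ensures
    \<open>1 \<le> k\<close>, so that \<open>p\<close> inherits the coercivity constant of
    \<open>x\<close>.\<close>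
  define k where "k = 8 * (norm w)\<^sup>2 * (M + (norm l)\<^sup>2) + 1"
  have k: "1 \<le> k" "8 * (norm w)\<^sup>2 * M \<le> k" "8 * (norm w)\<^sup>2 * (norm l)\<^sup>2 \<le> k"
    using M by (auto simp: k_def algebra_simps)
  define p where "p = w + k *\<^sub>R x"
  obtain e where e: "0 < e" "\<And>v. e * (norm v)\<^sup>2 \<le> inner (x \<cdot> v) v"
    using x(2) by (auto simp: coercive_endo_def)
  have "coercive_endo p"
    unfolding coercive_endo_def
  proof (intro exI conjI allI)
    show "0 < e" by fact
    fix v
    have nn: "0 \<le> inner (x \<cdot> v) v" using e by (meson less_imp_le mult_nonneg_nonneg order_trans zero_le_power2)
    have "e * (norm v)\<^sup>2 \<le> 1 * inner (x \<cdot> v) v" using e by simp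
    also have "\<dots> \<le> k * inner (x \<cdot> v) v" by (intro mult_right_mono k nn)
    also have "\<dots> \<le> inner (p \<cdot> v) v" using w(1) by (simp add: p_def inner_add_left positive_endo_def)
    finally show "e * (norm v)\<^sup>2 \<le> inner (p \<cdot> v) v" .
  qed
  moreover have "p\<^sup>\<dagger> = p" using w(1) x(1) by (simp add: p_def positive_endo_def)
  moreover have "2 * inner (p \<cdot> v) ((a - s * x) \<cdot> v) \<le> - (1/4) * (norm v)\<^sup>2" for v
  proof -
    define z where "z = x \<cdot> v"
    define g where "g = norm (c \<cdot> v)"
    define t where "t = norm (s \<cdot> z)"
    have tz: "t\<^sup>2 \<le> M * inner (s \<cdot> z) z"
      unfolding t_def by (rule positive_endo_square_le[OF s M(2)])
    have "0 = inner ((a\<^sup>\<dagger> * x + x * a - x * s * x + c\<^sup>\<dagger> * c) \<cdot> v) v" unfolding riccati by simp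
    also have "\<dots> = 2 * inner z (a \<cdot> v) - inner (s \<cdot> z) z + g\<^sup>2"
      using inner_adjoint[of x "a \<cdot> v" v] inner_adjoint[of x "s \<cdot> x \<cdot> v" v]
      by (simp add: inner_add_left inner_diff_left inner_adjoint x(1) z_def g_def power2_norm_eq_inner
          inner_commute[of "a \<cdot> v"])
    finally have decrease: "2 * inner z ((a - s * x) \<cdot> v) = - g\<^sup>2 - inner (s \<cdot> z) z"
      by (simp add: inner_diff_right z_def inner_commute)
    have "2 * inner (w \<cdot> v) ((a - s * x) \<cdot> v)
        = 2 * inner (w \<cdot> v) ((a + l * c) \<cdot> v) - 2 * inner (w \<cdot> v) (s \<cdot> z) - 2 * inner (w \<cdot> v) (l \<cdot> c \<cdot> v)"
      by (simp add: inner_diff_right inner_add_right z_def)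
    also have "\<dots> \<le> - (1/2) * (norm v)\<^sup>2 + 2 * (norm w * norm v * t) + 2 * (norm w * norm v * (norm l * g))"
    proof -
      have cs: "- inner (w \<cdot> v) u \<le> norm w * norm v * norm u" for u
        using inner_app_le[of w v "- u"] by simp
      have "norm w * norm v * norm (l \<cdot> c \<cdot> v) \<le> norm w * norm v * (norm l * g)"
        unfolding g_def by (intro mult_left_mono norm_app_le) auto
      with cs[of "s \<cdot> z"] cs[of "l \<cdot> c \<cdot> v"] w(2)[of v] show ?thesis by (simp add: t_def)
    qed
    also have "2 * (norm w * norm v * t) \<le> (norm v)\<^sup>2 / 8 + 8 * (norm w)\<^sup>2 * t\<^sup>2"
      using sum_squares_bound[of "norm v / 4" "4 * (norm w * t)"]
        zero_le_power2[of "norm v - 8 * (norm w * t)"]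
      by (simp add: power2_diff power_mult_distrib power_divide field_simps)
    also have "2 * (norm w * norm v * (norm l * g)) \<le> (norm v)\<^sup>2 / 8 + 8 * (norm w)\<^sup>2 * (norm l)\<^sup>2 * g\<^sup>2"
      using zero_le_power2[of "norm v - 8 * (norm w * norm l * g)"]
      by (simp add: power2_diff power_mult_distrib power_divide field_simps)
    also have "8 * (norm w)\<^sup>2 * t\<^sup>2 \<le> 8 * (norm w)\<^sup>2 * (M * inner (s \<cdot> z) z)"
      by (intro mult_left_mono tz) simp
    also have "\<dots> = 8 * (norm w)\<^sup>2 * M * inner (s \<cdot> z) z" by simp
    also have "\<dots> \<le> k * inner (s \<cdot> z) z"
      using s by (intro mult_right_mono k) (simp add: positive_endo_def)
    also have "8 * (norm w)\<^sup>2 * (norm l)\<^sup>2 * g\<^sup>2 \<le> k * g\<^sup>2" by (intro mult_right_mono k) simp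
    finally have "2 * inner (w \<cdot> v) ((a - s * x) \<cdot> v)
        \<le> - (1/4) * (norm v)\<^sup>2 + k * inner (s \<cdot> z) z + k * g\<^sup>2" by simp
    moreover have "2 * inner (p \<cdot> v) ((a - s * x) \<cdot> v)
        = 2 * inner (w \<cdot> v) ((a - s * x) \<cdot> v) + k * (2 * inner z ((a - s * x) \<cdot> v))"
      unfolding p_def z_def by (simp only: app_simps inner_add_left inner_scaleR_left algebra_simps)
    ultimately show ?thesis unfolding decrease by (simp add: algebra_simps)
  qed
  ultimately show ?thesis using that by blast
qed

text \<open>The sum \<open>u\<close> solves the Stein equation u = w + a u d, and
  \<open>z = - u d\<close> turns it into Sylvester form. The result is the off-diagonal entry that
  makes a complement of the graph invariant.\<close>

lemma sylvester_solution:
  fixes a d e w :: "'a::{real_normed_algebra_1, banach}"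
  assumes "d * e = 1" and sm: "summable (\<lambda>k. a ^ k * w * d ^ k)"
  obtains z where "a * z - w = z * e"
proof
  define u where "u = (\<Sum>k. a ^ k * w * d ^ k)"
  have "(\<lambda>k. a ^ Suc k * w * d ^ Suc k) = (\<lambda>k. a * ((a ^ k * w * d ^ k) * d))"
    by (simp add: fun_eq_iff mult.assoc power_commutes)
  then have "(\<Sum>k. a ^ Suc k * w * d ^ Suc k) = a * (u * d)"
    unfolding u_def by (simp only: suminf_mult[OF summable_mult2[OF sm]] suminf_mult2[OF sm, symmetric])
  then have "u - w = a * (u * d)" using suminf_split_head[OF sm] by (simp add: u_def)
  then show "a * (- (u * d)) - w = (- (u * d)) * e" by (simp add: mult.assoc assms(1) algebra_simps)
qed

text \<open>With y the inverse of 1 + a, the difference is -2 a y, and \<open>norm y \<le> 2\<close>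
  because \<open>norm a \<le> 1/2\<close>.\<close>

lemma cayley_near_one:
  fixes a :: "'a::{real_normed_algebra_1, banach}"
  assumes "norm a \<le> 1/2"
  obtains y where "(1 + a) * y = 1" "y * (1 + a) = 1" "norm ((1 - a) * y - 1) \<le> 4 * norm a"
proof -
  define y where "y = (\<Sum>n. (- a) ^ n)"
  have y: "(1 + a) * y = 1" "y * (1 + a) = 1"
    using norm_lt_one_inverse[of "- a"] assms by (simp_all add: y_def)
  have "y = 1 - a * y" using y(1) by (simp add: algebra_simps)
  then have "norm y \<le> 1 + norm a * norm y"
    using norm_triangle_ineq4[of 1 "a * y"] norm_mult_ineq[of a y] by simp
  also have "norm a * norm y \<le> 1/2 * norm y" by (intro mult_right_mono assms) simp
  finally have "norm y \<le> 2" by simp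
  have "(1 - a) * y - 1 = (1 - a) * y - (1 + a) * y" by (simp only: y)
  also have "\<dots> = - (2 *\<^sub>R (a * y))" by (simp add: algebra_simps scaleR_2)
  finally have "norm ((1 - a) * y - 1) \<le> 2 * (norm a * norm y)"
    using norm_mult_ineq[of a y] by simp
  also have "\<dots> \<le> 2 * (norm a * 2)" using \<open>norm y \<le> 2\<close> by (intro mult_left_mono) auto
  finally show ?thesis using that y by simp
qed

section \<open>The Riccati equation in a differential star-subalgebra\<close>

context differential_star_subalgebra
begin

text \<open>
  The reflection with eigenspaces the two diagonal blocks is the limit of Cayley transforms
  \<open>(1 - u ^ n) / (1 + u ^ n)\<close>, so one of them is close enough to apply \<open>nearby_involution_mem\<close>.
\<close>

lemma dichotomy_involution_mem:
  fixes t t' u :: "('v \<times> 'v) endo"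
  assumes u: "\<And>i j. entry i j u \<in> S"
    and t: "t * t' = 1" "t' * t = 1" and ut: "u = t * mat2 a 0 0 e * t'"
    and de: "d * e = 1" "e * d = 1"
    and decay: "(\<lambda>n. norm (a ^ n)) \<longlonglongrightarrow> 0" "(\<lambda>n. norm (d ^ n)) \<longlonglongrightarrow> 0"
  shows "entry i j (t * mat2 1 0 0 (- 1) * t') \<in> S"
proof -
  interpret M: differential_star_subalgebra "{m :: ('v \<times> 'v) endo. \<forall>i j. entry i j m \<in> S}"
    "\<lambda>m. \<Sum>i\<in>UNIV. \<Sum>j\<in>UNIV. \<nu> (entry i j m)" q \<theta> "8 * D" "8 * K"
    by (rule matrices)
  \<comment> \<open>\<open>t\<close> itself is not known to have entries in \<open>S\<close>, so
    conjugation serves only to compute blocks and norms; membership always starts from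
    \<open>u\<close>.\<close>
  define cj where "cj m = t * m * t'" for m
  have cj_mult: "cj m * cj n = cj (m * n)" for m n
  proof -
    have "cj m * cj n = t * m * (t' * t) * n * t'" by (simp only: cj_def mult.assoc)
    then show ?thesis by (simp add: t(2) cj_def mult.assoc)
  qed
  have cj_one: "cj 1 = 1" by (simp add: cj_def t)
  have cj_diagonal_one: "1 = cj (mat2 1 0 0 1)" by (simp add: mat2_one cj_one)
  have cj_add: "cj m + cj n = cj (m + n)" and cj_diff: "cj m - cj n = cj (m - n)" for m n
    by (simp_all add: cj_def algebra_simps)
  have u_power: "u ^ n = cj (mat2 (a ^ n) 0 0 (e ^ n))" for n
  proof -
    have "cj m ^ n = cj (m ^ n)" for m by (induction n) (simp_all only: power_0 power_Suc cj_one cj_mult)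
    then show ?thesis by (simp only: ut cj_def[symmetric] mat2_diagonal_power)
  qed
  have de_power: "e ^ n * d ^ n = 1" "d ^ n * e ^ n = 1" for n
    using de by (metis left_right_inverse_power)+
  \<comment> \<open>The conjugated error is at most \<open>norm t * norm t' * (2 / B)\<close>, which
    is \<open>(B - 2) / (4 * B)\<close> and so below 1/4; the summand 2 also gives
    \<open>1 / (4 * B) \<le> 1/2\<close>.\<close>
  define B where "B = norm t * norm t' * 8 + 2"
  have "2 \<le> B" by (simp add: B_def)
  have "\<forall>\<^sub>F n in sequentially. norm (a ^ n) < 1 / (4 * B)" "\<forall>\<^sub>F n in sequentially. norm (d ^ n) < 1 / (4 * B)"
    using \<open>2 \<le> B\<close> by (intro order_tendstoD(2)[OF decay(1)] order_tendstoD(2)[OF decay(2)]; simp)+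
  then have "\<forall>\<^sub>F n in sequentially. norm (a ^ n) < 1 / (4 * B) \<and> norm (d ^ n) < 1 / (4 * B)"
    by (rule eventually_conj)
  then obtain n where n: "norm (a ^ n) < 1 / (4 * B)" "norm (d ^ n) < 1 / (4 * B)"
    using eventually_happens by force
  have "1 / (4 * B) \<le> 1/2" using \<open>2 \<le> B\<close> by (simp add: field_simps)
  then have half: "norm (a ^ n) \<le> 1/2" "norm (d ^ n) \<le> 1/2" using n by linarith+
  obtain y where y: "(1 + a ^ n) * y = 1" "y * (1 + a ^ n) = 1"
      "norm ((1 - a ^ n) * y - 1) \<le> 4 * norm (a ^ n)"
    using cayley_near_one[OF half(1)] .
  obtain y' where y': "(1 + d ^ n) * y' = 1" "y' * (1 + d ^ n) = 1"
      "norm ((1 - d ^ n) * y' - 1) \<le> 4 * norm (d ^ n)"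
    using cayley_near_one[OF half(2)] .
  \<comment> \<open>The inverse of \<open>1 + e ^ n\<close> is expressed as
    \<open>d ^ n * y'\<close>, in terms of the decaying powers of \<open>d\<close>.\<close>
  define w where "w = cj (mat2 y 0 0 (d ^ n * y'))"
  have one_u: "1 + u ^ n = cj (mat2 (1 + a ^ n) 0 0 (1 + e ^ n))"
    "1 - u ^ n = cj (mat2 (1 - a ^ n) 0 0 (1 - e ^ n))"
    unfolding u_power by (subst cj_diagonal_one; simp add: mat2_add mat2_diff cj_add cj_diff)+
  have "(1 + e ^ n) * (d ^ n * y') = (1 + d ^ n) * y'"
    by (simp add: distrib_right mult.assoc[symmetric] de_power add.commute)
  moreover have "y' * d ^ n = d ^ n * y'"
  proof -
    have "y' * d ^ n = y' * (d ^ n * (1 + d ^ n)) * y'" by (simp add: mult.assoc y')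
    also have "d ^ n * (1 + d ^ n) = (1 + d ^ n) * d ^ n" by (simp add: algebra_simps)
    also have "y' * ((1 + d ^ n) * d ^ n) * y' = d ^ n * y'" by (simp add: y'(2) flip: mult.assoc)
    finally show ?thesis .
  qed
  then have "d ^ n * y' * (1 + e ^ n) = y' * (1 + d ^ n)"
    by (simp add: distrib_left mult.assoc de_power add.commute flip: \<open>y' * d ^ n = d ^ n * y'\<close>)
  ultimately have inv: "(1 + u ^ n) * w = 1" "w * (1 + u ^ n) = 1"
    unfolding one_u w_def cj_mult by (simp_all add: mat2_mult y y' mat2_one cj_one)
  have uS: "u \<in> {m. \<forall>i j. entry i j m \<in> S}" using u by simp
  have "w \<in> {m. \<forall>i j. entry i j m \<in> S}"
    by (rule M.inverse_mem[OF _ inv]) (intro M.add M.one M.power uS)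
  then have fS: "(1 - u ^ n) * w \<in> {m. \<forall>i j. entry i j m \<in> S}"
    by (intro M.mult M.diff M.one M.power uS)
  \<comment> \<open>Since \<open>e ^ n * d ^ n = 1\<close>, the second block is minus the Cayley
    transform of \<open>d ^ n\<close>; the blocks are thus close to 1 and -1.\<close>
  have f: "(1 - u ^ n) * w = cj (mat2 ((1 - a ^ n) * y) 0 0 (- ((1 - d ^ n) * y')))"
  proof -
    have "(1 - e ^ n) * (d ^ n * y') = - ((1 - d ^ n) * y')"
      by (simp add: left_diff_distrib mult.assoc[symmetric] de_power)
    then show ?thesis unfolding one_u w_def cj_mult by (simp add: mat2_mult)
  qed
  let ?g = "cj (mat2 1 0 0 (- 1))"
  have "?g \<in> {m. \<forall>i j. entry i j m \<in> S}"
  proof (rule M.nearby_involution_mem[OF fS])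
    show "?g * ?g = 1" by (simp add: cj_mult mat2_mult mat2_one cj_one)
    show "(1 - u ^ n) * w * ?g = ?g * ((1 - u ^ n) * w)" unfolding f cj_mult by (simp add: mat2_mult)
    have "?g * ((1 - u ^ n) * w) - 1 = cj (mat2 ((1 - a ^ n) * y - 1) 0 0 ((1 - d ^ n) * y' - 1))"
      unfolding f cj_mult by (subst cj_diagonal_one) (simp add: mat2_mult mat2_diff cj_diff)
    also have "norm \<dots> \<le> norm t * (norm ((1 - a ^ n) * y - 1) + norm ((1 - d ^ n) * y' - 1)) * norm t'"
      unfolding cj_def
      by (intro order_trans[OF norm_mult_ineq] mult_right_mono mult_left_mono norm_mat2_diagonal_le) auto
    also have "\<dots> \<le> norm t * (4 * norm (a ^ n) + 4 * norm (d ^ n)) * norm t'"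
      by (intro mult_right_mono mult_left_mono add_mono y y') auto
    also have "\<dots> \<le> norm t * (4 * (1 / (4 * B)) + 4 * (1 / (4 * B))) * norm t'"
      using n by (intro mult_right_mono mult_left_mono add_mono) auto
    also have "\<dots> = (norm t * norm t') * (2 / B)" using \<open>2 \<le> B\<close> by (simp add: field_simps)
    also have "norm t * norm t' = (B - 2) / 8" by (simp add: B_def)
    also have "(B - 2) / 8 * (2 / B) \<le> 1/4" using \<open>2 \<le> B\<close> by (simp add: field_simps)
    finally show "norm (?g * ((1 - u ^ n) * w) - 1) \<le> 1/4" .
  qed
  then show ?thesis by (simp add: cj_def)
qed

text \<open>
  The graph of \<open>x\<close> is the stable subspace of the Hamiltonian \<open>(a, - s; - c\<^sup>\<dagger>c, - a\<^sup>\<dagger>)\<close>; the spectral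
  projection onto it is \<open>(1; x) (1 + z x, - z)\<close> with \<open>z\<close> from a Sylvester equation. No invertibility of
  \<open>1 + z x\<close> is needed to recover \<open>x\<close>: multiplying the projection by its adjoint gives
  \<open>(1; x) g (1, x)\<close> with \<open>g\<close> coercive.
\<close>

theorem riccati_solution_mem:
  assumes a: "a \<in> S" and s: "s \<in> S" "positive_endo s" and c: "c\<^sup>\<dagger> * c \<in> S"
    and x: "x\<^sup>\<dagger> = x" "coercive_endo x"
    and riccati: "a\<^sup>\<dagger> * x + x * a - x * s * x + c\<^sup>\<dagger> * c = 0"
    and T: "0 \<le> T" "(norm (exp (T *\<^sub>R (a + l * c))))\<^sup>2 \<le> 1/2"
  shows "x \<in> S"
proof -
  define m where "m = a - s * x"
  obtain p where p: "p\<^sup>\<dagger> = p" "coercive_endo p"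
      "\<And>v. 2 * inner (p \<cdot> v) (m \<cdot> v) \<le> - (1/4) * (norm v)\<^sup>2"
    unfolding m_def using closed_loop_lyapunov[OF x s(2) riccati T] by blast
  obtain h b C r where h: "0 < h" and b: "(1 - h *\<^sub>R m) * b = 1" "b * (1 - h *\<^sub>R m) = 1"
    and r: "0 \<le> r" "r < 1" "\<And>n. norm ((1 + h *\<^sub>R m) ^ n) \<le> C * r ^ n" "\<And>n. norm (b ^ n) \<le> C * r ^ n"
    using euler_steps_contract[OF p(1,2) _ p(3)] by (metis zero_less_divide_1_iff zero_less_numeral)
  define f where "f = 1 + h *\<^sub>R m"
  define e where "e = (1 - h *\<^sub>R m)\<^sup>\<dagger>"
  define d where "d = b\<^sup>\<dagger>"
  have de: "d * e = 1" "e * d = 1" unfolding d_def e_def adjoint_simps(2)[symmetric] b by simp_all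
  have d_le: "norm (d ^ n) \<le> C * r ^ n" for n
    using norm_adjoint_le[of "b ^ n"] r(4)[of n] by (simp add: d_def adjoint_power)
  have lim: "(\<lambda>n. C * r ^ n) \<longlonglongrightarrow> 0"
    using r by (intro tendsto_mult_right_zero LIMSEQ_power_zero) simp
  have decay: "(\<lambda>n. norm (f ^ n)) \<longlonglongrightarrow> 0" "(\<lambda>n. norm (d ^ n)) \<longlonglongrightarrow> 0"
    by (rule tendsto_sandwich[OF _ _ tendsto_const lim]; use r(3) d_le in \<open>simp add: f_def\<close>)+
  have "summable (\<lambda>k. f ^ k * (h *\<^sub>R s) * d ^ k)"
  proof (rule summable_comparison_test'[where N = 0])
    show "summable (\<lambda>k. (C * C * norm (h *\<^sub>R s)) * (r * r) ^ k)"
      using r mult_le_one[of r r] mult_strict_mono[of r 1 r 1] by (intro summable_mult summable_geometric) simp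
    fix k
    have "norm (f ^ k * (h *\<^sub>R s) * d ^ k) \<le> norm (f ^ k) * norm (h *\<^sub>R s) * norm (d ^ k)"
      by (intro order_trans[OF norm_mult_ineq] mult_right_mono norm_mult_ineq norm_ge_zero)
    also have "\<dots> \<le> (C * r ^ k) * norm (h *\<^sub>R s) * (C * r ^ k)"
      using order_trans[OF norm_ge_zero d_le[of k]]
      by (intro mult_mono d_le r(3)[folded f_def]) auto
    finally show "norm (f ^ k * (h *\<^sub>R s) * d ^ k) \<le> (C * C * norm (h *\<^sub>R s)) * (r * r) ^ k"
      by (simp add: power_mult_distrib mult_ac)
  qed
  then obtain z where z: "f * z - h *\<^sub>R s = z * e" using sylvester_solution[OF de(1)] by blast
  \<comment> \<open>The columns (1; x) and (z; 1 + x z) span the graph and a complement. The inverse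
    \<open>t'\<close> is explicit for every \<open>z\<close>.\<close>
  define t where "t = mat2 1 z x (1 + x * z)"
  define t' where "t' = mat2 (1 + z * x) (- z) (- x) 1"
  have t: "t * t' = 1" "t' * t = 1"
    unfolding t_def t'_def by (simp_all add: mat2_mult algebra_simps flip: mat2_one)
  \<comment> \<open>\<open>1 + h H\<close> for the Hamiltonian \<open>H\<close>; its entries are in
    \<open>S\<close>, unlike those known for \<open>t\<close>.\<close>
  define u where "u = mat2 (1 + h *\<^sub>R a) (- (h *\<^sub>R s)) (- (h *\<^sub>R (c\<^sup>\<dagger> * c))) (1 - h *\<^sub>R a\<^sup>\<dagger>)"
  have "u * t = t * mat2 f 0 0 e"
  proof -
    have ric: "c\<^sup>\<dagger> * c = x * s * x - a\<^sup>\<dagger> * x - x * a" using riccati by (simp add: algebra_simps)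
    have e: "e = 1 - h *\<^sub>R a\<^sup>\<dagger> + h *\<^sub>R (x * s)"
      using s(2) x(1) by (simp add: e_def m_def positive_endo_def algebra_simps)
    have 11: "(1 + h *\<^sub>R a) - h *\<^sub>R (s * x) = f" by (simp add: f_def m_def algebra_simps)
    have 21: "- (h *\<^sub>R (c\<^sup>\<dagger> * c)) + (1 - h *\<^sub>R a\<^sup>\<dagger>) * x = x * f"
      unfolding ric by (simp add: f_def m_def algebra_simps)
    \<comment> \<open>The upper right block is the Sylvester equation for \<open>z\<close>, which
      makes the second column invariant.\<close>
    have 12: "(1 + h *\<^sub>R a) * z - h *\<^sub>R s * (1 + x * z) = z * e"
    proof -
      have "(1 + h *\<^sub>R a) * z - h *\<^sub>R s * (1 + x * z) = f * z - h *\<^sub>R s"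
        unfolding 11[symmetric] by (simp add: algebra_simps)
      then show ?thesis by (simp add: z)
    qed
    have 22: "- (h *\<^sub>R (c\<^sup>\<dagger> * c)) * z + (1 - h *\<^sub>R a\<^sup>\<dagger>) * (1 + x * z) = (1 + x * z) * e"
    proof -
      have "- (h *\<^sub>R (c\<^sup>\<dagger> * c)) * z + (1 - h *\<^sub>R a\<^sup>\<dagger>) * (1 + x * z) = x * f * z + (1 - h *\<^sub>R a\<^sup>\<dagger>)"
        unfolding 21[symmetric] by (simp add: algebra_simps)
      also have "\<dots> = x * (f * z - h *\<^sub>R s) + e" unfolding e by (simp add: algebra_simps)
      also have "\<dots> = (1 + x * z) * e" unfolding z by (simp add: algebra_simps)
      finally show ?thesis .
    qed
    have "(1 + h *\<^sub>R a) * 1 + - (h *\<^sub>R s) * x = 1 * f + z * 0"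
      "(1 + h *\<^sub>R a) * z + - (h *\<^sub>R s) * (1 + x * z) = 1 * 0 + z * e"
      "- (h *\<^sub>R (c\<^sup>\<dagger> * c)) * 1 + (1 - h *\<^sub>R a\<^sup>\<dagger>) * x = x * f + (1 + x * z) * 0"
      "- (h *\<^sub>R (c\<^sup>\<dagger> * c)) * z + (1 - h *\<^sub>R a\<^sup>\<dagger>) * (1 + x * z) = x * 0 + (1 + x * z) * e"
      subgoal using 11 by simp
      subgoal using 12 by simp
      subgoal using 21 by simp
      subgoal using 22 by simp
      done
    then show ?thesis unfolding u_def t_def mat2_mult by (simp only:)
  qed
  then have "u * (t * t') = t * mat2 f 0 0 e * t'" by (simp only: mult.assoc[symmetric])
  then have "u = t * mat2 f 0 0 e * t'" by (simp add: t(1))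
  moreover have "entry i j u \<in> S" for i j
    using a s c by (simp add: u_def add diff minus scaleR one adjoint)
  ultimately have g: "entry i j (t * mat2 1 0 0 (- 1) * t') \<in> S" for i j
    by (intro dichotomy_involution_mem[OF _ t _ de decay])
  \<comment> \<open>The projection is half the sum of identity and reflection. It is the column (1;
    x) times the row (y, -z), so \<open>x\<close> appears in its entries only inside
    products.\<close>
  define y where "y = 1 + z * x"
  have "t * mat2 1 0 0 1 * t' = 1" by (simp add: mat2_one t)
  moreover have "(1/2) *\<^sub>R (t * mat2 1 0 0 1 * t' + t * mat2 1 0 0 (- 1) * t')
      = t * ((1/2) *\<^sub>R (mat2 1 0 0 1 + mat2 1 0 0 (- 1))) * t'"
    by (simp add: algebra_simps)
  moreover have "(1/2) *\<^sub>R (mat2 1 0 0 1 + mat2 1 0 0 (- 1)) = mat2 (1 :: 'v endo) 0 0 0"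
    by (simp add: mat2_add mat2_scaleR flip: scaleR_2)
  moreover have "t * mat2 1 0 0 0 * t' = mat2 y (- z) (x * y) (x * (- z))"
    by (simp add: t_def t'_def mat2_mult y_def)
  ultimately have "mat2 y (- z) (x * y) (x * (- z)) = (1/2) *\<^sub>R (1 + t * mat2 1 0 0 (- 1) * t')"
    by metis
  then have P: "entry i j (mat2 y (- z) (x * y) (x * (- z))) \<in> S" for i j
    using g[of i j] by (simp add: entry_scaleR entry_add entry_one scaleR add one zero)
  have y: "y \<in> S" "x * y \<in> S" and z': "- z \<in> S" "x * (- z) \<in> S"
    using P[of False False] P[of True False] P[of False True] P[of True True] by simp_all
  \<comment> \<open>\<open>k\<close> is the row (y, -z) times its adjoint. The projection times its
    own adjoint has first column \<open>k\<close>, \<open>x * k\<close>, which puts both into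
    \<open>S\<close>.\<close>
  define k where "k = y * y\<^sup>\<dagger> + (- z) * (- z)\<^sup>\<dagger>"
  have kS: "k \<in> S" unfolding k_def by (intro add mult adjoint y z')
  have "x * k = (x * y) * y\<^sup>\<dagger> + (x * (- z)) * (- z)\<^sup>\<dagger>" by (simp add: k_def algebra_simps)
  also have "\<dots> \<in> S" by (intro add mult adjoint y z')
  finally have xk: "x * k \<in> S" .
  have "coercive_endo k"
    unfolding coercive_endo_def
  proof (intro exI conjI allI)
    let ?B = "2 * (1 + (norm x)\<^sup>2)"
    have B: "0 < ?B" by (simp add: add_pos_nonneg)
    then show "0 < 1 / ?B" by simp
    fix v
    define v1 where "v1 = norm (y\<^sup>\<dagger> \<cdot> v)"
    define v2 where "v2 = norm ((- z)\<^sup>\<dagger> \<cdot> v)"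
    \<comment> \<open>The row (y, -z) maps the column (1; x) to 1. The adjoint of this identity
      recovers \<open>v\<close> from its images under \<open>y\<^sup>\<dagger>\<close> and
      \<open>(- z)\<^sup>\<dagger>\<close>, hence coercivity.\<close>
    have "y\<^sup>\<dagger> + x * (- z)\<^sup>\<dagger> = 1" using x(1) by (simp add: y_def)
    then have "v = y\<^sup>\<dagger> \<cdot> v + x \<cdot> (- z)\<^sup>\<dagger> \<cdot> v" by (metis app.add_left app_mult app_one)
    then have "norm v = norm (y\<^sup>\<dagger> \<cdot> v + x \<cdot> (- z)\<^sup>\<dagger> \<cdot> v)" by (rule arg_cong)
    then have "norm v \<le> v1 + norm x * v2"
      using norm_triangle_ineq[of "y\<^sup>\<dagger> \<cdot> v" "x \<cdot> (- z)\<^sup>\<dagger> \<cdot> v"] norm_app_le[of x "(- z)\<^sup>\<dagger> \<cdot> v"]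
      unfolding v1_def v2_def by linarith
    then have "(norm v)\<^sup>2 \<le> (v1 + norm x * v2)\<^sup>2" by (intro power_mono) auto
    also have "\<dots> \<le> 2 * v1\<^sup>2 + 2 * (norm x)\<^sup>2 * v2\<^sup>2"
      using sum_squares_bound[of v1 "norm x * v2"] by (simp add: power2_sum power_mult_distrib algebra_simps)
    also have "\<dots> \<le> ?B * (v1\<^sup>2 + v2\<^sup>2)" by (simp add: algebra_simps)
    also have "v1\<^sup>2 + v2\<^sup>2 = inner (k \<cdot> v) v"
      unfolding v1_def v2_def power2_norm_eq_inner k_def
      by (simp add: inner_add_left inner_adjoint')
    finally show "1 / ?B * (norm v)\<^sup>2 \<le> inner (k \<cdot> v) v" using B by (simp add: field_simps)
  qed
  then obtain k' where k': "k' \<in> S" "k * k' = 1" using coercive_inverse_mem[OF kS] by metis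
  have "x = (x * k) * k'" by (simp add: mult.assoc k')
  then show ?thesis using xk k' mult by metis
qed

end

section \<open>Positive square roots\<close>

lemma positive_endo_app_zero:
  assumes "positive_endo a" and "inner (a \<cdot> x) x = 0"
  shows "a \<cdot> x = 0"
  using positive_endo_square_le[OF assms(1) order_refl, of x] assms(2) by simp

text \<open>By \<open>positive_endo_square_le\<close>, \<open>j = 1 - a / M\<close> is a
  contraction, so the binomial series in \<open>j\<close> applies. Being a power series, the root
  commutes with everything that commutes with \<open>a\<close>, as the uniqueness argument
  requires.\<close>

lemma positive_sqrt_exists:
  fixes a :: "'v::hilbert_space endo"
  assumes a: "positive_endo a"
  obtains c where "positive_endo c" "c * c = a" "\<And>b. a * b = b * a \<Longrightarrow> c * b = b * c"
proof -
  define M where "M = norm a + 1"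
  have M: "0 < M" "norm a \<le> M" by (auto simp: M_def add_nonneg_pos)
  define j where "j = 1 - (1 / M) *\<^sub>R a"
  have "norm (j \<cdot> x) \<le> 1 * norm x" for x
  proof -
    have "(norm (j \<cdot> x))\<^sup>2 = (norm x)\<^sup>2 - 2 / M * inner (a \<cdot> x) x + (norm (a \<cdot> x))\<^sup>2 / M\<^sup>2"
      unfolding power2_norm_eq_inner j_def
      by (simp add: inner_diff_left inner_diff_right inner_commute power2_eq_square)
    also have "(norm (a \<cdot> x))\<^sup>2 / M\<^sup>2 \<le> M * inner (a \<cdot> x) x / M\<^sup>2"
      by (intro divide_right_mono positive_endo_square_le a M) simp
    also have "M * inner (a \<cdot> x) x / M\<^sup>2 = 1 / M * inner (a \<cdot> x) x" by (simp add: power2_eq_square)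
    also have "(norm x)\<^sup>2 - 2 / M * inner (a \<cdot> x) x + 1 / M * inner (a \<cdot> x) x
        = (norm x)\<^sup>2 - inner (a \<cdot> x) x / M"
      by simp
    also have "\<dots> \<le> (norm x)\<^sup>2" using a M by (simp add: positive_endo_def)
    finally show ?thesis by (simp add: abs_le_square_iff[symmetric])
  qed
  then have j: "norm j \<le> 1" by (intro norm_endo_bound) auto
  define s where "s = sqrt_series j"
  define c where "c = sqrt M *\<^sub>R s"
  have "j\<^sup>\<dagger> = j" using a by (simp add: j_def positive_endo_def)
  then have sym: "s\<^sup>\<dagger> = s"
    unfolding s_def sqrt_series_def
    by (subst adjoint_suminf) (simp_all add: summable_sqrt_series j adjoint_power)
  have "0 \<le> inner (s \<cdot> x) x" for x
  proof -
    have "- inner ((s - 1) \<cdot> x) x \<le> norm (s - 1) * norm x * norm x"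
      using inner_app_le[of "s - 1" x "- x"] by simp
    also have "\<dots> \<le> 1 * norm x * norm x"
      using norm_sqrt_series_diff_one_le[OF j] j
      by (intro mult_right_mono) (auto simp: s_def)
    also have "\<dots> = inner x x" by (simp flip: power2_norm_eq_inner power2_eq_square)
    finally show ?thesis by (simp add: inner_diff_left)
  qed
  then have "positive_endo c" using sym M by (simp add: positive_endo_def c_def)
  moreover have "c * c = a"
    using M sqrt_series_square[OF j] by (simp add: c_def s_def j_def)
  moreover have "c * b = b * c" if "a * b = b * a" for b
  proof -
    have "j * b = b * j" using that by (simp add: j_def algebra_simps)
    then show ?thesis using sqrt_series_commute[OF j] by (simp add: c_def s_def)
  qed
  ultimately show ?thesis using that by blast
qed

text \<open>With u = (c - d) x, the vanishing form of (c - d)(c + d)(c - d) at x is the sum of the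
  forms of \<open>c\<close> and \<open>d\<close> at u. Both operators then annihilate u, so |u|^2 is
  the inner product of (c - d) u with x, which is 0.\<close>

lemma positive_sqrt_unique:
  fixes c d :: "'v::hilbert_space endo"
  assumes c: "positive_endo c" and d: "positive_endo d" and eq: "c * c = d * d" and comm: "c * d = d * c"
  shows "c = d"
proof (rule endo_eqI)
  fix x
  define u where "u = (c - d) \<cdot> x"
  have "(c - d) * ((c + d) * (c - d)) = 0"
    using eq comm by (simp add: algebra_simps)
  then have "0 = inner (((c - d) * ((c + d) * (c - d))) \<cdot> x) x" by (simp only: app_simps inner_zero_left)
  also have "\<dots> = inner (c \<cdot> u) u + inner (d \<cdot> u) u"
    using c d unfolding app_mult[of "c - d"] inner_adjoint'[of "c - d"]
    by (simp only: u_def adjoint_simps positive_endo_def app_mult app_simps)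
      (simp add: inner_add_left inner_diff_left)
  finally have "inner (c \<cdot> u) u = 0" "inner (d \<cdot> u) u = 0"
    using c d unfolding positive_endo_def by (smt (verit))+
  then have "c \<cdot> u = 0" "d \<cdot> u = 0" using positive_endo_app_zero c d by blast+
  then have "inner ((c - d) \<cdot> u) x = 0" by simp
  then have "inner u u = 0"
    using c d inner_adjoint'[of "c - d" u x] by (simp add: positive_endo_def u_def)
  then show "c \<cdot> x = d \<cdot> x" by (simp add: u_def)
qed

section \<open>Operators on \<open>\<ell>\<^sup>2\<close>\<close>

instance ell2 :: (type) hilbert_space
proof
  have "coord (single undefined 1) (undefined :: 'a) \<noteq> coord 0 undefined"
    by (simp add: single.rep_eq zero_ell2.rep_eq)
  then show "\<exists>x :: 'a ell2. x \<noteq> 0" by metis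
qed

abbreviation op_endo :: "'i op \<Rightarrow> 'i ell2 endo" where "op_endo \<equiv> of_blinfun"

lemma to_of_blinfun [simp]: "to_blinfun (op_endo a) = a"
  by (simp add: of_blinfun_inverse)

lemma op_endo_eq_iff [simp]: "op_endo a = op_endo b \<longleftrightarrow> a = b"
  by (metis to_of_blinfun)

lemma app_op_endo [simp]: "op_endo a \<cdot> x = blinfun_apply a x"
  by (simp add: app_def)

lemma norm_op_endo [simp]: "norm (op_endo a) = norm a"
  by (simp add: norm_endo.rep_eq)

lemma op_endo_compose: "op_endo (a o\<^sub>L b) = op_endo a * op_endo b"
  and op_endo_add: "op_endo (a + b) = op_endo a + op_endo b"
  and op_endo_diff: "op_endo (a - b) = op_endo a - op_endo b"
  and op_endo_zero: "op_endo 0 = 0"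
  and op_endo_scaleR: "op_endo (r *\<^sub>R a) = r *\<^sub>R op_endo a"
  by (rule endo_eqI; simp add: blinfun.bilinear_simps)+

section \<open>Complex scalars and complex adjoints\<close>

lemma of_real_cscale: "of_real r *\<^sub>c x = r *\<^sub>R x"
  by (rule ell2_eqI) (simp add: cscale.rep_eq scaleR_ell2.rep_eq scaleR_conv_of_real)

lemma scale_op_of_real: "scale_op (of_real r) a = r *\<^sub>R a"
  by (rule blinfun_eqI) (simp add: of_real_cscale blinfun.bilinear_simps)

text \<open>Elements of \<open>endo\<close> are only real-linear; complex linearity becomes
  commutation with every \<open>cmult c\<close>.\<close>

definition cmult :: "complex \<Rightarrow> 'i ell2 endo"
  where "cmult c = endo ((*\<^sub>c) c)"

lemma app_cmult [simp]: "cmult c \<cdot> x = c *\<^sub>c x"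
  by (simp add: cmult_def app_endo bounded_linear_cscale)

abbreviation unit_endo :: "'i set \<Rightarrow> 'i ell2 endo" where "unit_endo G \<equiv> op_endo (id_op G)"

lemma unit_endo_idem: "unit_endo G * unit_endo G = unit_endo G"
  by (rule endo_eqI, rule ell2_eqI) (simp add: restrict_ell2.rep_eq)

lemma bounded_ops_iff:
  "T \<in> bounded_ops G \<longleftrightarrow> (\<forall>c. op_endo T * cmult c = cmult c * op_endo T) \<and> unit_endo G * op_endo T = op_endo T \<and> op_endo T * unit_endo G = op_endo T"
proof -
  have "id_op G o\<^sub>L T o\<^sub>L id_op G = T \<longleftrightarrow> unit_endo G * op_endo T * unit_endo G = op_endo T"
    by (simp flip: op_endo_compose)
  also have "\<dots> \<longleftrightarrow> unit_endo G * op_endo T = op_endo T \<and> op_endo T * unit_endo G = op_endo T"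
    by (metis unit_endo_idem mult.assoc)
  moreover have "(\<forall>x. blinfun_apply T (c *\<^sub>c x) = c *\<^sub>c blinfun_apply T x) \<longleftrightarrow> op_endo T * cmult c = cmult c * op_endo T" for c
    by (metis (no_types, lifting) app_op_endo app_cmult app_mult endo_eqI)
  ultimately show ?thesis unfolding bounded_ops_def by auto
qed

lemma inner_restrict_ell2: "inner (restrict_ell2 G x) y = inner x (restrict_ell2 G y)"
  unfolding inner_ell2_def cinner_def
  by (intro arg_cong[where f = Re] infsum_cong) (simp add: restrict_ell2.rep_eq)

lemma unit_endo_adjoint [simp]: "(unit_endo G)\<^sup>\<dagger> = unit_endo G"
  by (rule adjoint_eqI) (simp add: inner_restrict_ell2)

lemma cinner_cscale_right: "cinner x (c *\<^sub>c y) = cnj c * cinner x y"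
  unfolding cinner_def
  by (subst infsum_cmult_right'[symmetric]) (simp add: cscale.rep_eq mult_ac)

lemma cinner_cscale_left: "cinner (c *\<^sub>c x) y = c * cinner x y"
  unfolding cinner_def
  by (subst infsum_cmult_right'[symmetric]) (simp add: cscale.rep_eq mult_ac)

text \<open>Both parts are real inner products, so adjoint identities pass to \<open>cinner\<close>
  for operators commuting with \<open>cmult \<i>\<close>.\<close>

lemma cinner_eq: "cinner x y = Complex (inner x y) (inner x (\<i> *\<^sub>c y))"
  by (simp add: inner_ell2_def cinner_cscale_right complex_eq_iff)

lemma cmult_adjoint: "(cmult c)\<^sup>\<dagger> = cmult (cnj c)"
  by (rule adjoint_eqI) (simp add: inner_ell2_def cinner_cscale_right cinner_cscale_left)

lemma adjoint_cmult_commute: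
  assumes "\<And>c. a * cmult c = cmult c * a"
  shows "a\<^sup>\<dagger> * cmult c = cmult c * a\<^sup>\<dagger>"
proof -
  have "(a * cmult (cnj c))\<^sup>\<dagger> = (cmult (cnj c) * a)\<^sup>\<dagger>" using assms by simp
  then show ?thesis by (simp add: cmult_adjoint)
qed

text \<open>The real adjoint commutes with complex scalars because \<open>T\<close> does, so it
  satisfies the complex identity defining \<open>adj\<close>; real parts give uniqueness.\<close>

lemma op_endo_adj:
  assumes "T \<in> bounded_ops G"
  shows "op_endo (adj T) = (op_endo T)\<^sup>\<dagger>"
proof -
  have comm: "op_endo T * cmult c = cmult c * op_endo T" for c using assms by (simp add: bounded_ops_iff)
  have "adj T = to_blinfun ((op_endo T)\<^sup>\<dagger>)"
    unfolding adj_def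
  proof (rule the_equality)
    have ap: "blinfun_apply (to_blinfun b) y = b \<cdot> y" for b :: "'a ell2 endo" and y
      by (simp add: app_def)
    show "\<forall>x y. cinner (blinfun_apply T x) y = cinner x (blinfun_apply (to_blinfun ((op_endo T)\<^sup>\<dagger>)) y)"
    proof (intro allI)
      fix x y
      have "(op_endo T)\<^sup>\<dagger> \<cdot> (\<i> *\<^sub>c y) = \<i> *\<^sub>c ((op_endo T)\<^sup>\<dagger> \<cdot> y)"
        using adjoint_cmult_commute[OF comm, of \<i>] by (metis app_cmult app_mult)
      then show "cinner (blinfun_apply T x) y = cinner x (blinfun_apply (to_blinfun ((op_endo T)\<^sup>\<dagger>)) y)"
        using inner_adjoint'[of "op_endo T" x] by (simp add: cinner_eq ap)
    qed
    fix S assume "\<forall>x y. cinner (blinfun_apply T x) y = cinner x (blinfun_apply S y)"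
    then have "(op_endo T)\<^sup>\<dagger> = op_endo S" by (intro adjoint_eqI) (simp add: inner_ell2_def)
    then show "S = to_blinfun ((op_endo T)\<^sup>\<dagger>)" by simp
  qed
  then show ?thesis by (simp add: to_blinfun_inverse)
qed

section \<open>Positivity and square roots relative to a coordinate subspace\<close>

lemma norm_ell2_split: "(norm x)\<^sup>2 = (norm (restrict_ell2 G x))\<^sup>2 + (norm (x - restrict_ell2 G x))\<^sup>2"
proof -
  have "inner (restrict_ell2 G x) (x - restrict_ell2 G x) = inner x (restrict_ell2 G (x - restrict_ell2 G x))"
    by (rule inner_restrict_ell2)
  also have "restrict_ell2 G (x - restrict_ell2 G x) = 0"
    by (rule ell2_eqI) (simp add: restrict_ell2.rep_eq minus_ell2.rep_eq zero_ell2.rep_eq)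
  finally have 0: "inner (restrict_ell2 G x) (x - restrict_ell2 G x) = 0" by simp
  have "(norm (restrict_ell2 G x + (x - restrict_ell2 G x)))\<^sup>2
      = (norm (restrict_ell2 G x))\<^sup>2 + (norm (x - restrict_ell2 G x))\<^sup>2"
    by (rule norm_add_Pythagorean) (simp add: 0 orthogonal_def)
  then show ?thesis by simp
qed

lemma restrict_ell2_mem: "restrict_ell2 G x \<in> ell2_on G"
  by (simp add: ell2_on_def restrict_ell2.rep_eq)

lemma inner_bounded_op:
  assumes "T \<in> bounded_ops G"
  shows "inner (op_endo T \<cdot> x) x = Re (cinner (blinfun_apply T (restrict_ell2 G x)) (restrict_ell2 G x))"
proof -
  have "op_endo T = unit_endo G * (op_endo T * unit_endo G)" using assms by (simp add: bounded_ops_iff)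
  then have "op_endo T \<cdot> x = restrict_ell2 G (blinfun_apply T (restrict_ell2 G x))"
    by (metis app_op_endo app_mult id_op_apply)
  then show ?thesis by (simp add: inner_restrict_ell2 inner_ell2_def[symmetric])
qed

lemma positive_op_iff:
  "positive_op G T \<longleftrightarrow> T \<in> bounded_ops G \<and> positive_endo (op_endo T)"
proof (cases "T \<in> bounded_ops G")
  case True
  have res: "restrict_ell2 G x = x" if "x \<in> ell2_on G" for x
    using that by (intro ell2_eqI) (auto simp: ell2_on_def restrict_ell2.rep_eq)
  have "adj T = T \<longleftrightarrow> (op_endo T)\<^sup>\<dagger> = op_endo T" using op_endo_adj[OF True] by (metis op_endo_eq_iff)
  moreover have "(\<forall>x\<in>ell2_on G. 0 \<le> Re (cinner (blinfun_apply T x) x)) \<longleftrightarrow> (\<forall>x. 0 \<le> inner (op_endo T \<cdot> x) x)"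
    unfolding inner_bounded_op[OF True] using restrict_ell2_mem res by metis
  ultimately show ?thesis using True by (simp add: positive_op_def positive_endo_def)
qed (simp add: positive_op_def)

text \<open>The summand \<open>1 - unit_endo G\<close> compensates the kernel off \<open>G\<close>:
  by Pythagoras the two forms combine with constant \<open>min c 1\<close>.\<close>

lemma strictly_positive_opD:
  assumes "strictly_positive_op G T"
  shows "(op_endo T)\<^sup>\<dagger> = op_endo T" "coercive_endo (op_endo T + (1 - unit_endo G))"
proof -
  have T: "T \<in> bounded_ops G" "adj T = T" using assms by (auto simp: strictly_positive_op_def)
  show "(op_endo T)\<^sup>\<dagger> = op_endo T" using op_endo_adj[OF T(1)] T(2) by simp
  obtain c where c: "0 < c" "\<And>x. x \<in> ell2_on G \<Longrightarrow> c * (norm x)\<^sup>2 \<le> Re (cinner (blinfun_apply T x) x)"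
    using assms by (auto simp: strictly_positive_op_def)
  show "coercive_endo (op_endo T + (1 - unit_endo G))"
    unfolding coercive_endo_def
  proof (intro exI conjI allI)
    show "0 < min c 1" using c by simp
    fix x
    define y where "y = restrict_ell2 G x"
    have "inner ((op_endo T + (1 - unit_endo G)) \<cdot> x) x = inner (op_endo T \<cdot> x) x + inner (x - y) x"
      by (simp add: inner_add_left y_def)
    also have "inner (x - y) x = (norm (x - y))\<^sup>2"
      using norm_ell2_split[of x G] inner_restrict_ell2[of G x "x - y"]
      by (simp add: y_def power2_norm_eq_inner inner_diff_left inner_diff_right inner_commute)
    finally have eq: "inner ((op_endo T + (1 - unit_endo G)) \<cdot> x) x = inner (op_endo T \<cdot> x) x + (norm (x - y))\<^sup>2" .
    have "min c 1 * (norm x)\<^sup>2 = min c 1 * (norm y)\<^sup>2 + min c 1 * (norm (x - y))\<^sup>2"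
      using norm_ell2_split[of x G] by (simp add: y_def distrib_left)
    also have "\<dots> \<le> c * (norm y)\<^sup>2 + 1 * (norm (x - y))\<^sup>2"
      by (intro add_mono mult_right_mono) auto
    also have "c * (norm y)\<^sup>2 \<le> inner (op_endo T \<cdot> x) x"
      unfolding inner_bounded_op[OF T(1)] y_def by (intro c restrict_ell2_mem)
    finally show "min c 1 * (norm x)\<^sup>2 \<le> inner ((op_endo T + (1 - unit_endo G)) \<cdot> x) x"
      unfolding eq by simp
  qed
qed

lemma sqrt_op_properties:
  assumes "positive_op G Q"
  shows "positive_op G (sqrt_op G Q)" "sqrt_op G Q o\<^sub>L sqrt_op G Q = Q"
proof -
  have Q: "Q \<in> bounded_ops G" "positive_endo (op_endo Q)" using assms by (auto simp: positive_op_iff)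
  obtain c where c: "positive_endo c" "c * c = op_endo Q" "\<And>b. op_endo Q * b = b * op_endo Q \<Longrightarrow> c * b = b * c"
    using positive_sqrt_exists[OF Q(2)] by blast
  have Q': "unit_endo G * op_endo Q = op_endo Q" "op_endo Q * unit_endo G = op_endo Q" "\<And>z. op_endo Q * cmult z = cmult z * op_endo Q"
    using Q(1) by (auto simp: bounded_ops_iff)
  \<comment> \<open>\<open>c * c = Q\<close> kills the complement, and the squared norm of
    \<open>c \<cdot> y\<close> is the form of \<open>c * c\<close> at \<open>y\<close>.\<close>
  have "c * (1 - unit_endo G) = 0"
  proof (rule endo_eqI)
    fix x
    let ?y = "(1 - unit_endo G) \<cdot> x"
    have "c * c * (1 - unit_endo G) = 0" using Q' by (simp add: c algebra_simps)
    then have "c \<cdot> c \<cdot> ?y = 0" by (metis app.zero_left app_mult)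
    then have "inner (c \<cdot> ?y) (c \<cdot> ?y) = 0"
      using c(1) inner_adjoint'[of c ?y "c \<cdot> ?y"] by (simp only: positive_endo_def inner_zero_right)
    then show "(c * (1 - unit_endo G)) \<cdot> x = 0 \<cdot> x" by (simp only: app_mult inner_eq_zero_iff app_simps)
  qed
  then have ce: "c * unit_endo G = c" by (simp add: algebra_simps)
  moreover have "unit_endo G * c = c" using c(3)[of "unit_endo G"] Q' ce by simp
  ultimately have "to_blinfun c \<in> bounded_ops G"
    using c(3)[OF Q'(3)] by (simp add: bounded_ops_iff to_blinfun_inverse)
  then have pos: "positive_op G (to_blinfun c)" using c(1) by (simp add: positive_op_iff to_blinfun_inverse)
  have sq: "to_blinfun c o\<^sub>L to_blinfun c = Q"
    using c(2) by (simp add: to_blinfun_inverse flip: op_endo_eq_iff op_endo_compose) (simp add: op_endo_compose to_blinfun_inverse)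
  have uniq: "S = to_blinfun c" if "positive_op G S" "S o\<^sub>L S = Q" for S
  proof -
    have S: "positive_endo (op_endo S)" "op_endo S * op_endo S = op_endo Q" using that by (simp_all add: positive_op_iff flip: op_endo_compose)
    \<comment> \<open>Any root \<open>S\<close> commutes with its square \<open>Q\<close>, hence
      with \<open>c\<close>.\<close>
    have "c * op_endo S = op_endo S * c" by (rule c(3)) (simp add: S(2)[symmetric] mult.assoc)
    then have "c = op_endo S" using positive_sqrt_unique[OF c(1) S(1)] c(2) S(2) by simp
    then show ?thesis by simp
  qed
  have "sqrt_op G Q = to_blinfun c"
    unfolding sqrt_op_def by (rule the_equality) (use pos sq uniq in blast)+
  then show "positive_op G (sqrt_op G Q)" "sqrt_op G Q o\<^sub>L sqrt_op G Q = Q" using pos sq by simp_all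
qed

section \<open>Exponentials and stability relative to a coordinate subspace\<close>

lemma bounded_linear_op_endo: "bounded_linear op_endo"
  by (rule bounded_linear_intro[where K = 1]) (simp_all add: op_endo_add op_endo_scaleR)

lemma bounded_linear_to_blinfun: "bounded_linear to_blinfun"
  by (rule bounded_linear_intro[where K = 1]) (simp_all add: plus_endo.rep_eq scaleR_endo.rep_eq norm_endo.rep_eq)

text \<open>The series of \<open>exp_op\<close> starts at \<open>id_op G\<close>, so every term is
  the usual one times the projection on the right.\<close>

lemma op_endo_exp_op: "op_endo (exp_op G T) = exp (op_endo T) * unit_endo G"
proof -
  define f where "f n = (((o\<^sub>L) T) ^^ n) (id_op G) /\<^sub>R fact n" for n
  have pow: "op_endo ((((o\<^sub>L) T) ^^ n) (id_op G)) = op_endo T ^ n * unit_endo G" for n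
    by (induction n) (simp_all add: op_endo_compose mult.assoc)
  have f: "op_endo (f n) = (op_endo T ^ n /\<^sub>R fact n) * unit_endo G" for n
    by (simp add: f_def op_endo_scaleR pow)
  have sm: "summable (\<lambda>n. op_endo T ^ n /\<^sub>R fact n)" by (rule summable_exp_generic)
  have "summable (\<lambda>n. op_endo (f n))" unfolding f by (rule summable_mult2[OF sm])
  then have "summable (\<lambda>n. to_blinfun (op_endo (f n)))" by (rule bounded_linear.summable[OF bounded_linear_to_blinfun])
  then have "op_endo (suminf f) = (\<Sum>n. op_endo (f n))" by (intro bounded_linear.suminf[OF bounded_linear_op_endo]) simp
  also have "\<dots> = (\<Sum>n. op_endo T ^ n /\<^sub>R fact n) * unit_endo G" unfolding f by (rule suminf_mult2[OF sm, symmetric])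
  finally show ?thesis by (simp add: exp_op_def f_def[abs_def] exp_def)
qed

lemma exp_mult_cong:
  fixes a b p :: "'a::{real_normed_algebra_1, banach}"
  assumes "\<And>n. a ^ n * p = b ^ n * p"
  shows "exp a * p = exp b * p"
  unfolding exp_def
  by (simp add: suminf_mult2[OF summable_exp_generic] assms)

text \<open>Off \<open>\<ell>\<^sup>2(G)\<close> the extended generator is \<open>-1\<close>, hence stable.\<close>

lemma exp_stable_extended:
  assumes T: "T \<in> bounded_ops G" and stable: "exp_stable G T"
  obtains t where "0 \<le> t" "(norm (exp (t *\<^sub>R (op_endo T - (1 - unit_endo G)))))\<^sup>2 \<le> 1/2"
proof -
  obtain M \<alpha> where M: "0 < \<alpha>" "\<And>t. 0 \<le> t \<Longrightarrow> norm (exp_op G (t *\<^sub>R T)) \<le> M * exp (- \<alpha> * t)"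
    using stable by (auto simp: exp_stable_def)
  define e where "e = unit_endo G"
  define a where "a = op_endo T"
  have e: "e * e = e" "e * a = a" "a * e = a"
    using T by (auto simp: e_def a_def unit_endo_idem bounded_ops_iff)
  define m where "m = a - (1 - e)"
  \<comment> \<open>\<open>m\<close> acts as \<open>a\<close> on the range of \<open>e\<close> and
    as -1 on that of \<open>1 - e\<close>; both are invariant, so the exponential is evaluated on
    each.\<close>
  have le: "norm (exp (t *\<^sub>R m)) \<le> M * exp (- \<alpha> * t) + exp (- t) * norm (1 - e)" if "0 \<le> t" for t
  proof -
    have "(t *\<^sub>R m) ^ n * e = (t *\<^sub>R a) ^ n * e \<and> e * ((t *\<^sub>R a) ^ n * e) = (t *\<^sub>R a) ^ n * e" for n
    proof (induction n)
      case (Suc n)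
      define p where "p = (t *\<^sub>R a) ^ n * e"
      have p: "(t *\<^sub>R m) ^ n * e = p" "e * p = p" using Suc by (auto simp: p_def)
      have "m * p = a * p" using p(2) by (simp add: m_def algebra_simps)
      moreover have "e * (a * p) = a * p" by (simp add: e flip: mult.assoc)
      moreover have "(t *\<^sub>R m) ^ Suc n * e = (t *\<^sub>R m) * p" "(t *\<^sub>R a) ^ Suc n * e = (t *\<^sub>R a) * p"
        by (simp_all only: power_Suc mult.assoc p flip: p_def)
      ultimately show ?case by simp
    qed (simp add: e)
    then have "exp (t *\<^sub>R m) * e = exp (t *\<^sub>R a) * e" by (intro exp_mult_cong) blast
    then have 1: "exp (t *\<^sub>R m) * e = op_endo (exp_op G (t *\<^sub>R T))" by (simp add: op_endo_exp_op op_endo_scaleR a_def e_def)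
    have m_e: "m * (1 - e) = - (1 - e)" by (simp add: m_def e algebra_simps)
    have "(t *\<^sub>R m) ^ n * (1 - e) = (- t) ^ n *\<^sub>R (1 - e)" for n
    proof (induction n)
      case (Suc n)
      have "(t *\<^sub>R m) ^ Suc n * (1 - e) = (t *\<^sub>R m) * ((t *\<^sub>R m) ^ n * (1 - e))"
        by (simp only: power_Suc mult.assoc)
      also have "\<dots> = ((- t) ^ n * t) *\<^sub>R (m * (1 - e))" unfolding Suc by simp
      finally show ?case unfolding m_e by (simp only: scaleR_minus_right power_Suc2) simp
    qed simp
    then have "(t *\<^sub>R m) ^ n * (1 - e) = of_real (- t) ^ n * (1 - e)" for n
      by (simp only: scaleR_conv_of_real of_real_power)
    then have "exp (t *\<^sub>R m) * (1 - e) = exp (of_real (- t)) * (1 - e)" by (rule exp_mult_cong)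
    then have 2: "exp (t *\<^sub>R m) * (1 - e) = exp (- t) *\<^sub>R (1 - e)"
      by (simp only: exp_of_real scaleR_conv_of_real)
    have "exp (t *\<^sub>R m) = exp (t *\<^sub>R m) * e + exp (t *\<^sub>R m) * (1 - e)" by (simp add: algebra_simps)
    then have "norm (exp (t *\<^sub>R m)) \<le> norm (op_endo (exp_op G (t *\<^sub>R T))) + norm (exp (- t) *\<^sub>R (1 - e))"
      unfolding 1 2 by (metis norm_triangle_ineq)
    then show ?thesis using M(2)[OF that] by simp
  qed
  have "((\<lambda>t. M * exp (- \<alpha> * t) + exp (- t) * norm (1 - e)) \<longlongrightarrow> M * 0 + 0 * norm (1 - e)) at_top"
    using M(1)
    by (intro tendsto_add tendsto_mult tendsto_const filterlim_compose[OF exp_at_bot]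
        filterlim_uminus_at_bot_at_top filterlim_tendsto_neg_mult_at_bot[OF tendsto_const] filterlim_ident) auto
  then have "\<forall>\<^sub>F t in at_top. M * exp (- \<alpha> * t) + exp (- t) * norm (1 - e) < 1/2"
    by (rule order_tendstoD(2)) simp
  then have "\<forall>\<^sub>F t in at_top. 0 \<le> t \<and> M * exp (- \<alpha> * t) + exp (- t) * norm (1 - e) < 1/2"
    using eventually_ge_at_top by (rule eventually_conj[rotated])
  then obtain t where t: "0 \<le> t" "M * exp (- \<alpha> * t) + exp (- t) * norm (1 - e) < 1/2"
    using eventually_happens by force
  then have "norm (exp (t *\<^sub>R m)) \<le> 1/2" using le[of t] by simp
  then have "(norm (exp (t *\<^sub>R m)))\<^sup>2 \<le> (1/2)\<^sup>2" by (intro power_mono) auto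
  also have "\<dots> \<le> 1/2" by (simp add: power2_eq_square)
  finally show ?thesis using that[OF t(1)] by (simp add: m_def a_def e_def)
qed

section \<open>Proper algebras\<close>

lemma inv_op_eqI:
  assumes S: "S \<in> bounded_ops G" "S o\<^sub>L T = id_op G" "T o\<^sub>L S = id_op G"
  shows "inv_op G T = S"
  unfolding inv_op_def
proof (rule the_equality)
  fix S' assume S': "S' \<in> bounded_ops G \<and> S' o\<^sub>L T = id_op G \<and> T o\<^sub>L S' = id_op G"
  have "op_endo S' = op_endo S' * (op_endo T * op_endo S)" using S' S by (simp add: bounded_ops_iff flip: op_endo_compose)
  also have "\<dots> = (op_endo S' * op_endo T) * op_endo S" by (simp only: mult.assoc)
  also have "\<dots> = op_endo S" using S' S by (simp add: bounded_ops_iff flip: op_endo_compose)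
  finally show "S' = S" by simp
qed (use S in simp)

context proper_q_Banach_algebra
begin

text \<open>
  Operators commuting with the projection onto \<open>\<ell>\<^sup>2(G)\<close> whose compression lies in the algebra; the part
  off \<open>\<ell>\<^sup>2(G)\<close> is arbitrary. This makes the identity operator available as a unit.
\<close>

definition extension :: "'i ell2 endo set"
  where "extension = {a. unit_endo G * a = a * unit_endo G \<and> to_blinfun (unit_endo G * a) \<in> \<A>}"

text \<open>The q-th power makes the q-triangle inequality plain subadditivity. The value is blind
  to the part off \<open>G\<close> and may vanish on nonzero elements.\<close>

definition compression_norm :: "'i ell2 endo \<Rightarrow> real"
  where "compression_norm a = N (to_blinfun (unit_endo G * a)) powr q"

lemma scaleR_mem: "A \<in> \<A> \<Longrightarrow> r *\<^sub>R A \<in> \<A>"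
  using scale_mem[of A "of_real r"] by (simp add: scale_op_of_real)

lemma N_scaleR: "A \<in> \<A> \<Longrightarrow> N (r *\<^sub>R A) = \<bar>r\<bar> * N A"
  using N_scale[of A "of_real r"] by (simp add: scale_op_of_real)

lemma diff_mem: "\<lbrakk>A \<in> \<A>; B \<in> \<A>\<rbrakk> \<Longrightarrow> A - B \<in> \<A>"
  using add_mem[of A "(-1) *\<^sub>R B"] scaleR_mem[of B "-1"] by simp

lemma mult_mem: "\<lbrakk>A \<in> \<A>; B \<in> \<A>\<rbrakk> \<Longrightarrow> A o\<^sub>L B \<in> \<A>"
  using ex_mult_bound by blast

text \<open>Since \<open>norm \<le> N\<close> on the algebra, limits in the q-norm are limits in
  operator norm; this links completeness to the condition \<open>closed\<close>.\<close>

lemma tendsto_of_N_tendsto: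
  assumes q: "0 < q" and S: "\<And>n. S n \<in> \<A>" and L: "L \<in> \<A>"
    and lim: "(\<lambda>n. N (S n - L) powr q) \<longlonglongrightarrow> 0"
  shows "S \<longlonglongrightarrow> L"
proof -
  have "(\<lambda>n. (N (S n - L) powr q) powr (1 / q)) \<longlonglongrightarrow> 0"
    by (rule tendsto_zero_powrI[OF lim tendsto_const]) (use q in auto)
  moreover have "(N (S n - L) powr q) powr (1 / q) = N (S n - L)" for n
    using q N_nonneg[OF diff_mem[OF S L], of n] by (simp add: powr_powr)
  ultimately have N: "(\<lambda>n. N (S n - L)) \<longlonglongrightarrow> 0" by simp
  have "(\<lambda>n. S n - L) \<longlonglongrightarrow> 0"
    by (rule Lim_null_comparison[OF _ N]) (simp add: norm_le_N diff_mem S L)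
  then show ?thesis by (rule LIM_zero_cancel)
qed

text \<open>For positive x, \<open>x powr q * (u / x) powr (q * \<theta>)\<close> equals
  \<open>(x powr q) powr (1 - \<theta>) * u powr (q * \<theta>)\<close>, which is monotone in both
  variables because \<theta> \<le> 1. The two summands give the factor 2.\<close>

lemma powr_differential:
  assumes q: "0 < q" and \<theta>: "0 < \<theta>" "\<theta> \<le> 1" and D: "0 < D"
    and le: "x powr q \<le> t" "y powr q \<le> t" "u \<le> m" "v \<le> m"
    and nn: "0 \<le> x" "0 \<le> y" "0 \<le> u" "0 \<le> v"
  shows "D * x powr q * y powr q * ((u / x) powr (q * \<theta>) + (v / y) powr (q * \<theta>))
    \<le> 2 * D * t powr (2 - \<theta>) * m powr (q * \<theta>)"
proof (cases "x = 0 \<or> y = 0")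
  case False
  have half: "x powr q * y powr q * (u / x) powr (q * \<theta>) \<le> t powr (2 - \<theta>) * m powr (q * \<theta>)"
    if "0 < x" "0 < y" "x powr q \<le> t" "y powr q \<le> t" "u \<le> m" "0 \<le> u" for x y u :: real
  proof -
    have "0 < x powr q" using that by simp
    then have t: "0 < t" using that by linarith
    have "x powr q * y powr q * (u / x) powr (q * \<theta>) = (x powr q) powr (1 - \<theta>) * y powr q * u powr (q * \<theta>)"
    proof -
      have "x powr q = (x powr q) powr (1 - \<theta>) * x powr (q * \<theta>)"
        using that by (simp add: powr_powr algebra_simps flip: powr_add)
      then have "x powr q * y powr q * (u / x) powr (q * \<theta>)
          = ((x powr q) powr (1 - \<theta>) * x powr (q * \<theta>)) * y powr q * (u / x) powr (q * \<theta>)"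
        by (rule arg_cong)
      also have "\<dots> = (x powr q) powr (1 - \<theta>) * y powr q * (x powr (q * \<theta>) * (u / x) powr (q * \<theta>))"
        by (simp only: mult_ac)
      also have "x powr (q * \<theta>) * (u / x) powr (q * \<theta>) = u powr (q * \<theta>)"
        using that by (simp flip: powr_mult)
      finally show ?thesis .
    qed
    also have "\<dots> \<le> t powr (1 - \<theta>) * t * m powr (q * \<theta>)"
      using that q \<theta> t by (intro mult_mono powr_mono2) auto
    also have "t powr (1 - \<theta>) * t = t powr (2 - \<theta>)"
      using t powr_mult_base[of t "1 - \<theta>"] by (simp add: mult.commute)
    finally show ?thesis .
  qed
  have "D * (x powr q * y powr q * (u / x) powr (q * \<theta>) + y powr q * x powr q * (v / y) powr (q * \<theta>))
      \<le> D * (t powr (2 - \<theta>) * m powr (q * \<theta>) + t powr (2 - \<theta>) * m powr (q * \<theta>))"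
    using False assms by (intro mult_left_mono add_mono half) auto
  then show ?thesis by (simp add: algebra_simps)
qed (use D in \<open>auto intro!: mult_nonneg_nonneg\<close>)

lemma differential_star_subalgebra_extension:
  assumes q: "0 < q"
  obtains \<theta> D K where "differential_star_subalgebra extension compression_norm q \<theta> D K"
proof -
  let ?e = "unit_endo G"
  let ?c = "\<lambda>a. to_blinfun (?e * a)"
  obtain \<theta> D where \<theta>: "0 < \<theta>" "\<theta> \<le> 1" and D: "0 < D" and diffl: "\<And>A B. \<lbrakk>A \<in> \<A>; B \<in> \<A>\<rbrakk> \<Longrightarrow>
      N (A o\<^sub>L B) powr q \<le> D * N A powr q * N B powr q
        * ((norm A / N A) powr (q * \<theta>) + (norm B / N B) powr (q * \<theta>))"
    using differential by blast
  obtain K where K: "0 < K" "\<And>A B. \<lbrakk>A \<in> \<A>; B \<in> \<A>\<rbrakk> \<Longrightarrow> N (A o\<^sub>L B) \<le> K * N A * N B"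
    using ex_mult_bound by blast
  have extI: "a \<in> extension" if "?e * a = a * ?e" "?c a \<in> \<A>" for a
    unfolding extension_def using that by blast
  have extD: "?e * a = a * ?e" "?c a \<in> \<A>" if "a \<in> extension" for a
    using that unfolding extension_def by blast+
  have c_mult: "?c (a * b) = ?c a o\<^sub>L ?c b" if "a \<in> extension" for a b
  proof -
    have "?e * (a * b) = (?e * ?e) * a * b" by (simp only: unit_endo_idem mult.assoc)
    also have "\<dots> = (?e * a) * (?e * b)" 
      using arg_cong[OF extD(1)[OF that], of "\<lambda>z. ?e * z * b"] by (simp only: mult.assoc)
    finally show ?thesis by (simp add: times_endo.rep_eq)
  qed
  have c_add: "?c (a + b) = ?c a + ?c b" and c_diff: "?c (a - b) = ?c a - ?c b"
    and c_scaleR: "?c (r *\<^sub>R a) = r *\<^sub>R ?c a" for a b r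
    by (simp_all add: distrib_left right_diff_distrib plus_endo.rep_eq minus_endo.rep_eq scaleR_endo.rep_eq)
  have norm_c: "norm (?c a) \<le> norm a" for a
  proof -
    have "norm ?e \<le> 1"
    proof (rule norm_endo_bound)
      fix x :: "'i ell2"
      show "norm (?e \<cdot> x) \<le> 1 * norm x"
        by (rule power2_le_imp_le) (simp_all add: norm_ell2_split[of x G])
    qed simp
    then have "norm ?e * norm a \<le> 1 * norm a" by (rule mult_right_mono) simp
    then show ?thesis using norm_mult_ineq[of ?e a] by (simp add: norm_endo.rep_eq)
  qed
  have "differential_star_subalgebra extension compression_norm q \<theta> (2 * D) (K powr q)"
  proof
    show "1 \<in> extension" using unit_mem by (simp add: extension_def)
    show "compression_norm 0 = 0"
      using N_eq_0_iff[OF zero_mem] by (simp add: compression_norm_def zero_endo.rep_eq)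
    fix a assume a: "a \<in> extension"
    show "r *\<^sub>R a \<in> extension" for r
      by (rule extI, simp add: extD(1)[OF a]) (simp only: c_scaleR scaleR_mem[OF extD(2)[OF a]])
    show "0 \<le> compression_norm a" by (simp add: compression_norm_def)
    show "compression_norm (r *\<^sub>R a) \<le> compression_norm a" if "\<bar>r\<bar> \<le> 1" for r
      unfolding compression_norm_def c_scaleR N_scaleR[OF extD(2)[OF a]]
      using that q N_nonneg[OF extD(2)[OF a]]
      by (intro powr_mono2 mult_left_le_one_le mult_nonneg_nonneg) auto
    show "a\<^sup>\<dagger> \<in> extension"
    proof -
      have "?e * a\<^sup>\<dagger> = (a * ?e)\<^sup>\<dagger>" "a\<^sup>\<dagger> * ?e = (?e * a)\<^sup>\<dagger>" by simp_all
      moreover have "to_blinfun ((?e * a)\<^sup>\<dagger>) = adj (?c a)"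
        using op_endo_adj[of "?c a" G] subset_bounded_ops extD(2)[OF a]
        by (metis subsetD to_blinfun_inverse to_of_blinfun)
      ultimately show ?thesis
        using extD[OF a] adj_mem[OF extD(2)[OF a]] by (simp only: extension_def mem_Collect_eq)
    qed
    fix b assume b: "b \<in> extension"
    show "a + b \<in> extension"
      by (rule extI, simp only: distrib_left distrib_right extD(1)[OF a] extD(1)[OF b])
        (simp only: c_add add_mem extD(2)[OF a] extD(2)[OF b])
    show "a * b \<in> extension"
    proof -
      have "?e * (a * b) = a * b * ?e" 
        by (simp only: mult.assoc[symmetric] extD(1)[OF a]) (simp only: mult.assoc extD(1)[OF b])
      then show ?thesis by (rule extI) (simp only: c_mult[OF a] mult_mem extD(2)[OF a] extD(2)[OF b])
    qed
    show "compression_norm (a + b) \<le> compression_norm a + compression_norm b"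
      unfolding compression_norm_def c_add by (intro N_triangle extD a b)
    show "compression_norm (a * b) \<le> K powr q * compression_norm a * compression_norm b"
    proof -
      have "N (?c a o\<^sub>L ?c b) powr q \<le> (K * N (?c a) * N (?c b)) powr q"
        using q by (intro powr_mono2 K N_nonneg mult_mem extD a b) auto
      then show ?thesis
        by (simp add: compression_norm_def c_mult a powr_mult)
    qed
    show "compression_norm (a * b) \<le> 2 * D * t powr (2 - \<theta>) * m powr (q * \<theta>)"
      if "compression_norm a \<le> t" "compression_norm b \<le> t" "norm a \<le> m" "norm b \<le> m" for t m
    proof -
      have "compression_norm (a * b) \<le> D * N (?c a) powr q * N (?c b) powr q
          * ((norm (?c a) / N (?c a)) powr (q * \<theta>) + (norm (?c b) / N (?c b)) powr (q * \<theta>))"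
        unfolding compression_norm_def c_mult[OF a] by (intro diffl extD a b)
      also have "\<dots> \<le> 2 * D * t powr (2 - \<theta>) * m powr (q * \<theta>)"
        using that norm_c[of a] norm_c[of b]
        by (intro powr_differential q \<theta> D N_nonneg extD a b norm_ge_zero) (auto simp: compression_norm_def)
      finally show ?thesis .
    qed
  next
    fix s l
    assume s: "\<And>n. s n \<in> extension" and cauchy: "\<And>e. 0 < e \<Longrightarrow> \<exists>M. \<forall>m\<ge>M. \<forall>n\<ge>M. compression_norm (s m - s n) < e"
      and lim: "s \<longlonglongrightarrow> l"
    \<comment> \<open>Completeness provides a limit \<open>L\<close> of the compressions inside the
      algebra; continuity in operator norm forces it to be the compression of
      \<open>l\<close>.\<close>
    obtain L where L: "L \<in> \<A>" "(\<lambda>n. N (?c (s n) - L) powr q) \<longlonglongrightarrow> 0"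
      using complete[of "\<lambda>n. ?c (s n)"] extD(2)[OF s] cauchy
      by (auto simp: compression_norm_def c_diff)
    have "(\<lambda>n. ?c (s n)) \<longlonglongrightarrow> L" by (rule tendsto_of_N_tendsto[OF q extD(2)[OF s] L])
    moreover have "(\<lambda>n. ?c (s n)) \<longlonglongrightarrow> ?c l"
      by (intro bounded_linear.tendsto[OF bounded_linear_to_blinfun] tendsto_mult tendsto_const lim)
    ultimately have "L = ?c l" by (rule LIMSEQ_unique)
    moreover have "?e * l = l * ?e"
    proof (rule LIMSEQ_unique)
      show "(\<lambda>n. ?e * s n) \<longlonglongrightarrow> ?e * l" by (intro tendsto_mult tendsto_const lim)
      have "(\<lambda>n. s n * ?e) \<longlonglongrightarrow> l * ?e" by (intro tendsto_mult tendsto_const lim)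
      then show "(\<lambda>n. ?e * s n) \<longlonglongrightarrow> l * ?e" by (simp only: extD(1)[OF s])
    qed
    ultimately show "l \<in> extension" using L(1) extI by simp
  qed (use q \<theta> D K in auto)
  then show ?thesis by (rule that)
qed

lemma op_endo_mem_extension: "A \<in> \<A> \<Longrightarrow> op_endo A \<in> extension"
  using subset_bounded_ops by (auto simp: extension_def bounded_ops_iff)

lemma complement_mem_extension: "1 - unit_endo G \<in> extension"
  using zero_mem by (simp add: extension_def algebra_simps unit_endo_idem zero_endo.rep_eq)

text \<open>On the complement of \<ell>^2(G) the generator is padded by 0 and the other Riccati data
  and the solution by 1, so the equation there reads -1 + 1 = 0 and the padded solution is coercive.
  Compression returns \<open>X\<close> at the end.\<close>

theorem riccati_gain_mem:
  assumes q: "0 < q" and mem: "A \<in> \<A>" "B \<in> \<A>" "Q \<in> \<A>" "R \<in> \<A>"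
    and Q: "positive_op G Q" and R: "strictly_positive_op G R" and X: "strictly_positive_op G X"
    and riccati: "(adj A o\<^sub>L X) + (X o\<^sub>L A) - (X o\<^sub>L B o\<^sub>L inv_op G R o\<^sub>L adj B o\<^sub>L X) + Q = 0"
    and detectable: "exp_detectable G A (sqrt_op G Q)"
  shows "- (inv_op G R o\<^sub>L adj B o\<^sub>L X) \<in> \<A>"
proof -
  obtain \<theta> D K where "differential_star_subalgebra extension compression_norm q \<theta> D K"
    using differential_star_subalgebra_extension[OF q] .
  then interpret ext: differential_star_subalgebra extension compression_norm q \<theta> D K .
  define e where "e = unit_endo G"
  define f where "f = 1 - e"
  have ef: "e * e = e" "f * f = f" "e * f = 0" "f * e = 0" "e + f = 1" "f\<^sup>\<dagger> = f" "e\<^sup>\<dagger> = e"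
    by (simp_all add: f_def e_def unit_endo_idem algebra_simps)
  have ops: "T \<in> bounded_ops G" if "T \<in> \<A>" for T using that subset_bounded_ops by auto
  have corner: "e * op_endo T = op_endo T" "op_endo T * e = op_endo T" "f * op_endo T = 0" "op_endo T * f = 0" if "T \<in> bounded_ops G" for T
    using that by (simp_all add: bounded_ops_iff e_def f_def algebra_simps)
  have f_mem: "f \<in> extension" using complement_mem_extension by (simp add: f_def e_def)
  have f_pos: "0 \<le> inner (f \<cdot> v) v" for v
  proof -
    have "inner (f \<cdot> v) v = inner (f \<cdot> f \<cdot> v) v" by (simp only: ef flip: app_mult)
    then show ?thesis by (simp add: inner_adjoint'[of f "f \<cdot> v"] ef(6))
  qed
  define a b where "a = op_endo A" and "b = op_endo B"
  have XB: "X \<in> bounded_ops G" using X by (simp add: strictly_positive_op_def)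

  note R' = strictly_positive_opD[OF R, folded e_def, folded f_def]
  \<comment> \<open>The padded \<open>R\<close> is coercive and so inverted inside
    \<open>extension\<close>; the compression of \<open>r\<close> inverts \<open>R\<close> on
    \<open>G\<close> and is \<open>inv_op G R\<close>.\<close>
  obtain r where r: "r \<in> extension" "(op_endo R + f) * r = 1" "r * (op_endo R + f) = 1"
    using ext.coercive_inverse_mem[OF ext.add[OF op_endo_mem_extension[OF mem(4)] f_mem] R'(2)] .
  have re: "e * r = r * e" and erA: "to_blinfun (e * r) \<in> \<A>" using r(1) by (auto simp: extension_def e_def)
  have "e * r * op_endo R = e" "op_endo R * (e * r) = e"
  proof -
    have R_eq: "op_endo R = e * (op_endo R + f)" "op_endo R = (op_endo R + f) * e"
      using corner[OF ops[OF mem(4)]] ef by (simp_all add: algebra_simps)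
    have "e * r * op_endo R = e * (r * (op_endo R + f)) * e" by (subst R_eq(2)) (simp only: mult.assoc)
    then show "e * r * op_endo R = e" by (simp add: r ef)
    have "op_endo R * (e * r) = e * (op_endo R + f) * (r * e)" using re R_eq(1) by simp
    also have "\<dots> = e * ((op_endo R + f) * r) * e" by (simp only: mult.assoc)
    finally show "op_endo R * (e * r) = e" by (simp add: r ef)
  qed
  then have "inv_op G R = to_blinfun (e * r)"
    by (intro inv_op_eqI ops[OF erA])
      (simp_all add: to_blinfun_inverse e_def flip: op_endo_eq_iff op_endo_compose, simp_all add: op_endo_compose to_blinfun_inverse e_def)
  then have Rinv: "op_endo (inv_op G R) = e * r" "inv_op G R \<in> \<A>" using erA by (simp_all add: to_blinfun_inverse)
  have r_sym: "r\<^sup>\<dagger> = r"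
  proof -
    have "r\<^sup>\<dagger> * (op_endo R + f) = 1" using arg_cong[OF r(2), of adjoint_endo] R'(1) ef(6) by simp
    then have "r\<^sup>\<dagger> * ((op_endo R + f) * r) = r" by (simp only: mult.assoc[symmetric] mult_1)
    then show ?thesis by (simp add: r)
  qed
  have r_pos: "0 \<le> inner (r \<cdot> v) v" for v
  proof -
    have v: "v = (op_endo R + f) \<cdot> r \<cdot> v" by (simp only: r app_one flip: app_mult)
    have "0 \<le> inner ((op_endo R + f) \<cdot> r \<cdot> v) (r \<cdot> v)"
      using R'(2) unfolding coercive_endo_def by (meson less_imp_le mult_nonneg_nonneg order_trans zero_le_power2)
    then show ?thesis unfolding v[symmetric] by (simp add: inner_commute)
  qed

  define s where "s = b * (e * r) * b\<^sup>\<dagger>"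
  have b: "b * e = b" "e * b = b" "b\<^sup>\<dagger> = op_endo (adj B)"
    using corner[OF ops[OF mem(2)]] op_endo_adj[OF ops[OF mem(2)]] by (simp_all add: b_def)
  have s_eq: "s = b * r * b\<^sup>\<dagger>" unfolding s_def using b(1) by (simp flip: mult.assoc)
  have s_pos: "positive_endo (s + f)"
    unfolding positive_endo_def
  proof (intro conjI allI)
    show "(s + f)\<^sup>\<dagger> = s + f" by (simp add: s_eq r_sym ef mult.assoc)
    fix v
    have "0 \<le> inner (r \<cdot> b\<^sup>\<dagger> \<cdot> v) (b\<^sup>\<dagger> \<cdot> v)" by (rule r_pos)
    also have "\<dots> = inner (s \<cdot> v) v" by (simp add: s_eq inner_adjoint'[of b])
    finally show "0 \<le> inner ((s + f) \<cdot> v) v" using f_pos[of v] by (simp add: inner_add_left)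
  qed
  have b_mem: "b \<in> extension" unfolding b_def by (rule op_endo_mem_extension[OF mem(2)])
  have s_mem: "s + f \<in> extension" unfolding s_eq by (intro ext.add ext.mult ext.adjoint r b_mem f_mem)

  define x where "x = op_endo X"
  have x: "e * x = x" "f * x = 0" "x * f = 0" using corner[OF XB] by (simp_all add: x_def)
  note X' = strictly_positive_opD[OF X, folded e_def, folded f_def x_def]
  define c where "c = op_endo (sqrt_op G Q)"
  have C: "sqrt_op G Q \<in> bounded_ops G" "c\<^sup>\<dagger> = c" "c * c = op_endo Q"
    using sqrt_op_properties[OF Q] unfolding positive_op_iff positive_endo_def c_def
    by (auto simp flip: op_endo_compose)
  have c: "c * f = 0" "f * c = 0" using corner[OF C(1)] by (simp_all add: c_def)
  have cf: "(c + f)\<^sup>\<dagger> * (c + f) = op_endo Q + f" using C(2,3) c ef by (simp add: algebra_simps)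
  obtain L where L: "L \<in> bounded_ops G" "exp_stable G (A + (L o\<^sub>L sqrt_op G Q))"
    using detectable by (auto simp: exp_detectable_def)
  define l where "l = op_endo L"
  have l: "l * f = 0" using corner[OF L(1)] by (simp add: l_def)
  have "A + (L o\<^sub>L sqrt_op G Q) \<in> bounded_ops G"
  proof -
    note * = ops[OF mem(1)] L(1) C(1)
    have "cmult z * (op_endo L * c) = op_endo L * c * cmult z" for z
      using * by (simp add: bounded_ops_iff c_def) (metis mult.assoc)
    then show ?thesis
      using * corner[OF *(1)] corner[OF *(2)] corner[OF *(3)]
      by (simp add: bounded_ops_iff op_endo_add op_endo_compose distrib_left distrib_right c_def mult.assoc e_def)
        (simp flip: mult.assoc)
  qed
  then obtain t where t: "0 \<le> t" "(norm (exp (t *\<^sub>R (op_endo (A + (L o\<^sub>L sqrt_op G Q)) - f))))\<^sup>2 \<le> 1/2"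
    using exp_stable_extended[OF _ L(2)] by (metis e_def f_def)
  \<comment> \<open>The extra gain \<open>- f\<close> meets the padded output \<open>f\<close> and
    moves the generator off \<open>G\<close> from 0 to -1.\<close>
  have gen: "op_endo (A + (L o\<^sub>L sqrt_op G Q)) - f = a + (l - f) * (c + f)"
    using l c ef by (simp add: op_endo_add op_endo_compose a_def l_def c_def algebra_simps)
  have a: "a * f = 0" "f * a = 0" "a\<^sup>\<dagger> = op_endo (adj A)" "a\<^sup>\<dagger> * f = 0"
  proof -
    show "a * f = 0" "f * a = 0" "a\<^sup>\<dagger> = op_endo (adj A)"
      using corner[OF ops[OF mem(1)]] op_endo_adj[OF ops[OF mem(1)]] by (simp_all add: a_def)
    have "(f * a)\<^sup>\<dagger> = 0" using \<open>f * a = 0\<close> by simp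
    then show "a\<^sup>\<dagger> * f = 0" by (simp add: ef(6))
  qed
  have ric0: "a\<^sup>\<dagger> * x + x * a - x * s * x + op_endo Q = 0"
    using arg_cong[OF riccati, of op_endo]
    by (simp add: op_endo_add op_endo_diff op_endo_compose op_endo_zero Rinv s_def a b x_def mult.assoc flip: a_def b_def)
  have xsx: "(x + f) * (s + f) * (x + f) = x * s * x + f"
  proof -
    have "f * s = 0" "s * f = 0"
    proof -
      have "f * b = 0" using b(2) ef by (metis mult.assoc mult_zero_left)
      then show "f * s = 0" by (simp add: s_eq flip: mult.assoc)
      have "(f * b)\<^sup>\<dagger> = 0" using \<open>f * b = 0\<close> by simp
      then have "b\<^sup>\<dagger> * f = 0" by (simp add: ef(6))
      then show "s * f = 0" by (simp add: s_eq mult.assoc)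
    qed
    then show ?thesis using x ef by (simp add: algebra_simps)
  qed
  have ric: "a\<^sup>\<dagger> * (x + f) + (x + f) * a - (x + f) * (s + f) * (x + f) + (c + f)\<^sup>\<dagger> * (c + f) = 0"
    unfolding cf xsx using ric0 a(2,4) by (simp add: distrib_left distrib_right)
  have "x + f \<in> extension"
  proof (rule ext.riccati_solution_mem[OF _ s_mem s_pos _ _ X'(2) ric t(1) t(2)[unfolded gen]])
    show "a \<in> extension" unfolding a_def by (rule op_endo_mem_extension[OF mem(1)])
    show "(c + f)\<^sup>\<dagger> * (c + f) \<in> extension"
      unfolding cf by (intro ext.add op_endo_mem_extension mem f_mem)
    show "(x + f)\<^sup>\<dagger> = x + f" using X'(1) ef(6) by simp
  qed
  then have "to_blinfun (e * (x + f)) \<in> \<A>" unfolding extension_def e_def by blast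
  moreover have "e * (x + f) = x" by (simp add: distrib_left x(1) ef(3))
  ultimately have "X \<in> \<A>" by (simp add: x_def)
  then have "inv_op G R o\<^sub>L adj B o\<^sub>L X \<in> \<A>" by (intro mult_mem Rinv adj_mem mem)
  then show ?thesis using scaleR_mem[of _ "-1"] by simp
qed

end

theorem corollary9p1:
  fixes G :: "(int ^ 'd) set" and q :: real
    and \<A> :: "(int ^ 'd) op set" and N :: "(int ^ 'd) op \<Rightarrow> real"
    and A B Q R X :: "(int ^ 'd) op"
  assumes "0 < q" and "q \<le> 1"
    and "proper_q_Banach_algebra G q \<A> N"
    and "A \<in> \<A>" and "B \<in> \<A>" and "Q \<in> \<A>" and "R \<in> \<A>"
    and "positive_op G Q" and "strictly_positive_op G R"
    and "strictly_positive_op G X"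
    and "(adj A o\<^sub>L X) + (X o\<^sub>L A) - (X o\<^sub>L B o\<^sub>L inv_op G R o\<^sub>L adj B o\<^sub>L X) + Q = 0"
    and "(exp_stabilizable G A B \<and> exp_detectable G A (sqrt_op G Q)
            \<and> (\<exists>Y\<in>bounded_ops G. adj Y = Y
                 \<and> (A o\<^sub>L Y) + (Y o\<^sub>L adj A) - (Y o\<^sub>L Q o\<^sub>L Y) + (B o\<^sub>L inv_op G R o\<^sub>L adj B) = 0
                 \<and> invertible_op G (id_op G + (Y o\<^sub>L X))))
         \<or> (approx_controllable G A B \<and> exp_detectable G A (sqrt_op G Q))"
  shows "- (inv_op G R o\<^sub>L adj B o\<^sub>L X) \<in> \<A>"
proof -
  interpret proper_q_Banach_algebra G q \<A> N by fact
  show ?thesis by (rule riccati_gain_mem) (use assms in blast)+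
qed

end
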